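(* There exist positive absolute (numerical) constants $\sigma^\star<1$ (sufficiently small), $c_0$, $\kappa_0$, $\rho^\star>1$, $\alpha_0$, $c_1$, $\gamma_1$, $\gamma_2$ such that the following holds. Let the data $\mathbf{Y}=[\mathbf{y}_1,\dots,\mathbf{y}_N]\in\mathbb{R}^{n\times N}$ be generated by the semirandom noisy subspace model (defined in the context) with subspaces $S_1,\dots,S_L\subset\mathbb{R}^n$ of dimensions $d_1,\dots,d_L$, with $N_1,\dots,N_L$ points per subspace, sampling densities $\rho_\ell=N_\ell/d_\ell$ satisfying $\rho_\ell\le e^{d_\ell/2}$ for all $\ell$, and noise level $\sigma$, where $$0<\sigma<\sigma^\star \quad\text{and}\quad \max_{\ell} d_\ell< c_0\,\frac{n}{(\log N)^2}.$$ Fix $i\in\{1,\dots,N\}$, let $S_\ell$ be the subspace from which $\mathbf{y}_i$ originates, and write $d(i)=d_\ell$, $N(i)=N_\ell$, $\rho(i)=\rho_\ell$. Assume that $S_\ell$ satisfies the affinity condition $$\max_{k:\,k\neq \ell}\operatorname{aff}(S_\ell,S_k)\le \frac{\kappa_0}{\log N}$$ and the sampling condition $\rho_\ell\ge\rho^\star$. Run the two-step procedure (defined in the context) on column $i$ with $\tau=2\sigma$ and a deterministic function $f:(0,\infty)\to(0,\infty)$ obeying $$0.707\,\sigma\, t^{-1}\le f(t)\le \alpha_0\, t^{-1}\quad\text{for all } t>0,$$ and let $\mathbf{B}_i=\hat{\boldsymbol\beta}\in\mathbb{R}^N$ be its output. Then, with probability at least $$1-2e^{-\gamma_1 n}-6e^{-\gamma_2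 d(i)}-e^{-\sqrt{N(i)d(i)}}-\frac{23}{N^2},$$ there are at least $$c_1\,\frac{d(i)}{\log\rho(i)}$$ true discoveries in the $i$th column of $\mathbf{B}$; that is, at least $c_1 d(i)/\log\rho(i)$ indices $j$ such that $\hat\beta_j\neq0$ and $\mathbf{y}_j$ originates from the same subspace as $\mathbf{y}_i$.
   Context: Semirandom noisy subspace model. $S_1,\dots,S_L$ are fixed linear subspaces of $\mathbb{R}^n$ with $\dim S_\ell=d_\ell\ge1$. The index set $\{1,\dots,N\}$ is partitioned (deterministically) into $L$ groups, the $\ell$th of size $N_\ell$, with $N=N_1+\dots+N_L\geq 2$. For each index $j$ in group $\ell$, the observed point is $\mathbf{y}_j=\mathbf{x}_j+\mathbf{z}_j$, where $\mathbf{x}_j$ is uniformly distributed on the unit sphere $\{\mathbf{x}\in S_\ell:\|\mathbf{x}\|_{\ell_2}=1\}$ of $S_\ell$, and $\mathbf{z}_j\in\mathbb{R}^n$ has i.i.d. $\mathcal{N}(0,\sigma^2/n)$ entries; all the $\mathbf{x}_j$'s and $\mathbf{z}_j$'s are mutually independent. One says that $\mathbf{y}_j$ originates from $S_\ell$. The sampling density of $S_\ell$ is $\rho_\ell=N_\ell/d_\ell$. Affinity. For subspaces $S,S'$ of dimensions $d,d'$ with matrices $\mathbf{U},\mathbf{V}$ whose columns are orthonormal bases of $S,S'$, the cosines of the principal angles $\theta^{(1)},\dots,\theta^{(d\wedge d')}$ are the singular values of $\mathbf{U}^T\mathbf{V}$, and $$\operatorname{aff}(S,S')=\sqrt{\frac{\cos^2\theta^{(1)}+\cdots+\cos^2\theta^{(d\wedge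 d')}}{d\wedge d'}}.$$ Two-step procedure for column $i$ (with parameters $\tau$ and $f$): 1. Let $\boldsymbol\beta^\star$ be a solution of $\min_{\boldsymbol\beta\in\mathbb{R}^N}\|\boldsymbol\beta\|_{\ell_1}$ subject to $\|\mathbf{y}_i-\mathbf{Y}\boldsymbol\beta\|_{\ell_2}\le\tau$ and $\beta_i=0$. 2. Set $\lambda=f(\|\boldsymbol\beta^\star\|_{\ell_1})$. 3. Let $\hat{\boldsymbol\beta}$ be a solution of $\min_{\boldsymbol\beta\in\mathbb{R}^N}\frac12\|\mathbf{y}_i-\mathbf{Y}\boldsymbol\beta\|_{\ell_2}^2+\lambda\|\boldsymbol\beta\|_{\ell_1}$ subject to $\beta_i=0$. 4. Set the $i$th column of $\mathbf{B}$ to be $\mathbf{B}_i=\hat{\boldsymbol\beta}$. (If step 1 is infeasible or $\boldsymbol\beta^\star=\mathbf{0}$, the output is assigned by an arbitrary fixed convention.) A true discovery in column $i$ is an index $j$ with $\hat\beta_j\ne0$ such that $\mathbf{y}_i$ and $\mathbf{y}_j$ originate from the same subspace. "Numerical constants" are absolute: they do not depend on $n,N,L$, the subspaces, their dimensions, the $N_\ell$, $\sigma$, $f$ or $i$. *)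

theory Defs
  imports
    "HOL-Probability.Probability"
    "Jordan_Normal_Form.VS_Connect"
    "Jordan_Normal_Form.Char_Poly"
begin

(* HOL-Analysis and Jordan_Normal_Form share several names; below, "vec", "mat", "$" etc. are those
   of Jordan_Normal_Form. The ambient dimension n is quantified inside the theorem, after the
   numerical constants, so R^n is carrier_vec n rather than a type. *)
hide_type (open) Finite_Cartesian_Product.vec
hide_const (open) Finite_Cartesian_Product.vec Finite_Cartesian_Product.mat
no_notation vec_nth (infixl \<open>$\<close> 90)

definition l1norm :: "real vec \<Rightarrow> real" where
  "l1norm v = (\<Sum>i<dim_vec v. \<bar>v $ i\<bar>)"

definition l2norm :: "real vec \<Rightarrow> real" where
  "l2norm v = sqrt (scalar_prod v v)"

definition linear_subspace :: "nat \<Rightarrow> real vec set \<Rightarrow> bool" where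
  "linear_subspace n S \<longleftrightarrow> VectorSpace.subspace class_ring S (module_vec TYPE(real) n)"

definition subspace_dim :: "nat \<Rightarrow> real vec set \<Rightarrow> nat" where
  "subspace_dim n S = vectorspace.dim class_ring (module_vec TYPE(real) n\<lparr>carrier := S\<rparr>)"

definition is_orthonormal_basis :: "nat \<Rightarrow> real vec set \<Rightarrow> real mat \<Rightarrow> bool" where
  "is_orthonormal_basis n S U \<longleftrightarrow>
     dim_row U = n \<and> U\<^sup>T * U = 1\<^sub>m (dim_col U) \<and> vec_space.col_space n U = S"

(* An arbitrary orthonormal basis. Neither the affinity nor the uniform law on the sphere, which are
   defined with it, depends on which one is chosen. *)
definition orthonormal_basis :: "nat \<Rightarrow> real vec set \<Rightarrow> real mat" where
  "orthonormal_basis n S = (SOME U. is_orthonormal_basis n S U)"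

(* The min (dim_row A) (dim_col A) singular values in decreasing order: square roots of the largest
   eigenvalues of A^T A, counted with multiplicity. If A has more columns than rows, the
   dim_col A - dim_row A eigenvalues that are dropped are zeros. *)
definition singular_values :: "real mat \<Rightarrow> real list" where
  "singular_values A =
     take (min (dim_row A) (dim_col A))
       (rev (sorted_list_of_multiset (image_mset sqrt (proots (char_poly (A\<^sup>T * A))))))"

definition principal_cosines :: "nat \<Rightarrow> real vec set \<Rightarrow> real vec set \<Rightarrow> real list" where
  "principal_cosines n S S' =
     singular_values ((orthonormal_basis n S)\<^sup>T * orthonormal_basis n S')"

definition affinity :: "nat \<Rightarrow> real vec set \<Rightarrow> real vec set \<Rightarrow> real" where
  "affinity n S S' =
     sqrt ((\<Sum>c\<leftarrow>principal_cosines n S S'. c\<^sup>2) / real (min (subspace_dim n S) (subspace_dim n S')))"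

definition borel_vec :: "nat \<Rightarrow> real vec measure" where
  "borel_vec n =
     vimage_algebra (carrier_vec n) (\<lambda>v. \<lambda>k\<in>{..<n}. v $ k) (\<Pi>\<^sub>M k\<in>{..<n}. borel)"

definition lborel_vec :: "nat \<Rightarrow> real vec measure" where
  "lborel_vec n = distr (\<Pi>\<^sub>M k\<in>{..<n}. lborel) (borel_vec n) (vec n)"

(* Normalised surface measure of the unit sphere of S. As usual the surface measure of a set E of
   unit vectors is proportional to the volume of the cone {r x | 0 < r <= 1, x in E}; equivalently it
   is the law of v / |v| for v uniform in the unit ball. An orthonormal basis identifies S
   with R^d. *)
definition uniform_sphere :: "nat \<Rightarrow> real vec set \<Rightarrow> real vec measure" where
  "uniform_sphere n S =
     (let U = orthonormal_basis n S; d = dim_col U in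
      distr (uniform_measure (lborel_vec d) {v \<in> carrier_vec d. l2norm v \<le> 1}) (borel_vec n)
        (\<lambda>v. U *\<^sub>v ((1 / l2norm v) \<cdot>\<^sub>v v)))"

(* normal_density takes the standard deviation, so each entry has variance sigma^2 / n *)
definition gaussian_noise :: "nat \<Rightarrow> real \<Rightarrow> real vec measure" where
  "gaussian_noise n \<sigma> =
     distr (\<Pi>\<^sub>M k\<in>{..<n}. density lborel (normal_density 0 (\<sigma> / sqrt (real n)))) (borel_vec n) (vec n)"

(* Points have the indices 0, ..., N - 1, and grp j is the index of the subspace from which point j
   originates. This is the joint law of the pairs (x_j, z_j); a canonical sample space is
   used because quantifying over sample spaces of arbitrary type would let the numerical constants
   depend on that type. *)
definition semirandom_model ::
  "nat \<Rightarrow> nat \<Rightarrow> (nat \<Rightarrow> real vec set) \<Rightarrow> (nat \<Rightarrow> nat) \<Rightarrow> real \<Rightarrow> (nat \<Rightarrow> real vec \<times> real vec) measure"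
  where
  "semirandom_model n N S grp \<sigma> =
     (\<Pi>\<^sub>M j\<in>{..<N}. uniform_sphere n (S (grp j)) \<Otimes>\<^sub>M gaussian_noise n \<sigma>)"

definition data_matrix :: "nat \<Rightarrow> nat \<Rightarrow> (nat \<Rightarrow> real vec \<times> real vec) \<Rightarrow> real mat" where
  "data_matrix n N \<omega> = mat_of_cols n (map (\<lambda>j. fst (\<omega> j) + snd (\<omega> j)) [0..<N])"

definition step1_feasible :: "real mat \<Rightarrow> nat \<Rightarrow> real \<Rightarrow> real vec \<Rightarrow> bool" where
  "step1_feasible Y i \<tau> \<beta> \<longleftrightarrow>
     \<beta> \<in> carrier_vec (dim_col Y) \<and> l2norm (col Y i - Y *\<^sub>v \<beta>) \<le> \<tau> \<and> \<beta> $ i = 0"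

definition step1_solution :: "real mat \<Rightarrow> nat \<Rightarrow> real \<Rightarrow> real vec \<Rightarrow> bool" where
  "step1_solution Y i \<tau> \<beta> \<longleftrightarrow> is_arg_min l1norm (step1_feasible Y i \<tau>) \<beta>"

definition step3_solution :: "real mat \<Rightarrow> nat \<Rightarrow> real \<Rightarrow> real vec \<Rightarrow> bool" where
  "step3_solution Y i lam \<beta> \<longleftrightarrow>
     is_arg_min (\<lambda>b. (l2norm (col Y i - Y *\<^sub>v b))\<^sup>2 / 2 + lam * l1norm b)
       (\<lambda>b. b \<in> carrier_vec (dim_col Y) \<and> b $ i = 0) \<beta>"

(* beta is a possible output of the two-step procedure for column i. Minimisers need not be unique,
   hence a relation. conv is the fixed convention for the degenerate cases: step 1 infeasible, or
   its solution is 0. *)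
definition two_step_output ::
  "(real mat \<Rightarrow> real vec) \<Rightarrow> real mat \<Rightarrow> nat \<Rightarrow> real \<Rightarrow> (real \<Rightarrow> real) \<Rightarrow> real vec \<Rightarrow> bool" where
  "two_step_output conv Y i \<tau> f \<beta> \<longleftrightarrow>
     (\<exists>\<beta>s. step1_solution Y i \<tau> \<beta>s \<and> \<beta>s \<noteq> 0\<^sub>v (dim_col Y) \<and> step3_solution Y i (f (l1norm \<beta>s)) \<beta>) \<or>
     ((\<nexists>b. step1_feasible Y i \<tau> b) \<or> step1_solution Y i \<tau> (0\<^sub>v (dim_col Y))) \<and> \<beta> = conv Y"

definition true_discoveries :: "(nat \<Rightarrow> nat) \<Rightarrow> nat \<Rightarrow> real vec \<Rightarrow> nat set" where
  "true_discoveries grp i \<beta> = {j. j < dim_vec \<beta> \<and> \<beta> $ j \<noteq> 0 \<and> grp j = grp i}"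

end

theory Submission
  imports Defs "Jordan_Normal_Form.Schur_Decomposition"
begin

text \<open>
  Let \<open>d = d(i)\<close> and let \<open>P\<close> be the orthogonal projection onto the subspace of \<open>x\<^sub>i\<close>. A well-conditioned set of
  \<open>10\<^sup>1\<^sup>2 d\<close> points of the same group represents \<open>x\<^sub>i\<close> with coefficients of small \<open>\<ell>\<^sub>2\<close> norm, so the first step
  is feasible and \<open>|\<beta>\<^sup>\<star>|\<^sub>1 = O(sqrt d)\<close>. Comparing the minimizer of the second step with \<open>\<beta>\<^sup>\<star>\<close> shows that its \<open>\<ell>\<^sub>1\<close>
  norm is \<open>O(sqrt d)\<close> as well and that its residual is a small constant, by the two bounds on \<open>f\<close>.

  By the affinity condition the points of the other groups satisfy \<open>|P y\<^sub>j| \<le> W\<close> with \<open>W\<close> of order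
  \<open>\<kappa>\<^sub>0 / sqrt (ln N)\<close>. By Maurey's argument their contribution to the projected fit is, up to a small error, a
  combination of \<open>s\<close> of them with \<open>s ln N\<close> a small multiple of \<open>d\<close>. Hence, if there were fewer than \<open>c\<^sub>1 d / ln \<rho>\<close>
  true discoveries, \<open>P x\<^sub>i\<close> would be close to the span of so few of the \<open>P y\<^sub>j\<close> that the number of possible spans
  is only \<open>exp (\<epsilon> d)\<close>. As the direction of \<open>x\<^sub>i\<close> is uniform and independent of these spans, this has
  probability at most \<open>3 exp (- d / 4)\<close>. No dual certificate is needed, and false discoveries are not excluded.
\<close>

section \<open>Euclidean norms, nets and sparse approximation\<close>

text \<open>The obstacle is that the selected points depend on x_i, whereas uniformity of its
  direction can be used only against spans fixed beforehand; the price is a union bound over all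
  candidate spans, and the hypotheses keep it at exp (eps d). A uniform unit vector of another
  subspace has a projection of mean square at most aff^2. Control of all N points at once costs a
  factor sqrt (ln N), so affinity kappa_0 / ln N gives the order of W, and d < c_0 n / (ln N)^2 puts
  the projected noise on the same scale. For an l1 norm of order sqrt d, Maurey needs s of order d
  W^2, that is kappa_0^2 d / ln N, and about N^s = exp (kappa_0^2 d) choices arise. Likewise c_1 d /
  ln rho discoveries among about rho d points leave exp (O (c_1 d)) choices, which explains ln rho.
  A span of m vectors comes within 1/4 of a random direction with probability at most C^m 2^(-d), so
  m may be a small fraction of d. As many as 10^12 points per dimension represent x_i so that the l2
  norm of the coefficients, and with it the noise they collect, fits into tau = 2 sigma.\<close>

lemma L2_set_sum_le: "L2_set (\<lambda>i. \<Sum>j\<in>J. f j i) A \<le> (\<Sum>j\<in>J. L2_set (f j) A)"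
proof (induction J rule: infinite_finite_induct)
  case (insert x F)
  have "L2_set (\<lambda>i. f x i + (\<Sum>j\<in>F. f j i)) A \<le> L2_set (f x) A + L2_set (\<lambda>i. \<Sum>j\<in>F. f j i) A"
    by (rule L2_set_triangle_ineq)
  with insert show ?case by simp
qed (auto simp: L2_set_def)

lemma L2_set_scale: "L2_set (\<lambda>i. c * f i) A = \<bar>c\<bar> * L2_set f A"
  by (simp add: L2_set_def power_mult_distrib real_sqrt_mult flip: sum_distrib_left)

lemma L2_set_power2: "(L2_set f A)\<^sup>2 = (\<Sum>i\<in>A. (f i)\<^sup>2)"
  by (simp add: L2_set_def sum_nonneg)

lemma L2_set_le_iff: "0 \<le> c \<Longrightarrow> L2_set f A \<le> c \<longleftrightarrow> (\<Sum>i\<in>A. (f i)\<^sup>2) \<le> c\<^sup>2"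
  by (metis L2_set_nonneg L2_set_power2 power2_le_imp_le power_mono)

lemma abs_inner_le_L2_set: "\<bar>\<Sum>i\<in>A. u i * v i\<bar> \<le> L2_set u A * L2_set v A"
proof -
  have "\<bar>\<Sum>i\<in>A. u i * v i\<bar> \<le> (\<Sum>i\<in>A. \<bar>u i\<bar> * \<bar>v i\<bar>)"
    by (rule order_trans[OF sum_abs]) (simp add: abs_mult)
  also have "\<dots> \<le> L2_set u A * L2_set v A" by (rule L2_set_mult_ineq)
  finally show ?thesis .
qed

lemma L2_set_minus_commute: "L2_set (\<lambda>i. u i - v i) A = L2_set (\<lambda>i. v i - u i) A"
  by (simp add: L2_set_def power2_commute)

lemma L2_set_triangle_diff: "L2_set u A \<le> L2_set v A + L2_set (\<lambda>i. u i - v i) A"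
  using L2_set_triangle_ineq[of v "\<lambda>i. u i - v i" A] by simp

lemma sum_abs_le_sqrt_L2_set:
  assumes "finite A"
  shows "(\<Sum>i\<in>A. \<bar>u i\<bar>) \<le> sqrt (real (card A)) * L2_set u A"
  using L2_set_mult_ineq[of "\<lambda>_. 1::real" u A] by (simp add: L2_set_def)

section \<open>Lattice points and nets of the unit ball\<close>

lemma sum_half_powers: "(\<Sum>k\<in>{- int K..int K}. (1/2::real) ^ nat \<bar>k\<bar>) = 3 - 2 * (1/2) ^ K"
proof (induction K)
  case (Suc K)
  have "{- int (Suc K)..int (Suc K)} = insert (- int (Suc K)) (insert (int (Suc K)) {- int K..int K})" by auto
  then show ?case using Suc by (simp add: nat_add_distrib)
qed simp

text \<open>Weighted by \<open>2\<^sup>-\<^sup>|\<^sup>k\<^sup>|\<close>, every point of the set counts at least \<open>2\<^sup>-\<^sup>M\<close>, and the total weight of all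
  integer points factorizes.\<close>
lemma card_int_points_l1:
  fixes M K D :: nat
  defines "P \<equiv> {k \<in> PiE {..<D} (\<lambda>_. {- int K..int K}). (\<Sum>i<D. nat \<bar>k i\<bar>) \<le> M}"
  shows "finite P" "real (card P) \<le> 3 ^ D * 2 ^ M"
proof -
  have fin: "finite (PiE {..<D} (\<lambda>_. {- int K..int K}))" by (intro finite_PiE) auto
  then show "finite P" unfolding P_def by auto
  have "real (card P) * (1/2) ^ M = (\<Sum>k\<in>P. (1/2) ^ M)" by simp
  also have "\<dots> \<le> (\<Sum>k\<in>P. \<Prod>i<D. (1/2) ^ nat \<bar>k i\<bar>)"
  proof (rule sum_mono)
    fix k assume "k \<in> P"
    then have "(\<Sum>i<D. nat \<bar>k i\<bar>) \<le> M" unfolding P_def by auto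
    then have "(1/2::real) ^ M \<le> (1/2) ^ (\<Sum>i<D. nat \<bar>k i\<bar>)" by (intro power_decreasing) auto
    then show "(1/2::real) ^ M \<le> (\<Prod>i<D. (1/2) ^ nat \<bar>k i\<bar>)" by (simp add: power_sum)
  qed
  also have "\<dots> \<le> (\<Sum>k\<in>PiE {..<D} (\<lambda>_. {- int K..int K}). \<Prod>i<D. (1/2) ^ nat \<bar>k i\<bar>)"
  proof (rule sum_mono2[OF fin])
    show "P \<subseteq> PiE {..<D} (\<lambda>_. {- int K..int K})" unfolding P_def by blast
  qed (rule prod_nonneg, simp)
  also have "\<dots> = (\<Prod>i<D. \<Sum>k\<in>{- int K..int K}. (1/2) ^ nat \<bar>k\<bar>)"
    by (subst prod_sum_PiE) auto
  also have "\<dots> \<le> 3 ^ D"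
  proof -
    have "(\<Sum>k\<in>{- int K..int K}. (1/2::real) ^ nat \<bar>k\<bar>) \<le> 3" by (simp add: sum_half_powers)
    then have "(\<Prod>i<D. \<Sum>k\<in>{- int K..int K}. (1/2::real) ^ nat \<bar>k\<bar>) \<le> (\<Prod>i<D. 3)"
      by (intro prod_mono) (auto intro: sum_nonneg)
    then show ?thesis by simp
  qed
  finally have "real (card P) * (1/2) ^ M \<le> 3 ^ D" .
  moreover have "(1/2::real) ^ M = 1 / 2 ^ M" by (rule power_one_over)
  ultimately have "real (card P) / 2 ^ M \<le> 3 ^ D" by simp
  then show "real (card P) \<le> 3 ^ D * 2 ^ M" by (simp add: pos_divide_le_eq)
qed

text \<open>Rounding coordinates down to multiples of h = 1 / (E sqrt D) moves a point by at most h
  sqrt D = 1 / E. The integer vectors that occur have l1 norm at most sqrt D / h + D = D (E + 1),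
  and the lattice point count gives 3^D 2^(D (E + 1)). The net points themselves may lie outside the
  unit ball.\<close>

lemma net_exists:
  fixes D E :: nat
  assumes E: "0 < E"
  obtains Q :: "(nat \<Rightarrow> real) set" where "finite Q" "real (card Q) \<le> (6 * 2 ^ E) ^ D"
    "\<And>u. L2_set u {..<D} \<le> 1 \<Longrightarrow> \<exists>q\<in>Q. L2_set (\<lambda>i. u i - q i) {..<D} \<le> 1 / real E"
proof (cases "D = 0")
  case True
  then show ?thesis by (intro that[of "{\<lambda>_. 0}"]) auto
next
  case False
  define h where "h = 1 / (real E * sqrt (real D))"
  have h: "h > 0" unfolding h_def using E False by simp
  define M where "M = D * (E + 1)"
  define P where "P = {k \<in> PiE {..<D} (\<lambda>_. {- int M..int M}). (\<Sum>i<D. nat \<bar>k i\<bar>) \<le> M}"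
  note P = card_int_points_l1[where D=D and K=M and M=M, folded P_def]
  let ?Q = "(\<lambda>k i. h * real_of_int (k i)) ` P"
  show ?thesis
  proof (rule that[of ?Q])
    show "finite ?Q" using P by simp
    have "real (card ?Q) \<le> real (card P)" using P by (simp add: card_image_le)
    also have "\<dots> \<le> 3 ^ D * 2 ^ M" by (rule P)
    also have "\<dots> = (6 * 2 ^ E) ^ D"
    proof -
      have "(6 * 2 ^ E :: real) = 3 * 2 ^ (E + 1)" by simp
      then have "(6 * 2 ^ E :: real) ^ D = 3 ^ D * (2 ^ (E + 1)) ^ D" by (simp only: power_mult_distrib)
      also have "(2 ^ (E + 1) :: real) ^ D = 2 ^ M" unfolding M_def by (subst power_mult[symmetric]) (simp add: mult.commute)
      finally show ?thesis by simp
    qed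
    finally show "real (card ?Q) \<le> (6 * 2 ^ E) ^ D" .
    fix u assume u: "L2_set u {..<D} \<le> 1"
    define k where "k = (\<lambda>i\<in>{..<D}. \<lfloor>u i / h\<rfloor>)"
    have "(\<Sum>i<D. \<bar>u i\<bar>) \<le> sqrt (real D) * L2_set u {..<D}"
      using sum_abs_le_sqrt_L2_set[of "{..<D}" u] by simp
    also have "\<dots> \<le> sqrt (real D) * 1" using u by (intro mult_left_mono) auto
    finally have s1: "(\<Sum>i<D. \<bar>u i\<bar>) \<le> sqrt (real D)" by simp
    have "(\<Sum>i<D. real (nat \<bar>k i\<bar>)) \<le> (\<Sum>i<D. \<bar>u i\<bar> / h + 1)"
    proof (rule sum_mono)
      fix i assume "i \<in> {..<D}"
      then have "real (nat \<bar>k i\<bar>) = \<bar>real_of_int \<lfloor>u i / h\<rfloor>\<bar>" by (simp add: k_def)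
      also have "\<dots> \<le> \<bar>u i / h\<bar> + 1" by linarith
      finally show "real (nat \<bar>k i\<bar>) \<le> \<bar>u i\<bar> / h + 1" using h by (simp add: abs_divide)
    qed
    also have "\<dots> = (\<Sum>i<D. \<bar>u i\<bar>) / h + real D" by (simp add: sum.distrib sum_divide_distrib)
    also have "\<dots> \<le> sqrt (real D) / h + real D" using s1 h by (simp add: divide_right_mono)
    also have "\<dots> = real M" unfolding h_def M_def by (simp add: algebra_simps flip: real_sqrt_mult)
    finally have "real (\<Sum>i<D. nat \<bar>k i\<bar>) \<le> real M" by (simp only: of_nat_sum)
    then have sM: "(\<Sum>i<D. nat \<bar>k i\<bar>) \<le> M" by (simp only: of_nat_le_iff)
    have "k \<in> P"
    proof -
      have "k i \<in> {- int M..int M}" if "i < D" for i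
      proof -
        have "nat \<bar>k i\<bar> \<le> (\<Sum>i<D. nat \<bar>k i\<bar>)" using that by (intro member_le_sum) auto
        then have "nat \<bar>k i\<bar> \<le> M" using sM by linarith
        then show ?thesis by auto
      qed
      then show ?thesis unfolding P_def using sM by (auto simp: k_def PiE_def)
    qed
    moreover have "L2_set (\<lambda>i. u i - h * real_of_int (k i)) {..<D} \<le> 1 / real E"
    proof -
      have "(\<Sum>i<D. (u i - h * real_of_int (k i))\<^sup>2) \<le> (\<Sum>i<D. h\<^sup>2)"
      proof (rule sum_mono)
        fix i assume i: "i \<in> {..<D}"
        have "\<bar>u i / h - real_of_int \<lfloor>u i / h\<rfloor>\<bar> \<le> 1" by linarith
        then have "\<bar>h * (u i / h - real_of_int \<lfloor>u i / h\<rfloor>)\<bar> \<le> h" using h by (simp add: abs_mult)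
        then have "\<bar>u i - h * real_of_int (k i)\<bar> \<le> \<bar>h\<bar>" using h i by (simp add: k_def right_diff_distrib)
        then show "(u i - h * real_of_int (k i))\<^sup>2 \<le> h\<^sup>2" by (simp only: abs_le_square_iff)
      qed
      also have "\<dots> = (1 / real E)\<^sup>2" unfolding h_def using False by (simp add: power_mult_distrib power_divide)
      finally show ?thesis by (subst L2_set_le_iff) auto
    qed
    ultimately show "\<exists>q\<in>?Q. L2_set (\<lambda>i. u i - q i) {..<D} \<le> 1 / real E"
      by (intro bexI[of _ "\<lambda>i. h * real_of_int (k i)"]) auto
  qed
qed

text \<open>Maurey's empirical method with the random draws replaced by greedy ones:
  \<open>c j\<close> counts how often \<open>w j\<close> has been picked, and some pick is at least
  as good as the average over \<open>p\<close>, which raises the squared error by at most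
  \<open>W\<close>. Here \<open>W\<close> bounds squared norms.\<close>

lemma maurey_step:
  fixes w :: "'j \<Rightarrow> 'a \<Rightarrow> real"
  assumes F: "finite F" and w: "\<And>j. j \<in> F \<Longrightarrow> (\<Sum>i\<in>A. (w j i)\<^sup>2) \<le> W"
    and p: "\<And>j. j \<in> F \<Longrightarrow> 0 \<le> p j" "(\<Sum>j\<in>F. p j) = 1"
  defines "v \<equiv> \<lambda>i. \<Sum>j\<in>F. p j * w j i"
  shows "\<exists>c. finite {j. c j \<noteq> 0} \<and> {j. c j \<noteq> 0} \<subseteq> F \<and> card {j. c j \<noteq> 0} \<le> s \<and>
    (\<Sum>i\<in>A. (real s * v i - (\<Sum>j\<in>F. c j * w j i))\<^sup>2) \<le> real s * W"
proof (induction s)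
  case 0
  show ?case by (rule exI[of _ "\<lambda>_. 0"]) simp
next
  case (Suc s)
  then obtain c where c: "finite {j. c j \<noteq> 0}" "{j. c j \<noteq> 0} \<subseteq> F" "card {j. c j \<noteq> 0} \<le> s"
    "(\<Sum>i\<in>A. (real s * v i - (\<Sum>j\<in>F. c j * w j i))\<^sup>2) \<le> real s * W" by blast
  define d where "d = (\<lambda>i. real s * v i - (\<Sum>j\<in>F. c j * w j i))"
  \<comment> \<open>The cross terms vanish on average because \<open>v\<close> is the
    \<open>p\<close>-mean of the \<open>w j\<close>; what remains is |d|^2 - |v|^2 plus the mean of
    |w j|^2.\<close>
  have avg: "(\<Sum>j\<in>F. p j * (\<Sum>i\<in>A. (d i + v i - w j i)\<^sup>2)) \<le> (\<Sum>i\<in>A. (d i)\<^sup>2) + W"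
  proof -
    have "(\<Sum>j\<in>F. p j * (\<Sum>i\<in>A. (d i + v i - w j i)\<^sup>2)) =
       (\<Sum>i\<in>A. \<Sum>j\<in>F. p j * (d i + v i - w j i)\<^sup>2)"
      by (simp add: sum_distrib_left sum.swap[of _ A])
    also have "\<dots> = (\<Sum>i\<in>A. (d i)\<^sup>2 - (v i)\<^sup>2 + (\<Sum>j\<in>F. p j * (w j i)\<^sup>2))"
    proof (rule sum.cong[OF refl])
      fix i
      have "(\<Sum>j\<in>F. p j * (d i + v i - w j i)\<^sup>2) =
         (\<Sum>j\<in>F. p j * (d i + v i)\<^sup>2 - 2 * (d i + v i) * (p j * w j i) + p j * (w j i)\<^sup>2)"
        by (rule sum.cong) (auto simp: power2_eq_square algebra_simps)
      also have "\<dots> = (\<Sum>j\<in>F. p j) * (d i + v i)\<^sup>2 - 2 * (d i + v i) * v i + (\<Sum>j\<in>F. p j * (w j i)\<^sup>2)"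
        by (simp add: sum.distrib sum_subtractf v_def sum_distrib_left sum_distrib_right)
      also have "\<dots> = (d i)\<^sup>2 - (v i)\<^sup>2 + (\<Sum>j\<in>F. p j * (w j i)\<^sup>2)"
        by (simp add: p power2_eq_square algebra_simps)
      finally show "(\<Sum>j\<in>F. p j * (d i + v i - w j i)\<^sup>2) = (d i)\<^sup>2 - (v i)\<^sup>2 + (\<Sum>j\<in>F. p j * (w j i)\<^sup>2)" .
    qed
    also have "\<dots> \<le> (\<Sum>i\<in>A. (d i)\<^sup>2 + (\<Sum>j\<in>F. p j * (w j i)\<^sup>2))" by (rule sum_mono) simp
    also have "\<dots> = (\<Sum>i\<in>A. (d i)\<^sup>2) + (\<Sum>j\<in>F. p j * (\<Sum>i\<in>A. (w j i)\<^sup>2))"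
      by (simp add: sum.distrib sum_distrib_left sum.swap[of _ A])
    also have "(\<Sum>j\<in>F. p j * (\<Sum>i\<in>A. (w j i)\<^sup>2)) \<le> (\<Sum>j\<in>F. p j * W)"
      by (intro sum_mono mult_left_mono w p)
    also have "\<dots> = W" by (simp add: p flip: sum_distrib_right)
    finally show ?thesis by simp
  qed
  obtain m where m: "m \<in> F" "(\<Sum>i\<in>A. (d i + v i - w m i)\<^sup>2) \<le> (\<Sum>i\<in>A. (d i)\<^sup>2) + W"
  proof (rule ccontr)
    assume "\<not> thesis"
    then have less: "\<And>j. j \<in> F \<Longrightarrow> (\<Sum>i\<in>A. (d i)\<^sup>2) + W < (\<Sum>i\<in>A. (d i + v i - w j i)\<^sup>2)"
      using that by force
    obtain j0 where j0: "j0 \<in> F" "p j0 > 0"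
      by (metis p order_le_less sum.neutral zero_neq_one)
    have "(\<Sum>j\<in>F. p j * ((\<Sum>i\<in>A. (d i)\<^sup>2) + W)) < (\<Sum>j\<in>F. p j * (\<Sum>i\<in>A. (d i + v i - w j i)\<^sup>2))"
    proof (rule sum_strict_mono_ex1[OF F])
      show "\<forall>j\<in>F. p j * ((\<Sum>i\<in>A. (d i)\<^sup>2) + W) \<le> p j * (\<Sum>i\<in>A. (d i + v i - w j i)\<^sup>2)"
        using less p by (intro ballI mult_left_mono) (auto intro: less_imp_le)
      show "\<exists>j\<in>F. p j * ((\<Sum>i\<in>A. (d i)\<^sup>2) + W) < p j * (\<Sum>i\<in>A. (d i + v i - w j i)\<^sup>2)"
        using less j0 by (intro bexI[of _ j0] mult_strict_left_mono) auto
    qed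
    moreover have "(\<Sum>j\<in>F. p j * ((\<Sum>i\<in>A. (d i)\<^sup>2) + W)) = (\<Sum>i\<in>A. (d i)\<^sup>2) + W"
      by (simp add: p flip: sum_distrib_right)
    ultimately show False using avg by linarith
  qed
  define c' where "c' = c(m := c m + 1)"
  have sub: "{j. c' j \<noteq> 0} \<subseteq> insert m {j. c j \<noteq> 0}" unfolding c'_def by auto
  have eq: "real (Suc s) * v i - (\<Sum>j\<in>F. c' j * w j i) = d i + v i - w m i" for i
  proof -
    have "(\<Sum>j\<in>F. c' j * w j i) = (\<Sum>j\<in>F. c j * w j i + (if j = m then w j i else 0))"
      by (rule sum.cong) (auto simp: c'_def algebra_simps)
    also have "\<dots> = (\<Sum>j\<in>F. c j * w j i) + w m i" using m F by (simp add: sum.distrib)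
    finally show ?thesis by (simp add: d_def algebra_simps)
  qed
  show ?case
  proof (intro exI[of _ c'] conjI)
    show "finite {j. c' j \<noteq> 0}" using sub c(1) by (auto intro: finite_subset)
    show "{j. c' j \<noteq> 0} \<subseteq> F" using sub c(2) m by auto
    have "card {j. c' j \<noteq> 0} \<le> card (insert m {j. c j \<noteq> 0})" using sub c(1) by (intro card_mono) auto
    also have "\<dots> \<le> Suc s" using c(1,3) by (simp add: card_insert_if)
    finally show "card {j. c' j \<noteq> 0} \<le> Suc s" .
    have "(\<Sum>i\<in>A. (d i + v i - w m i)\<^sup>2) \<le> real s * W + W"
      using m(2) c(4) by (simp add: d_def)
    then show "(\<Sum>i\<in>A. (real (Suc s) * v i - (\<Sum>j\<in>F. c' j * w j i))\<^sup>2) \<le> real (Suc s) * W"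
      unfolding eq by (simp add: algebra_simps)
  qed
qed

text \<open>Signs go into the vectors and |b j| / beta into the weights, where beta is the l1 norm
  of \<open>b\<close>. This is a convex combination unless beta = 0, hence the case split. Rescaling
  by beta / s turns the error sqrt s W into beta W / sqrt s.\<close>

lemma maurey:
  fixes w :: "'j \<Rightarrow> 'a \<Rightarrow> real" and b :: "'j \<Rightarrow> real"
  assumes F: "finite F" and w: "\<And>j. j \<in> F \<Longrightarrow> L2_set (w j) A \<le> W" and W: "0 \<le> W"
    and b: "(\<Sum>j\<in>F. \<bar>b j\<bar>) \<le> B" and s: "0 < s"
  obtains G c where "G \<subseteq> F" "card G \<le> s"
    "L2_set (\<lambda>i. (\<Sum>j\<in>F. b j * w j i) - (\<Sum>j\<in>G. c j * w j i)) A \<le> B * W / sqrt (real s)"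
proof (cases "(\<Sum>j\<in>F. \<bar>b j\<bar>) = 0")
  case True
  then have "\<forall>j\<in>F. b j = 0" using F by (simp add: sum_nonneg_eq_0_iff)
  moreover have "0 \<le> B" using b True by simp
  ultimately show ?thesis using W by (intro that[of "{}"]) (auto simp: L2_set_def)
next
  case False
  define \<beta> where "\<beta> = (\<Sum>j\<in>F. \<bar>b j\<bar>)"
  have \<beta>: "\<beta> > 0" using False sum_nonneg[of F "\<lambda>j. \<bar>b j\<bar>", OF abs_ge_zero] unfolding \<beta>_def by linarith
  define u where "u = (\<lambda>j i. sgn (b j) * w j i)"
  define p where "p = (\<lambda>j. \<bar>b j\<bar> / \<beta>)"
  have u: "(\<Sum>i\<in>A. (u j i)\<^sup>2) \<le> W\<^sup>2" if "j \<in> F" for j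
  proof -
    have "(\<Sum>i\<in>A. (u j i)\<^sup>2) \<le> (\<Sum>i\<in>A. (w j i)\<^sup>2)"
      by (rule sum_mono) (auto simp: u_def power_mult_distrib sgn_if)
    also have "\<dots> \<le> W\<^sup>2" using w[OF that] W L2_set_le_iff[of W "w j" A] by auto
    finally show ?thesis .
  qed
  have "\<exists>c. finite {j. c j \<noteq> 0} \<and> {j. c j \<noteq> 0} \<subseteq> F \<and> card {j. c j \<noteq> 0} \<le> s \<and>
    (\<Sum>i\<in>A. (real s * (\<Sum>j\<in>F. p j * u j i) - (\<Sum>j\<in>F. c j * u j i))\<^sup>2) \<le> real s * W\<^sup>2"
    by (rule maurey_step[OF F u]) (use \<beta> in \<open>auto simp: p_def \<beta>_def sum_divide_distrib[symmetric]\<close>)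
  then obtain c where c: "finite {j. c j \<noteq> 0}" "{j. c j \<noteq> 0} \<subseteq> F" "card {j. c j \<noteq> 0} \<le> s"
    "(\<Sum>i\<in>A. (real s * (\<Sum>j\<in>F. p j * u j i) - (\<Sum>j\<in>F. c j * u j i))\<^sup>2) \<le> real s * W\<^sup>2" by blast
  have pu: "(\<Sum>j\<in>F. p j * u j i) = (\<Sum>j\<in>F. b j * w j i) / \<beta>" for i
    unfolding sum_divide_distrib by (rule sum.cong) (auto simp: p_def u_def sgn_if)
  have L: "L2_set (\<lambda>i. real s * (\<Sum>j\<in>F. p j * u j i) - (\<Sum>j\<in>F. c j * u j i)) A \<le> sqrt (real s) * W"
    using c(4) W by (subst L2_set_le_iff) (auto simp: power_mult_distrib)
  define c' where "c' = (\<lambda>j. \<beta> / real s * c j * sgn (b j))"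
  have eq: "(\<Sum>j\<in>F. b j * w j i) - (\<Sum>j\<in>{j. c j \<noteq> 0}. c' j * w j i) =
      (\<beta> / real s) * (real s * (\<Sum>j\<in>F. p j * u j i) - (\<Sum>j\<in>F. c j * u j i))" for i
  proof -
    have "(\<Sum>j\<in>{j. c j \<noteq> 0}. c' j * w j i) = (\<Sum>j\<in>F. c' j * w j i)"
      using c F by (intro sum.mono_neutral_left) (auto simp: c'_def)
    also have "\<dots> = (\<beta> / real s) * (\<Sum>j\<in>F. c j * u j i)"
      unfolding sum_distrib_left by (rule sum.cong) (auto simp: c'_def u_def)
    finally show ?thesis unfolding pu using s \<beta> by (simp add: field_simps)
  qed
  have "L2_set (\<lambda>i. (\<Sum>j\<in>F. b j * w j i) - (\<Sum>j\<in>{j. c j \<noteq> 0}. c' j * w j i)) A \<le> \<beta> / real s * (sqrt (real s) * W)"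
    unfolding eq L2_set_scale using \<beta> s L by (simp add: divide_right_mono mult_left_mono)
  also have "\<dots> = \<beta> * W / sqrt (real s)"
    using s by (simp add: field_simps flip: power2_eq_square)
  also have "\<dots> \<le> B * W / sqrt (real s)"
    using b W s unfolding \<beta>_def by (intro divide_right_mono mult_right_mono) auto
  finally show ?thesis using c by (intro that[of "{j. c j \<noteq> 0}" c']) auto
qed

text \<open>The vectors may be dependent, so \<open>r\<close> can be smaller than
  \<open>card G\<close>. Both inclusions between the spans are recorded: writing \<open>w\<close> in
  terms of \<open>q\<close> reduces distances to a span to r coordinates, and writing
  \<open>q\<close> in terms of \<open>w\<close> later shows that an orthonormal system stays inside
  a given subspace.\<close>

lemma gram_schmidt_functions:
  fixes w :: "'j \<Rightarrow> nat \<Rightarrow> real"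
  assumes "finite G"
  shows "\<exists>r q. r \<le> card G \<and>
    (\<forall>s<r. \<forall>t<r. (\<Sum>i<d. q s i * q t i) = (if s = t then 1 else 0)) \<and>
    (\<forall>j\<in>G. \<exists>e. \<forall>i<d. w j i = (\<Sum>t<r. e t * q t i)) \<and>
    (\<forall>t<r. \<exists>c. \<forall>i<d. q t i = (\<Sum>j\<in>G. c j * w j i))"
  using assms
proof (induction G rule: finite_induct)
  case empty
  show ?case by (intro exI[of _ "0::nat"] exI[of _ "\<lambda>_ _. 0::real"]) simp
next
  case (insert x G)
  then obtain r q where r: "r \<le> card G"
    and orth': "\<forall>s<r. \<forall>t<r. (\<Sum>i<d. q s i * q t i) = (if s = t then 1 else 0)"
    and wq: "\<forall>j\<in>G. \<exists>e. \<forall>i<d. w j i = (\<Sum>t<r. e t * q t i)"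
    and qw: "\<forall>t<r. \<exists>c. \<forall>i<d. q t i = (\<Sum>j\<in>G. c j * w j i)" by blast
  have orth: "(\<Sum>i<d. q s i * q t i) = (if s = t then 1 else 0)" if "s < r" "t < r" for s t
    using orth' that by blast
  define cc where "cc = (\<lambda>t. SOME c. \<forall>i<d. q t i = (\<Sum>j\<in>G. c j * w j i))"
  have cc: "q t i = (\<Sum>j\<in>G. cc t j * w j i)" if "t < r" "i < d" for t i
    using someI_ex[OF qw[rule_format, OF that(1)]] that(2) unfolding cc_def by blast
  define a where "a = (\<lambda>t. \<Sum>i<d. w x i * q t i)"
  define v where "v = (\<lambda>i. w x i - (\<Sum>t<r. a t * q t i))"
  have vq: "(\<Sum>i<d. v i * q s i) = 0" if "s < r" for s
  proof -
    have "(\<Sum>i<d. v i * q s i) = a s - (\<Sum>i<d. \<Sum>t<r. a t * (q t i * q s i))"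
      by (simp add: v_def left_diff_distrib sum_subtractf a_def sum_distrib_right mult.assoc)
    also have "(\<Sum>i<d. \<Sum>t<r. a t * (q t i * q s i)) = (\<Sum>t<r. a t * (\<Sum>i<d. q t i * q s i))"
      by (subst sum.swap) (simp add: sum_distrib_left)
    also have "\<dots> = (\<Sum>t<r. if t = s then a t else 0)"
      by (rule sum.cong) (auto simp: orth that)
    also have "\<dots> = a s" using that by simp
    finally show ?thesis by simp
  qed
  have old: "\<exists>e. \<forall>i<d. w j i = (\<Sum>t<Suc r. e t * (q(r := y)) t i)" if "j \<in> G" for j y
  proof -
    obtain e where "\<forall>i<d. w j i = (\<Sum>t<r. e t * q t i)" using wq \<open>j \<in> G\<close> by blast
    then show ?thesis by (intro exI[of _ "e(r := 0)"]) simp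
  qed
  have oldq: "\<exists>c. \<forall>i<d. q t i = (\<Sum>j\<in>insert x G. c j * w j i)" if "t < r" for t
  proof (rule exI[of _ "(cc t)(x := 0)"], intro allI impI)
    fix i assume "i < d"
    have "(\<Sum>j\<in>G. ((cc t)(x := 0)) j * w j i) = (\<Sum>j\<in>G. cc t j * w j i)"
      using insert by (intro sum.cong) auto
    then show "q t i = (\<Sum>j\<in>insert x G. ((cc t)(x := 0)) j * w j i)"
      using insert cc[OF that \<open>i < d\<close>] by simp
  qed
  show ?case
  proof (cases "\<forall>i<d. v i = 0")
    case True
    have "\<exists>e. \<forall>i<d. w j i = (\<Sum>t<r. e t * q t i)" if "j \<in> insert x G" for j
    proof (cases "j = x")
      case True': True
      show ?thesis by (rule exI[of _ a]) (use True True' in \<open>auto simp: v_def\<close>)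
    qed (use that wq in auto)
    moreover have "r \<le> card (insert x G)" using r insert by simp
    ultimately show ?thesis using orth oldq by (intro exI[of _ r] exI[of _ q]) blast
  next
    case False
    define m where "m = L2_set v {..<d}"
    have "m \<noteq> 0" using False unfolding m_def by (auto simp: L2_set_eq_0_iff)
    then have m: "m > 0" unfolding m_def using L2_set_nonneg[of v "{..<d}"] by linarith
    define y where "y = (\<lambda>i. v i / m)"
    have yy: "(\<Sum>i<d. y i * y i) = 1"
    proof -
      have "(\<Sum>i<d. y i * y i) = (\<Sum>i<d. (v i)\<^sup>2) / m\<^sup>2"
        by (simp add: y_def power2_eq_square sum_divide_distrib)
      then show ?thesis using m by (simp add: m_def flip: L2_set_power2)
    qed
    have yq: "(\<Sum>i<d. y i * q s i) = 0" if "s < r" for s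
      using vq[OF that] by (simp add: y_def flip: sum_divide_distrib)
    have qy: "(\<Sum>i<d. q s i * y i) = 0" if "s < r" for s
      using yq[OF that] by (simp add: mult.commute)
    have "(\<Sum>i<d. (q(r := y)) s i * (q(r := y)) t i) = (if s = t then 1 else 0)" if "s < Suc r" "t < Suc r" for s t
      using that orth yy yq qy by (cases "s = r"; cases "t = r") auto
    moreover have "\<exists>e. \<forall>i<d. w j i = (\<Sum>t<Suc r. e t * (q(r := y)) t i)" if "j \<in> insert x G" for j
    proof (cases "j = x")
      case True
      show ?thesis
        by (rule exI[of _ "a(r := m)"]) (use True m in \<open>auto simp: y_def v_def\<close>)
    qed (use that old in auto)
    moreover have "\<exists>c. \<forall>i<d. (q(r := y)) t i = (\<Sum>j\<in>insert x G. c j * w j i)" if "t < Suc r" for t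
    proof (cases "t = r")
      case True
      have "y i = (\<Sum>j\<in>insert x G. (if j = x then 1 / m else - (\<Sum>t<r. a t * cc t j) / m) * w j i)" if "i < d" for i
      proof -
        have "(\<Sum>t<r. a t * q t i) = (\<Sum>t<r. \<Sum>j\<in>G. a t * cc t j * w j i)"
          using cc that by (auto simp: sum_distrib_left mult.assoc intro!: sum.cong)
        also have "\<dots> = (\<Sum>j\<in>G. (\<Sum>t<r. a t * cc t j) * w j i)"
          by (subst sum.swap) (simp add: sum_distrib_right)
        finally have "y i = w x i / m + (\<Sum>j\<in>G. - (\<Sum>t<r. a t * cc t j) / m * w j i)"
          by (simp add: y_def v_def diff_divide_distrib sum_negf flip: sum_divide_distrib)
        also have "(\<Sum>j\<in>G. - (\<Sum>t<r. a t * cc t j) / m * w j i) = (\<Sum>j\<in>G. (if j = x then 1 / m else - (\<Sum>t<r. a t * cc t j) / m) * w j i)"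
          using insert by (intro sum.cong) auto
        finally show ?thesis using insert by simp
      qed
      then show ?thesis using True by (intro exI) auto
    qed (use that oldq in auto)
    moreover have "Suc r \<le> card (insert x G)" using r insert by simp
    ultimately show ?thesis by (intro exI[of _ "Suc r"] exI[of _ "q(r := y)"]) blast
  qed
qed

text \<open>The supremum S over the unit ball satisfies S <= K + S / 2, since twice the difference
  to the nearest net point lies in the unit ball again. Boundedness has to come first: the
  inequality says nothing about an infinite S.\<close>

lemma sup_from_net:
  fixes \<xi> :: "'j \<Rightarrow> nat \<Rightarrow> real"
  assumes net: "\<And>u. L2_set u {..<D} \<le> 1 \<Longrightarrow> \<exists>q\<in>Q. L2_set (\<lambda>i. u i - q i) {..<D} \<le> 1 / 2"
    and K: "\<And>q. q \<in> Q \<Longrightarrow> L2_set (\<lambda>j. \<Sum>i<D. q i * \<xi> j i) J \<le> K"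
    and u: "L2_set u {..<D} \<le> 1"
  shows "L2_set (\<lambda>j. \<Sum>i<D. u i * \<xi> j i) J \<le> 2 * K"
proof -
  define V where "V = (\<lambda>u. L2_set (\<lambda>j. \<Sum>i<D. u i * \<xi> j i) J)"
  let ?B = "{u. L2_set u {..<D} \<le> 1}"
  have V_scale: "V (\<lambda>i. c * u i) = \<bar>c\<bar> * V u" for c u
    unfolding V_def L2_set_scale[symmetric] by (simp add: sum_distrib_left mult.assoc)
  have V_tri: "V u \<le> V q + V (\<lambda>i. u i - q i)" for u q
    unfolding V_def using L2_set_triangle_diff[of "\<lambda>j. \<Sum>i<D. u i * \<xi> j i" J "\<lambda>j. \<Sum>i<D. q i * \<xi> j i"]
    by (simp add: left_diff_distrib sum_subtractf)
  have bdd: "bdd_above (V ` ?B)"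
  proof (rule bdd_aboveI2[of _ _ "L2_set (\<lambda>j. L2_set (\<xi> j) {..<D}) J"])
    fix u assume "u \<in> ?B"
    then have "\<bar>\<Sum>i<D. u i * \<xi> j i\<bar> \<le> L2_set (\<xi> j) {..<D}" for j
      using abs_inner_le_L2_set[of u "\<xi> j" "{..<D}"] mult_right_mono[OF _ L2_set_nonneg, of "L2_set u {..<D}" 1 "\<xi> j" "{..<D}"]
      by auto
    then show "V u \<le> L2_set (\<lambda>j. L2_set (\<xi> j) {..<D}) J"
      unfolding V_def L2_set_def[of _ J]
      by (intro real_sqrt_le_mono sum_mono) (metis abs_le_square_iff abs_of_nonneg L2_set_nonneg)
  qed
  let ?S = "Sup (V ` ?B)"
  have S: "V u \<le> K + ?S / 2" if "u \<in> ?B" for u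
  proof -
    obtain q where q: "q \<in> Q" "L2_set (\<lambda>i. u i - q i) {..<D} \<le> 1 / 2" using net \<open>u \<in> ?B\<close> by auto
    have "(\<lambda>i. 2 * (u i - q i)) \<in> ?B" using q(2) L2_set_scale[of 2 "\<lambda>i. u i - q i" "{..<D}"] by auto
    then have "V (\<lambda>i. 2 * (u i - q i)) \<le> ?S" using bdd by (intro cSup_upper) auto
    then have "V (\<lambda>i. u i - q i) \<le> ?S / 2" using V_scale[of 2 "\<lambda>i. u i - q i"] by linarith
    moreover have "V q \<le> K" using K q unfolding V_def by auto
    ultimately show ?thesis using V_tri[of u q] by linarith
  qed
  have "?S \<le> K + ?S / 2" by (rule cSup_least) (use S u in auto)
  with S[of u] u show ?thesis unfolding V_def by simp
qed

section \<open>Volumes of cones in the unit ball\<close>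

lemma borel_measurable_L2_set:
  assumes "\<And>i. i \<in> A \<Longrightarrow> (\<lambda>x. f x i) \<in> borel_measurable M"
  shows "(\<lambda>x. L2_set (f x) A) \<in> borel_measurable M"
  unfolding L2_set_def by (intro measurable_compose[OF _ borel_measurable_sqrt] borel_measurable_sum borel_measurable_power assms)

abbreviation (input) lborel_PiM :: "nat \<Rightarrow> (nat \<Rightarrow> real) measure" where
  "lborel_PiM d \<equiv> (\<Pi>\<^sub>M k\<in>{..<d}. lborel)"

definition fun_ball :: "nat \<Rightarrow> (nat \<Rightarrow> real) \<Rightarrow> real \<Rightarrow> (nat \<Rightarrow> real) set" where
  "fun_ball d p r = {g \<in> space (lborel_PiM d). L2_set (\<lambda>i. g i - p i) {..<d} \<le> r}"

interpretation lborel_product: product_sigma_finite "\<lambda>_::nat. lborel :: real measure" ..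

lemma comp_measurable_lborel_PiM: "i < d \<Longrightarrow> (\<lambda>g. g i) \<in> borel_measurable (lborel_PiM d)"
  using measurable_component_singleton[of i "{..<d}" "\<lambda>_. lborel"] by simp

lemma fun_ball_sets [measurable]: "fun_ball d p r \<in> sets (lborel_PiM d)"
  unfolding fun_ball_def
  by (intro borel_measurable_le borel_measurable_L2_set borel_measurable_diff borel_measurable_const)
    (auto intro: comp_measurable_lborel_PiM)

definition fun_affine :: "nat \<Rightarrow> real \<Rightarrow> (nat \<Rightarrow> real) \<Rightarrow> (nat \<Rightarrow> real) \<Rightarrow> nat \<Rightarrow> real" where
  "fun_affine d r p g = (\<lambda>i\<in>{..<d}. p i + r * g i)"

lemma fun_affine_measurable: "fun_affine d r p \<in> measurable (lborel_PiM d) (lborel_PiM d)"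
  unfolding fun_affine_def
  by (intro measurable_restrict) (simp add: comp_measurable_lborel_PiM borel_measurable_add borel_measurable_times)

text \<open>A product measure is determined by its values on boxes, where the claim factorizes into
  one-dimensional affine changes of variables.\<close>

lemma emeasure_lborel_PiM_affine:
  assumes r: "0 < r" and B: "B \<in> sets (lborel_PiM d)"
  shows "emeasure (lborel_PiM d) B =
    ennreal (r ^ d) * emeasure (lborel_PiM d) (fun_affine d r p -` B \<inter> space (lborel_PiM d))"
proof -
  let ?L = "lborel_PiM d"
  let ?T = "fun_affine d r p"
  let ?P = "scale_measure (ennreal (r ^ d)) (distr ?L ?L ?T)"
  have "?P = ?L"
  proof (rule lborel_product.PiM_eqI)
    show "finite {..<d}" by simp
    show "sets ?P = sets ?L" by simp
    fix A :: "nat \<Rightarrow> real set" assume A: "\<And>i. i \<in> {..<d} \<Longrightarrow> A i \<in> sets lborel"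
    have pre: "?T -` Pi\<^sub>E {..<d} A \<inter> space ?L = Pi\<^sub>E {..<d} (\<lambda>i. (\<lambda>x. p i + r * x) -` A i)"
      by (auto simp: space_PiM fun_affine_def PiE_iff)
    have one: "emeasure lborel (A i) = ennreal r * emeasure lborel ((\<lambda>x. p i + r * x) -` A i)" if "i \<in> {..<d}" for i
    proof -
      have "emeasure lborel (A i) = emeasure (density (distr lborel borel (\<lambda>x. p i + r * x)) (\<lambda>_. ennreal \<bar>r\<bar>)) (A i)"
        using lborel_real_affine[of r "p i"] r by simp
      also have "\<dots> = ennreal r * emeasure (distr lborel borel (\<lambda>x. p i + r * x)) (A i)"
        using A[OF that] r by (simp add: emeasure_density_const)
      also have "\<dots> = ennreal r * emeasure lborel ((\<lambda>x. p i + r * x) -` A i)"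
        using A[OF that] by (subst emeasure_distr) auto
      finally show ?thesis .
    qed
    have PA: "Pi\<^sub>E {..<d} A \<in> sets ?L" using A by (intro sets_PiM_I_finite) auto
    have "emeasure ?P (Pi\<^sub>E {..<d} A) = ennreal (r ^ d) * emeasure ?L (Pi\<^sub>E {..<d} (\<lambda>i. (\<lambda>x. p i + r * x) -` A i))"
      using PA fun_affine_measurable[of d r p] by (simp add: emeasure_distr pre)
    also have "\<dots> = ennreal (r ^ d) * (\<Prod>i<d. emeasure lborel ((\<lambda>x. p i + r * x) -` A i))"
    proof -
      have "(\<lambda>x. p i + r * x) -` A i \<in> sets lborel" if "i \<in> {..<d}" for i
        using measurable_sets[of "\<lambda>x. p i + r * x" borel borel "A i"] A[OF that] by simp
      then show ?thesis by (subst lborel_product.emeasure_PiM) auto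
    qed
    also have "\<dots> = (\<Prod>i<d. ennreal r * emeasure lborel ((\<lambda>x. p i + r * x) -` A i))"
      using r by (simp add: prod.distrib ennreal_power)
    also have "\<dots> = (\<Prod>i<d. emeasure lborel (A i))" by (intro prod.cong) (auto simp: one)
    finally show "emeasure ?P (Pi\<^sub>E {..<d} A) = (\<Prod>i<d. emeasure lborel (A i))" .
  qed
  then have "emeasure ?L B = emeasure ?P B" by simp
  then show ?thesis using B fun_affine_measurable[of d r p] by (simp add: emeasure_distr)
qed

lemma emeasure_fun_ball:
  assumes r: "0 < r"
  shows "emeasure (lborel_PiM d) (fun_ball d p r) = ennreal (r ^ d) * emeasure (lborel_PiM d) (fun_ball d (\<lambda>_. 0) 1)"
proof -
  have "fun_affine d r p -` fun_ball d p r \<inter> space (lborel_PiM d) = fun_ball d (\<lambda>_. 0) 1"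
  proof -
    have "L2_set (\<lambda>i. fun_affine d r p g i - p i) {..<d} = r * L2_set g {..<d}" for g
    proof -
      have "L2_set (\<lambda>i. fun_affine d r p g i - p i) {..<d} = L2_set (\<lambda>i. r * g i) {..<d}"
        by (rule L2_set_cong) (auto simp: fun_affine_def)
      then show ?thesis using r by (simp add: L2_set_scale)
    qed
    then show ?thesis
      using r measurable_space[OF fun_affine_measurable[of d r p]] by (auto simp: fun_ball_def)
  qed
  then show ?thesis using emeasure_lborel_PiM_affine[OF r fun_ball_sets, of d p r p] by simp
qed

lemma emeasure_unit_fun_ball:
  "emeasure (lborel_PiM d) (fun_ball d (\<lambda>_. 0) 1) \<noteq> 0"
  "emeasure (lborel_PiM d) (fun_ball d (\<lambda>_. 0) 1) \<noteq> \<infinity>"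
proof -
  let ?L = "lborel_PiM d" and ?B = "fun_ball d (\<lambda>_. 0) 1"
  have sub: "?B \<subseteq> Pi\<^sub>E {..<d} (\<lambda>_. {-1..1})"
  proof
    fix g assume "g \<in> ?B"
    then have g: "g \<in> space ?L" "L2_set g {..<d} \<le> 1" by (auto simp: fun_ball_def)
    have "\<bar>g i\<bar> \<le> 1" if "i < d" for i
      using member_le_L2_set[of "{..<d}" i "\<lambda>i. \<bar>g i\<bar>"] g(2) that
      by (simp add: L2_set_def) (metis order_trans real_sqrt_le_1_iff)
    then show "g \<in> Pi\<^sub>E {..<d} (\<lambda>_. {-1..1})" using g(1) by (force simp: space_PiM PiE_iff abs_le_iff)
  qed
  have "emeasure ?L ?B \<le> emeasure ?L (Pi\<^sub>E {..<d} (\<lambda>_. {-1..1}))"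
    by (rule emeasure_mono[OF sub]) (intro sets_PiM_I_finite, auto)
  also have "\<dots> = (\<Prod>i<d. emeasure lborel {-1..1::real})" by (subst lborel_product.emeasure_PiM) auto
  also have "\<dots> = ennreal (2 ^ d)" by (simp add: ennreal_power flip: ennreal_numeral)
  finally show "emeasure ?L ?B \<noteq> \<infinity>" by (auto simp: top_unique)
  \<comment> \<open>The cube with side h lies in the l1 unit ball; \<open>d + 1\<close> instead of
    \<open>d\<close> keeps h meaningful for d = 0.\<close>
  define h where "h = 1 / (real d + 1)"
  have h: "h > 0" by (simp add: h_def)
  have sub: "Pi\<^sub>E {..<d} (\<lambda>_. {0..h}) \<subseteq> ?B"
  proof
    fix g assume g: "g \<in> Pi\<^sub>E {..<d} (\<lambda>_. {0..h})"
    have "L2_set g {..<d} \<le> (\<Sum>i<d. \<bar>g i\<bar>)" by (rule L2_set_le_sum_abs)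
    also have "\<dots> \<le> (\<Sum>i<d. h)" using g by (intro sum_mono) (auto simp: PiE_iff)
    also have "\<dots> \<le> 1" by (simp add: h_def)
    finally show "g \<in> ?B" using g by (auto simp: fun_ball_def space_PiM PiE_iff)
  qed
  have "(\<Prod>i<d. emeasure lborel {0..h}) = emeasure ?L (Pi\<^sub>E {..<d} (\<lambda>_. {0..h}))"
    by (subst lborel_product.emeasure_PiM) auto
  also have "\<dots> \<le> emeasure ?L ?B" by (rule emeasure_mono[OF sub fun_ball_sets])
  finally have "(\<Prod>i<d. emeasure lborel {0..h}) \<le> emeasure ?L ?B" .
  moreover have "(\<Prod>i<d. emeasure lborel {0..h}) \<noteq> 0" using h by (simp add: ennreal_power)
  ultimately show "emeasure ?L ?B \<noteq> 0" by (metis le_zero_eq)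
qed

text \<open>Sets of directions are measured by the volume of their cones in the unit ball, so that
  no surface measure is required.\<close>

definition ball_law :: "nat \<Rightarrow> (nat \<Rightarrow> real) measure" where
  "ball_law d = uniform_measure (lborel_PiM d) (fun_ball d (\<lambda>_. 0) 1)"

lemma ball_law_sets [simp, measurable_cong]: "sets (ball_law d) = sets (lborel_PiM d)"
  and ball_law_space [simp]: "space (ball_law d) = space (lborel_PiM d)"
  by (simp_all add: ball_law_def)

lemma prob_space_ball_law: "prob_space (ball_law d)"
  unfolding ball_law_def by (rule prob_space_uniform_measure) (use emeasure_unit_fun_ball in auto)

text \<open>A ball of radius r has the share r^d of the unit ball. One such ball will cover the cone
  over a cap; a net of them covers the cone over the neighbourhood of a span.\<close>

lemma ball_law_cover:
  assumes A: "A \<in> sets (lborel_PiM d)" and r: "0 < r" and Q: "finite Q"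
    and sub: "\<And>g. g \<in> A \<Longrightarrow> L2_set g {..<d} \<le> 1 \<Longrightarrow> \<exists>q\<in>Q. L2_set (\<lambda>i. g i - q i) {..<d} \<le> r"
  shows "emeasure (ball_law d) A \<le> ennreal (real (card Q) * r ^ d)"
proof -
  let ?L = "lborel_PiM d" and ?B = "fun_ball d (\<lambda>_. 0) 1"
  have "emeasure ?L (?B \<inter> A) \<le> emeasure ?L (\<Union>q\<in>Q. fun_ball d q r)"
  proof (rule emeasure_mono)
    show "?B \<inter> A \<subseteq> (\<Union>q\<in>Q. fun_ball d q r)"
      using sub sets.sets_into_space[OF A] by (fastforce simp: fun_ball_def)
  qed (use Q in auto)
  also have "\<dots> \<le> (\<Sum>q\<in>Q. emeasure ?L (fun_ball d q r))"
    using Q by (intro emeasure_subadditive_finite) auto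
  also have "\<dots> = ennreal (real (card Q) * r ^ d) * emeasure ?L ?B"
    using r by (simp add: emeasure_fun_ball[OF r] ennreal_mult mult.assoc flip: ennreal_of_nat_eq_real_of_nat)
  finally have le: "emeasure ?L (?B \<inter> A) \<le> ennreal (real (card Q) * r ^ d) * emeasure ?L ?B" .
  have "emeasure (ball_law d) A = emeasure ?L (?B \<inter> A) / emeasure ?L ?B"
    unfolding ball_law_def using A by (simp add: emeasure_uniform_measure)
  also have "\<dots> \<le> ennreal (real (card Q) * r ^ d) * emeasure ?L ?B / emeasure ?L ?B"
    using le by (rule divide_right_mono_ennreal)
  also have "\<dots> = ennreal (real (card Q) * r ^ d)"
    using emeasure_unit_fun_ball[of d] by (simp add: ennreal_mult_divide_eq)
  finally show ?thesis .
qed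

text \<open>If \<open>g\<close> vanishes on the first d coordinates, division by zero makes this 0.
  Hence norm at most 1, rather than norm 1, is what holds for every \<open>g\<close>.\<close>

definition unit_dir :: "nat \<Rightarrow> (nat \<Rightarrow> real) \<Rightarrow> nat \<Rightarrow> real" where
  "unit_dir d g = (\<lambda>i. g i / L2_set g {..<d})"

lemma unit_dir_scale: "i < d \<Longrightarrow> L2_set g {..<d} * unit_dir d g i = g i"
  by (cases "L2_set g {..<d} = 0") (auto simp: unit_dir_def L2_set_eq_0_iff)

lemma L2_set_unit_dir_le: "L2_set (unit_dir d g) {..<d} \<le> 1"
proof -
  have "L2_set (unit_dir d g) {..<d} = \<bar>1 / L2_set g {..<d}\<bar> * L2_set g {..<d}"
    unfolding unit_dir_def L2_set_scale[symmetric] by simp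
  then show ?thesis by (cases "L2_set g {..<d} = 0") auto
qed

lemma unit_dir_measurable: "i < d \<Longrightarrow> (\<lambda>g. unit_dir d g i) \<in> borel_measurable (lborel_PiM d)"
  unfolding unit_dir_def
  by (intro borel_measurable_divide borel_measurable_L2_set comp_measurable_lborel_PiM) auto

lemma cap_measurable:
  "(\<lambda>g. \<Sum>i<d. u i * unit_dir d g i) \<in> borel_measurable (lborel_PiM d)"
  by (intro borel_measurable_sum borel_measurable_times unit_dir_measurable borel_measurable_const) auto

text \<open>The cone over a spherical cap of height \<open>s\<close>, cut off at radius 1, lies in the ball of radius
  \<open>sqrt (1 - s\<^sup>2)\<close> around \<open>s u\<close> as long as \<open>s\<^sup>2 \<le> 1/2\<close>.\<close>
lemma ball_law_cap_small:
  assumes u: "L2_set u {..<d} \<le> 1" and s: "0 \<le> s" "s\<^sup>2 \<le> 1/2"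
  shows "emeasure (ball_law d) {g \<in> space (lborel_PiM d). s \<le> (\<Sum>i<d. u i * unit_dir d g i)} \<le> ennreal (exp (- real d * s\<^sup>2 / 2))"
proof -
  let ?A = "{g \<in> space (lborel_PiM d). s \<le> (\<Sum>i<d. u i * unit_dir d g i)}"
  define r where "r = sqrt (1 - s\<^sup>2)"
  have r: "r > 0" unfolding r_def using s by (intro real_sqrt_gt_zero) linarith
  have A: "?A \<in> sets (lborel_PiM d)"
    by (intro borel_measurable_le borel_measurable_const cap_measurable)
  have u2: "(\<Sum>i<d. (u i)\<^sup>2) \<le> 1" using u L2_set_le_iff[of 1 u "{..<d}"] by simp
  have "emeasure (ball_law d) ?A \<le> ennreal (real (card {\<lambda>i. s * u i}) * r ^ d)"
  proof (rule ball_law_cover[OF A r])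
    fix g assume g: "g \<in> ?A" "L2_set g {..<d} \<le> 1"
    define t where "t = L2_set g {..<d}"
    have t: "0 \<le> t" "t \<le> 1" using g by (auto simp: t_def)
    have "t * s \<le> t * (\<Sum>i<d. u i * unit_dir d g i)" using g t by (intro mult_left_mono) auto
    also have "\<dots> = (\<Sum>i<d. u i * g i)"
      unfolding sum_distrib_left
    proof (rule sum.cong[OF refl])
      fix i assume "i \<in> {..<d}"
      then have "t * unit_dir d g i = g i" using unit_dir_scale[of i d g] by (simp add: t_def)
      then show "t * (u i * unit_dir d g i) = u i * g i" by (metis mult.left_commute)
    qed
    finally have ug: "t * s \<le> (\<Sum>i<d. u i * g i)" .
    have "(\<Sum>i<d. (g i - s * u i)\<^sup>2) = (\<Sum>i<d. (g i)\<^sup>2) - 2 * s * (\<Sum>i<d. u i * g i) + s\<^sup>2 * (\<Sum>i<d. (u i)\<^sup>2)"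
      by (simp add: power2_diff power_mult_distrib sum.distrib sum_subtractf sum_distrib_left algebra_simps)
    also have "\<dots> \<le> t\<^sup>2 - 2 * s * (t * s) + s\<^sup>2 * 1"
    proof -
      have "s * (t * s) \<le> s * (\<Sum>i<d. u i * g i)" using ug s by (intro mult_left_mono) auto
      moreover have "s\<^sup>2 * (\<Sum>i<d. (u i)\<^sup>2) \<le> s\<^sup>2 * 1" using u2 by (intro mult_left_mono) auto
      ultimately show ?thesis unfolding t_def L2_set_power2 by (simp add: t_def[symmetric])
    qed
    also have "\<dots> \<le> 1 - s\<^sup>2"
    \<comment> \<open>As a function of t, t^2 - 2 s^2 t is convex, so on the unit interval it is
      largest at an end point; because 2 s^2 <= 1 this is t = 1.\<close>
    proof -
      have "(1 - t) * (2 * s\<^sup>2 - 1 - t) \<le> 0" using s t by (intro mult_nonneg_nonpos) auto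
      then show ?thesis by (simp add: algebra_simps power2_eq_square)
    qed
    also have "\<dots> = r\<^sup>2" using s by (simp add: r_def)
    finally show "\<exists>q\<in>{\<lambda>i. s * u i}. L2_set (\<lambda>i. g i - q i) {..<d} \<le> r"
      using r by (simp add: L2_set_le_iff)
  qed auto
  also have "real (card {\<lambda>i. s * u i}) * r ^ d \<le> exp (- real d * s\<^sup>2 / 2)"
  proof -
    have "1 - s\<^sup>2 \<le> exp (- (s\<^sup>2))" using exp_ge_add_one_self[of "- (s\<^sup>2)"] by simp
    also have "\<dots> = (exp (- (s\<^sup>2) / 2))\<^sup>2" by (simp flip: exp_double)
    finally have "r \<le> exp (- (s\<^sup>2) / 2)" unfolding r_def by (intro real_le_lsqrt) auto
    then have "r ^ d \<le> exp (- (s\<^sup>2) / 2) ^ d" using r by (intro power_mono) auto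
    also have "\<dots> = exp (- real d * s\<^sup>2 / 2)" by (simp flip: exp_of_nat_mult)
    finally show ?thesis by simp
  qed
  finally show ?thesis by (simp add: ennreal_leI)
qed

text \<open>Halving the exponent removes the restriction on s: between 1/2 and 1 the square s^2 is
  at most twice the admissible value 1/2, and beyond s = 1 the cap is empty by
  Cauchy-Schwarz.\<close>

lemma ball_law_cap:
  assumes u: "L2_set u {..<d} \<le> 1" and s: "0 \<le> s"
  shows "emeasure (ball_law d) {g \<in> space (lborel_PiM d). s \<le> (\<Sum>i<d. u i * unit_dir d g i)} \<le> ennreal (exp (- (real d / 4) * s\<^sup>2))"
proof -
  let ?A = "\<lambda>s. {g \<in> space (lborel_PiM d). s \<le> (\<Sum>i<d. u i * unit_dir d g i)}"
  consider "s\<^sup>2 \<le> 1/2" | "1/2 < s\<^sup>2" "s \<le> 1" | "1 < s" by linarith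
  then show ?thesis
  proof cases
    case 1
    have "emeasure (ball_law d) (?A s) \<le> ennreal (exp (- real d * s\<^sup>2 / 2))" by (rule ball_law_cap_small[OF u s 1])
    also have "\<dots> \<le> ennreal (exp (- (real d / 4) * s\<^sup>2))" by (intro ennreal_leI) simp
    finally show ?thesis .
  next
    case 2
    define s0 :: real where "s0 = sqrt (1/2)"
    have s0: "0 \<le> s0" "s0\<^sup>2 = 1/2" by (auto simp: s0_def)
    have "s0 \<le> s" using 2 s s0 by (metis less_imp_le power2_le_imp_le)
    have "emeasure (ball_law d) (?A s) \<le> emeasure (ball_law d) (?A s0)"
      using \<open>s0 \<le> s\<close> by (intro emeasure_mono) (auto intro!: borel_measurable_le cap_measurable)
    also have "\<dots> \<le> ennreal (exp (- real d * s0\<^sup>2 / 2))" using s0 by (intro ball_law_cap_small u) auto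
    also have "\<dots> \<le> ennreal (exp (- (real d / 4) * s\<^sup>2))"
      using power_le_one[OF s 2(2), of 2] mult_left_mono[of "s\<^sup>2" 1 "real d"] by (intro ennreal_leI) (simp add: s0)
    finally show ?thesis .
  next
    case 3
    have "(\<Sum>i<d. u i * unit_dir d g i) \<le> 1 * 1" for g
      using abs_inner_le_L2_set[of u "unit_dir d g" "{..<d}"]
        mult_mono[OF u L2_set_unit_dir_le[of d g] zero_le_one L2_set_nonneg] by linarith
    then have "?A s = {}" using 3 by (auto simp: not_le intro: le_less_trans)
    then show ?thesis by (simp only: emeasure_empty zero_le)
  qed
qed


text \<open>The \<open>J + 1\<close> translates of the slab by multiples of \<open>u / (J sqrt d)\<close> are disjoint and lie in a
  ball that is only slightly larger than the unit ball.\<close>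
lemma ball_law_slab:
  assumes u: "L2_set u {..<d} = 1" and d: "0 < d" and J: "0 < J"
  defines "h \<equiv> 1 / (2 * real J * sqrt (real d))"
  shows "emeasure (ball_law d) {g \<in> space (lborel_PiM d). \<bar>\<Sum>i<d. u i * g i\<bar> < h} \<le> ennreal (exp 1 / (real J + 1))"
proof -
  let ?L = "lborel_PiM d" and ?B = "fun_ball d (\<lambda>_. 0) 1"
  have h: "0 < h" using d J by (simp add: h_def)
  have [measurable]: "(\<lambda>g. \<Sum>i<d. u i * g i) \<in> borel_measurable ?L"
    by (intro borel_measurable_sum borel_measurable_times comp_measurable_lborel_PiM borel_measurable_const) auto
  define A where "A = {g \<in> ?B. \<bar>\<Sum>i<d. u i * g i\<bar> < h}"
  have "A = ?B \<inter> {g \<in> space ?L. \<bar>\<Sum>i<d. u i * g i\<bar> < h}" by (auto simp: A_def fun_ball_def)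
  moreover have Sl: "{g \<in> space ?L. \<bar>\<Sum>i<d. u i * g i\<bar> < h} \<in> sets ?L"
    by (intro borel_measurable_less) auto
  ultimately have A: "A \<in> sets ?L" by (simp add: sets.Int)
  define S where "S = (\<lambda>j::nat. fun_affine d 1 (\<lambda>i. - (2 * h * real j * u i)) -` A \<inter> space ?L)"
  have Ss: "S j \<in> sets ?L" for j unfolding S_def by (rule measurable_sets[OF fun_affine_measurable A])
  have Sm: "emeasure ?L (S j) = emeasure ?L A" for j
    using emeasure_lborel_PiM_affine[of 1 A d "\<lambda>i. - (2 * h * real j * u i)"] A by (simp add: S_def)
  have u2: "(\<Sum>i<d. (u i)\<^sup>2) = 1" using u L2_set_power2[of u "{..<d}"] by simp
  have aff: "(\<Sum>i<d. u i * fun_affine d 1 (\<lambda>i. - (2 * h * real j * u i)) g i) = (\<Sum>i<d. u i * g i) - 2 * h * real j" for g j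
  proof -
    have "(\<Sum>i<d. u i * fun_affine d 1 (\<lambda>i. - (2 * h * real j * u i)) g i) = (\<Sum>i<d. u i * g i - 2 * h * real j * (u i)\<^sup>2)"
      by (rule sum.cong) (auto simp: fun_affine_def power2_eq_square algebra_simps)
    also have "\<dots> = (\<Sum>i<d. u i * g i) - 2 * h * real j * (\<Sum>i<d. (u i)\<^sup>2)"
      by (simp add: sum_subtractf sum_distrib_left)
    finally show ?thesis using u2 by simp
  qed
  have disj: "disjoint_family_on S {..J}"
    unfolding disjoint_family_on_def
  proof (intro ballI impI)
    fix j k :: nat assume "j \<noteq> k"
    show "S j \<inter> S k = {}"
    proof (rule ccontr)
      assume "S j \<inter> S k \<noteq> {}"
      then obtain g where "g \<in> S j" "g \<in> S k" by blast
      then have *: "\<bar>(\<Sum>i<d. u i * g i) - 2 * h * real j\<bar> < h" "\<bar>(\<Sum>i<d. u i * g i) - 2 * h * real k\<bar> < h"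
        by (auto simp: S_def A_def aff)
      then have "\<bar>2 * h * real j - 2 * h * real k\<bar> < 2 * h" by linarith
      then have "2 * h * \<bar>real j - real k\<bar> < 2 * h * 1" using h by (simp add: abs_mult flip: right_diff_distrib)
      then have "\<bar>real j - real k\<bar> < 1" using h by (simp only: mult_less_cancel_left_pos mult_pos_pos zero_less_numeral)
      then show False using \<open>j \<noteq> k\<close> by linarith
    qed
  qed
  \<comment> \<open>A translate moves along u by at most 2 h J = 1 / sqrt d. Since the inner product
    with u is at most h in the slab, the cross term is as small as the square of the shift, and the
    squared norm grows by at most 8 (h J)^2 = 2 / d. Thus R^d stays below e.\<close>
  define R where "R = sqrt (1 + 2 / real d)"
  have R: "R > 0" unfolding R_def using d by (simp add: add_pos_nonneg)
  have SR: "S j \<subseteq> fun_ball d (\<lambda>_. 0) R" if "j \<le> J" for j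
  proof
    fix g assume g: "g \<in> S j"
    let ?f = "fun_affine d 1 (\<lambda>i. - (2 * h * real j * u i)) g"
    have f: "(\<Sum>i<d. (?f i)\<^sup>2) \<le> 1" "(\<Sum>i<d. u i * ?f i) \<le> h"
      using g L2_set_le_iff[of 1 ?f "{..<d}"] by (auto simp: S_def A_def fun_ball_def)
    have "(\<Sum>i<d. (g i)\<^sup>2) = (\<Sum>i<d. (?f i)\<^sup>2 + 2 * (2 * h * real j) * (u i * ?f i) + (2 * h * real j)\<^sup>2 * (u i)\<^sup>2)"
      by (rule sum.cong) (auto simp: fun_affine_def power2_eq_square algebra_simps)
    also have "\<dots> = (\<Sum>i<d. (?f i)\<^sup>2) + 2 * (2 * h * real j) * (\<Sum>i<d. u i * ?f i) + (2 * h * real j)\<^sup>2"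
      by (simp add: sum.distrib u2 flip: sum_distrib_left)
    also have "\<dots> \<le> 1 + 2 * (2 * h * real j) * h + (2 * h * real j)\<^sup>2"
      using f h by (intro add_mono mult_left_mono) auto
    also have "\<dots> \<le> 1 + 2 * (2 * h * real J) * (h * real J) + (2 * h * real J)\<^sup>2"
    proof -
      have "h * real j * h \<le> h * real J * (h * real J)"
        unfolding mult.assoc using that h J mult_left_mono[of 1 "real J" h]
        by (simp add: mult_left_mono mult_mono)
      moreover have "(2 * h * real j)\<^sup>2 \<le> (2 * h * real J)\<^sup>2" using that h by (intro power_mono mult_left_mono) auto
      ultimately show ?thesis by simp
    qed
    also have "\<dots> = 1 + 8 * (h * real J)\<^sup>2" by (simp add: power2_eq_square)
    also have "(h * real J)\<^sup>2 = 1 / (4 * real d)" using J d by (simp add: h_def power_divide power_mult_distrib)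
    also have "1 + 8 * (1 / (4 * real d)) = R\<^sup>2" using d by (simp add: R_def add_nonneg_nonneg)
    finally have "L2_set g {..<d} \<le> R" using R by (simp add: L2_set_le_iff)
    then show "g \<in> fun_ball d (\<lambda>_. 0) R" using g by (simp add: fun_ball_def S_def)
  qed
  have "of_nat (Suc J) * emeasure ?L A = (\<Sum>j\<le>J. emeasure ?L (S j))" by (simp add: Sm)
  also have "\<dots> = emeasure ?L (\<Union>j\<le>J. S j)" using disj Ss by (intro sum_emeasure) auto
  also have "\<dots> \<le> emeasure ?L (fun_ball d (\<lambda>_. 0) R)" using SR by (intro emeasure_mono fun_ball_sets) auto
  also have "\<dots> = ennreal (R ^ d) * emeasure ?L ?B" by (rule emeasure_fun_ball[OF R])
  also have "\<dots> \<le> ennreal (exp 1) * emeasure ?L ?B"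
  proof (intro mult_right_mono ennreal_leI)
    have "1 + 2 / real d \<le> (exp (1 / real d))\<^sup>2"
      using exp_ge_add_one_self[of "2 / real d"] by (simp flip: exp_double)
    then have "R \<le> exp (1 / real d)" unfolding R_def by (intro real_le_lsqrt) auto
    then have "R ^ d \<le> exp (1 / real d) ^ d" using R by (intro power_mono) auto
    also have "\<dots> = exp 1" using d by (simp flip: exp_of_nat_mult)
    finally show "R ^ d \<le> exp 1" .
  qed simp
  finally have le: "of_nat (Suc J) * emeasure ?L A \<le> ennreal (exp 1) * emeasure ?L ?B" .
  have "emeasure ?L A \<le> emeasure ?L ?B" by (rule emeasure_mono) (auto simp: A_def)
  with emeasure_unit_fun_ball[of d] obtain a b where ab: "emeasure ?L A = ennreal a" "emeasure ?L ?B = ennreal b" "0 \<le> a" "0 < b"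
    by (cases "emeasure ?L A"; cases "emeasure ?L ?B") (auto simp: top_unique)
  have "real (Suc J) * a \<le> exp 1 * b"
    using le ab by (simp add: ennreal_mult[symmetric] ennreal_of_nat_eq_real_of_nat del: of_nat_Suc)
  then have "a / b \<le> exp 1 / (real J + 1)" using ab by (simp add: field_simps)
  moreover have "emeasure (ball_law d) {g \<in> space ?L. \<bar>\<Sum>i<d. u i * g i\<bar> < h} = ennreal (a / b)"
  proof -
    have "?B \<inter> {g \<in> space ?L. \<bar>\<Sum>i<d. u i * g i\<bar> < h} = A" by (auto simp: A_def fun_ball_def)
    then show ?thesis unfolding ball_law_def using Sl ab by (simp add: divide_ennreal)
  qed
  ultimately show ?thesis by (simp add: ennreal_leI)
qed

lemma L2_set_orthonormal_sum:
  fixes q :: "nat \<Rightarrow> nat \<Rightarrow> real" and r d :: nat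
  assumes orth: "\<And>s t. s < r \<Longrightarrow> t < r \<Longrightarrow> (\<Sum>i<d. q s i * q t i) = (if s = t then 1 else 0)"
  shows "L2_set (\<lambda>i. \<Sum>t<r. f t * q t i) {..<d} = L2_set f {..<r}"
proof -
  have "(\<Sum>i<d. (\<Sum>t<r. f t * q t i)\<^sup>2) = (\<Sum>i<d. \<Sum>s<r. \<Sum>t<r. f s * f t * (q s i * q t i))"
    by (simp add: power2_eq_square sum_product mult_ac)
  also have "\<dots> = (\<Sum>s<r. \<Sum>t<r. f s * f t * (\<Sum>i<d. q s i * q t i))"
    by (subst sum.swap, rule sum.cong[OF refl], subst sum.swap) (simp add: sum_distrib_left)
  also have "\<dots> = (\<Sum>s<r. \<Sum>t<r. if s = t then f s * f t else 0)"
    by (intro sum.cong refl) (auto simp: orth)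
  also have "\<dots> = (\<Sum>s<r. (f s)\<^sup>2)"
  proof (rule sum.cong[OF refl])
    fix s assume "s \<in> {..<r}"
    then show "(\<Sum>t<r. if s = t then f s * f t else 0) = (f s)\<^sup>2"
      using sum.delta'[of "{..<r}" s "\<lambda>t. f s * f t"] by (simp add: power2_eq_square)
  qed
  finally show ?thesis by (simp add: L2_set_def)
qed

text \<open>A vector of length at most 2 in the span of \<open>card G\<close> vectors is close to one of \<open>1536 ^ card G\<close>
  points; balls of radius 1/2 around these points cover all \<open>g\<close> whose direction is close to the span.\<close>
lemma ball_law_near_span:
  fixes w :: "'j \<Rightarrow> nat \<Rightarrow> real"
  assumes G: "finite G"
    and A: "A \<in> sets (lborel_PiM d)"
    and sub: "\<And>g. g \<in> A \<Longrightarrow> \<exists>c. L2_set (\<lambda>i. unit_dir d g i - (\<Sum>j\<in>G. c j * w j i)) {..<d} \<le> 1 / 4"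
  shows "emeasure (ball_law d) A \<le> ennreal (1536 ^ card G * (1/2) ^ d)"
proof -
  obtain r q where r: "r \<le> card G"
    and orth: "\<And>s t. s < r \<Longrightarrow> t < r \<Longrightarrow> (\<Sum>i<d. q s i * q t i) = (if s = t then 1 else (0::real))"
    and wq': "\<forall>j\<in>G. \<exists>e. \<forall>i<d. w j i = (\<Sum>t<r. e t * q t i)"
    using gram_schmidt_functions[OF G, of d w] by blast
  from wq' obtain e where wq: "\<And>j i. j \<in> G \<Longrightarrow> i < d \<Longrightarrow> w j i = (\<Sum>t<r. e j t * q t i)" by metis
  \<comment> \<open>The coefficients of the point nearest to \<open>g\<close> in the span have norm
    at most 5/4, so half of them lie in the unit ball. A net of resolution 1/8, scaled by 2, costs
    1/4; the distance to the span costs another 1/4. The base is 6 * 2^8 = 1536.\<close>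
  obtain Q :: "(nat \<Rightarrow> real) set" where Q: "finite Q" "real (card Q) \<le> (6 * 2 ^ 8) ^ r"
    "\<And>u. L2_set u {..<r} \<le> 1 \<Longrightarrow> \<exists>q\<in>Q. L2_set (\<lambda>i. u i - q i) {..<r} \<le> 1 / real 8"
    using net_exists[of 8 r] by auto
  define Q' where "Q' = (\<lambda>y i. \<Sum>t<r. 2 * y t * q t i) ` Q"
  have "emeasure (ball_law d) A \<le> ennreal (real (card Q') * (1/2) ^ d)"
  proof (rule ball_law_cover[OF A])
    show "finite Q'" using Q by (simp add: Q'_def)
    fix g assume g: "g \<in> A" "L2_set g {..<d} \<le> 1"
    define t where "t = L2_set g {..<d}"
    have t: "0 \<le> t" "t \<le> 1" using g by (auto simp: t_def)
    obtain c where c: "L2_set (\<lambda>i. unit_dir d g i - (\<Sum>j\<in>G. c j * w j i)) {..<d} \<le> 1 / 4"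
      using sub[OF g(1)] by blast
    define f where "f = (\<lambda>s. t * (\<Sum>j\<in>G. c j * e j s))"
    have f: "t * (\<Sum>j\<in>G. c j * w j i) = (\<Sum>s<r. f s * q s i)" if "i < d" for i
    proof -
      have "(\<Sum>j\<in>G. c j * w j i) = (\<Sum>j\<in>G. \<Sum>s<r. c j * e j s * q s i)"
        using wq that by (auto simp: sum_distrib_left mult.assoc intro!: sum.cong)
      also have "\<dots> = (\<Sum>s<r. (\<Sum>j\<in>G. c j * e j s) * q s i)"
        by (subst sum.swap) (simp add: sum_distrib_right)
      finally show ?thesis
        unfolding f_def using sum_distrib_left[of t "\<lambda>s. (\<Sum>j\<in>G. c j * e j s) * q s i" "{..<r}"] by (simp add: mult.assoc)
    qed
    have gf: "L2_set (\<lambda>i. g i - (\<Sum>s<r. f s * q s i)) {..<d} \<le> 1 / 4"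
    proof -
      have "L2_set (\<lambda>i. g i - (\<Sum>s<r. f s * q s i)) {..<d} = L2_set (\<lambda>i. t * (unit_dir d g i - (\<Sum>j\<in>G. c j * w j i))) {..<d}"
        by (rule L2_set_cong) (auto simp: right_diff_distrib f[unfolded t_def] t_def unit_dir_scale)
      also have "\<dots> \<le> 1 * (1 / 4)" unfolding L2_set_scale using t c by (intro mult_mono) auto
      finally show ?thesis by simp
    qed
    have "L2_set f {..<r} = L2_set (\<lambda>i. \<Sum>s<r. f s * q s i) {..<d}" using L2_set_orthonormal_sum[OF orth] by simp
    also have "\<dots> \<le> t + 1 / 4"
      using L2_set_triangle_diff[of "\<lambda>i. \<Sum>s<r. f s * q s i" "{..<d}" g] gf
      by (simp add: t_def L2_set_minus_commute[of g])
    finally have "L2_set (\<lambda>s. (1/2) * f s) {..<r} \<le> 1" unfolding L2_set_scale using t by simp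
    then obtain y where y: "y \<in> Q" "L2_set (\<lambda>s. (1/2) * f s - y s) {..<r} \<le> 1 / 8" using Q(3) by auto
    have "L2_set (\<lambda>i. g i - (\<Sum>s<r. 2 * y s * q s i)) {..<d}
      \<le> L2_set (\<lambda>i. g i - (\<Sum>s<r. f s * q s i)) {..<d} + L2_set (\<lambda>i. (\<Sum>s<r. f s * q s i) - (\<Sum>s<r. 2 * y s * q s i)) {..<d}"
      using L2_set_triangle_ineq[of "\<lambda>i. g i - (\<Sum>s<r. f s * q s i)" "\<lambda>i. (\<Sum>s<r. f s * q s i) - (\<Sum>s<r. 2 * y s * q s i)"] by simp
    also have "L2_set (\<lambda>i. (\<Sum>s<r. f s * q s i) - (\<Sum>s<r. 2 * y s * q s i)) {..<d} = L2_set (\<lambda>i. \<Sum>s<r. (2 * ((1/2) * f s - y s)) * q s i) {..<d}"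
      by (simp add: left_diff_distrib sum_subtractf)
    also have "\<dots> = 2 * L2_set (\<lambda>s. (1/2) * f s - y s) {..<r}"
      using L2_set_orthonormal_sum[where q=q and r=r and d=d and f="\<lambda>s. 2 * ((1/2) * f s - y s)", OF orth]
        L2_set_scale[of 2 "\<lambda>s. (1/2) * f s - y s" "{..<r}"] by simp
    finally have "L2_set (\<lambda>i. g i - (\<Sum>s<r. 2 * y s * q s i)) {..<d} \<le> 1 / 2" using gf y by linarith
    then show "\<exists>p\<in>Q'. L2_set (\<lambda>i. g i - p i) {..<d} \<le> 1 / 2" using y(1) by (auto simp: Q'_def)
  qed auto
  also have "real (card Q') * (1/2) ^ d \<le> 1536 ^ card G * (1/2) ^ d"
  proof -
    have "real (card Q') \<le> real (card Q)" using Q(1) by (simp add: Q'_def card_image_le)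
    also have "\<dots> \<le> 1536 ^ r" using Q(2) by simp
    also have "\<dots> \<le> 1536 ^ card G" using r by (intro power_increasing) auto
    finally show ?thesis by (intro mult_right_mono) auto
  qed
  finally show ?thesis by (simp add: ennreal_leI)
qed

section \<open>Subgaussian vectors\<close>

lemma prod_mono_ennreal:
  fixes f g :: "'i \<Rightarrow> ennreal"
  assumes "\<And>i. i \<in> A \<Longrightarrow> f i \<le> g i"
  shows "prod f A \<le> prod g A"
  using assms by (induction A rule: infinite_finite_induct) (auto intro: mult_mono)

lemma markov_exp:
  assumes f: "f \<in> borel_measurable M" and C: "(\<integral>\<^sup>+ x. ennreal (exp (f x)) \<partial>M) \<le> ennreal C"
  shows "emeasure M {x \<in> space M. a \<le> f x} \<le> ennreal (C * exp (- a))"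
proof -
  have "emeasure M {x \<in> space M. a \<le> f x} \<le> ennreal (exp (- 1 * a)) * (\<integral>\<^sup>+ x. ennreal (exp (1 * f x)) * indicator (space M) x \<partial>M)"
    using Chernoff_ineq_nn_integral_ge[of 1 "space M" M f a] f by simp
  also have "(\<integral>\<^sup>+ x. ennreal (exp (1 * f x)) * indicator (space M) x \<partial>M) = (\<integral>\<^sup>+ x. ennreal (exp (f x)) \<partial>M)"
    by (intro nn_integral_cong) simp
  also have "ennreal (exp (- 1 * a)) * \<dots> \<le> ennreal (exp (- 1 * a)) * ennreal C"
    by (intro mult_left_mono C) simp
  also have "\<dots> = ennreal (C * exp (- a))" using ennreal_mult'[of "exp (- a)" C] by (simp add: mult.commute)
  finally show ?thesis .
qed

text \<open>With Y = c X^2 / 2 the tails give P (Y >= k) <= 2 exp (-2 k), so summing exp (k + 1)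
  over the integer levels leaves a geometric series with value 2 e / (1 - 1 / e).\<close>

lemma nn_integral_exp_square_from_tail:
  assumes "prob_space M" and X [measurable]: "X \<in> borel_measurable M" and c: "0 < c"
    and tail1: "\<And>s. 0 \<le> s \<Longrightarrow> emeasure M {x \<in> space M. s \<le> X x} \<le> ennreal (exp (- c * s\<^sup>2))"
    and tail2: "\<And>s. 0 \<le> s \<Longrightarrow> emeasure M {x \<in> space M. s \<le> - X x} \<le> ennreal (exp (- c * s\<^sup>2))"
  shows "(\<integral>\<^sup>+ x. ennreal (exp (c / 2 * (X x)\<^sup>2)) \<partial>M) \<le> 9"
proof -
  define Y where "Y = (\<lambda>x. c / 2 * (X x)\<^sup>2)"
  have [measurable]: "Y \<in> borel_measurable M" unfolding Y_def by measurable
  have Y0: "0 \<le> Y x" for x using c by (simp add: Y_def)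
  let ?A = "\<lambda>k. {x \<in> space M. real k \<le> Y x}"
  have tail: "emeasure M (?A k) \<le> ennreal (2 * exp (- 2 * real k))" for k
  proof -
    define s where "s = sqrt (2 * real k / c)"
    have s: "0 \<le> s" "s\<^sup>2 = 2 * real k / c" using c by (auto simp: s_def)
    have sub: "?A k \<subseteq> {x \<in> space M. s \<le> X x} \<union> {x \<in> space M. s \<le> - X x}"
    proof
      fix x assume x: "x \<in> ?A k"
      then have "2 * real k \<le> (X x)\<^sup>2 * c" by (simp add: Y_def mult.commute)
      then have "s\<^sup>2 \<le> \<bar>X x\<bar>\<^sup>2" using c by (simp add: s pos_divide_le_eq)
      then have "s \<le> \<bar>X x\<bar>" by (rule power2_le_imp_le) simp
      then show "x \<in> {x \<in> space M. s \<le> X x} \<union> {x \<in> space M. s \<le> - X x}" using x by auto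
    qed
    have "emeasure M (?A k) \<le> emeasure M {x \<in> space M. s \<le> X x} + emeasure M {x \<in> space M. s \<le> - X x}"
      by (rule order_trans[OF emeasure_mono[OF sub] emeasure_subadditive])
        (intro sets.Un borel_measurable_le borel_measurable_const borel_measurable_uminus X)+
    also have "\<dots> \<le> ennreal (exp (- c * s\<^sup>2)) + ennreal (exp (- c * s\<^sup>2))"
      by (intro add_mono tail1 tail2 s)
    also have "\<dots> = ennreal (2 * exp (- 2 * real k))" using c by (simp add: s flip: ennreal_plus)
    finally show ?thesis .
  qed
  have "(\<integral>\<^sup>+ x. ennreal (exp (Y x)) \<partial>M) \<le> (\<integral>\<^sup>+ x. (\<Sum>k. ennreal (exp (real k + 1)) * indicator (?A k) x) \<partial>M)"
  proof (rule nn_integral_mono)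
    fix x assume x: "x \<in> space M"
    define k where "k = nat \<lfloor>Y x\<rfloor>"
    have "real k \<le> Y x" "Y x \<le> real k + 1" using Y0[of x] by (auto simp: k_def)
    then have "ennreal (exp (Y x)) \<le> ennreal (exp (real k + 1)) * indicator (?A k) x" using x by (simp add: ennreal_leI)
    also have "\<dots> \<le> (\<Sum>k. ennreal (exp (real k + 1)) * indicator (?A k) x)"
    proof -
      define h where "h = (\<lambda>k. ennreal (exp (real k + 1)) * indicator (?A k) x)"
      have "sum h {k} \<le> suminf h" by (rule sum_le_suminf) auto
      then show ?thesis by (simp add: h_def del: sum_mult_indicator)
    qed
    finally show "ennreal (exp (Y x)) \<le> (\<Sum>k. ennreal (exp (real k + 1)) * indicator (?A k) x)" .
  qed
  also have "\<dots> = (\<Sum>k. ennreal (exp (real k + 1)) * emeasure M (?A k))"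
    by (subst nn_integral_suminf) (auto simp: nn_integral_cmult)
  also have "\<dots> \<le> (\<Sum>k. ennreal ((2 * exp 1) * exp (- 1) ^ k))"
  proof (intro suminf_le summableI)
    fix k
    have "ennreal (exp (real k + 1)) * emeasure M (?A k) \<le> ennreal (exp (real k + 1)) * ennreal (2 * exp (- 2 * real k))"
      by (intro mult_left_mono tail) simp
    also have "\<dots> = ennreal ((2 * exp 1) * exp (- 1) ^ k)"
      by (simp add: mult_exp_exp flip: ennreal_mult exp_of_nat_mult)
    finally show "ennreal (exp (real k + 1)) * emeasure M (?A k) \<le> ennreal ((2 * exp 1) * exp (- 1) ^ k)" .
  qed
  also have "\<dots> = ennreal (2 * exp 1 * (1 / (1 - exp (- 1))))"
    by (rule suminf_ennreal_eq) (use sums_mult[OF geometric_sums[of "exp (- 1::real)"], of "2 * exp 1"] in \<open>auto simp: mult.assoc\<close>)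
  also have "\<dots> \<le> ennreal 9"
  proof (rule ennreal_leI)
    define e where "e = exp (1::real)"
    have e: "2 \<le> e" "e \<le> 3" using exp_ge_add_one_self[of "1::real"] exp_le by (auto simp: e_def)
    \<comment> \<open>The claim 2 e^2 <= 9 (e - 1) is this factorization; it needs only 3/2 <= e <=
      3.\<close>
    have "(2 * e - 3) * (e - 3) \<le> 0" using e by (intro mult_nonneg_nonpos) auto
    then have "2 * e * e \<le> 9 * (e - 1)" by (simp add: algebra_simps)
    then have "2 * e * (1 / (1 - 1 / e)) \<le> 9" using e by (simp add: field_simps)
    then show "2 * exp 1 * (1 / (1 - exp (- 1))) \<le> (9::real)" by (simp add: e_def exp_minus inverse_eq_divide)
  qed
  finally show ?thesis by (simp add: Y_def)
qed

text \<open>The scale is an inverse variance: \<open>\<langle>u, \<xi>\<rangle>\<close> has bounded exponential square moment as long as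
  \<open>|u|\<^sup>2 \<le> q\<close>.\<close>
definition subgaussian :: "'a measure \<Rightarrow> nat \<Rightarrow> ('a \<Rightarrow> nat \<Rightarrow> real) \<Rightarrow> real \<Rightarrow> bool" where
  "subgaussian M D \<xi> q \<longleftrightarrow> (\<forall>i<D. (\<lambda>x. \<xi> x i) \<in> borel_measurable M) \<and>
     (\<forall>u. (\<Sum>i<D. (u i)\<^sup>2) \<le> q \<longrightarrow> (\<integral>\<^sup>+ x. ennreal (exp ((\<Sum>i<D. u i * \<xi> x i)\<^sup>2)) \<partial>M) \<le> 9)"

lemma subgaussian_inner_measurable:
  "subgaussian M D \<xi> q \<Longrightarrow> (\<lambda>x. \<Sum>i<D. u i * \<xi> x i) \<in> borel_measurable M"
  unfolding subgaussian_def by (intro borel_measurable_sum borel_measurable_times) auto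

text \<open>A one-sided tail for all u also covers -u and hence both tails. Vectors of squared
  length c / 2 are rescaled to unit vectors.\<close>

lemma subgaussian_from_tail:
  assumes M: "prob_space M" and c: "0 < c"
    and \<xi>: "\<And>i. i < D \<Longrightarrow> (\<lambda>x. \<xi> x i) \<in> borel_measurable M"
    and tail: "\<And>u s. L2_set u {..<D} \<le> 1 \<Longrightarrow> 0 \<le> s \<Longrightarrow>
      emeasure M {x \<in> space M. s \<le> (\<Sum>i<D. u i * \<xi> x i)} \<le> ennreal (exp (- c * s\<^sup>2))"
  shows "subgaussian M D \<xi> (c / 2)"
  unfolding subgaussian_def
proof (intro conjI allI impI \<xi>)
  fix u :: "nat \<Rightarrow> real" assume u: "(\<Sum>i<D. (u i)\<^sup>2) \<le> c / 2"
  define a where "a = sqrt (c / 2)"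
  have a: "a > 0" "a\<^sup>2 = c / 2" using c by (auto simp: a_def)
  define v where "v = (\<lambda>i. (1 / a) * u i)"
  have "L2_set u {..<D} \<le> a" using u a by (simp add: L2_set_le_iff)
  then have v: "L2_set v {..<D} \<le> 1" unfolding v_def L2_set_scale using a by simp
  have v': "L2_set (\<lambda>i. - v i) {..<D} \<le> 1" using v by (simp add: L2_set_def)
  have uv: "c / 2 * (\<Sum>i<D. v i * \<xi> x i)\<^sup>2 = (\<Sum>i<D. u i * \<xi> x i)\<^sup>2" for x
  proof -
    have "(\<Sum>i<D. u i * \<xi> x i) = a * (\<Sum>i<D. v i * \<xi> x i)"
      using a by (simp add: v_def sum_distrib_left)
    then show ?thesis using a by (simp add: power_mult_distrib)
  qed
  have "(\<integral>\<^sup>+ x. ennreal (exp (c / 2 * (\<Sum>i<D. v i * \<xi> x i)\<^sup>2)) \<partial>M) \<le> 9"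
    by (rule nn_integral_exp_square_from_tail[OF M _ c])
      (use tail[OF v] tail[OF v'] \<xi> in \<open>auto simp: sum_negf intro!: borel_measurable_sum borel_measurable_times\<close>)
  then show "(\<integral>\<^sup>+ x. ennreal (exp ((\<Sum>i<D. u i * \<xi> x i)\<^sup>2)) \<partial>M) \<le> 9" by (simp only: uv)
qed

lemma subgaussian_ball_law:
  assumes "0 < d"
  shows "subgaussian (ball_law d) d (unit_dir d) (real d / 8)"
proof -
  have "subgaussian (ball_law d) d (unit_dir d) (real d / 4 / 2)"
  proof (rule subgaussian_from_tail[OF prob_space_ball_law])
    show "(\<lambda>g. unit_dir d g i) \<in> borel_measurable (ball_law d)" if "i < d" for i
      using unit_dir_measurable[OF that] by (simp add: measurable_cong_sets[OF ball_law_sets refl])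
  qed (use assms ball_law_cap in auto)
  then show ?thesis by simp
qed

section \<open>Gaussian vectors\<close>

abbreviation (input) normal_PiM :: "nat \<Rightarrow> real \<Rightarrow> (nat \<Rightarrow> real) measure" where
  "normal_PiM n s \<equiv> (\<Pi>\<^sub>M k\<in>{..<n}. density lborel (normal_density 0 s))"

lemma nn_integral_normal_exp_linear:
  assumes s: "0 < s"
  shows "(\<integral>\<^sup>+ x. ennreal (exp (t * x)) \<partial>density lborel (normal_density 0 s)) = ennreal (exp (t\<^sup>2 * s\<^sup>2 / 2))"
proof -
  have eq: "normal_density 0 s x * exp (t * x) = exp (t\<^sup>2 * s\<^sup>2 / 2) * normal_density (t * s\<^sup>2) s x" for x
  proof -
    have "- (x\<^sup>2) / (2 * s\<^sup>2) + t * x = t\<^sup>2 * s\<^sup>2 / 2 + - ((x - t * s\<^sup>2)\<^sup>2) / (2 * s\<^sup>2)"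
      using s by (simp add: field_simps power2_eq_square)
    then have "exp (- (x\<^sup>2) / (2 * s\<^sup>2)) * exp (t * x) = exp (t\<^sup>2 * s\<^sup>2 / 2) * exp (- ((x - t * s\<^sup>2)\<^sup>2) / (2 * s\<^sup>2))"
      unfolding exp_add[symmetric] by simp
    then show ?thesis by (simp add: normal_density_def)
  qed
  have "(\<integral>\<^sup>+ x. ennreal (exp (t * x)) \<partial>density lborel (normal_density 0 s)) = (\<integral>\<^sup>+ x. ennreal (exp (t\<^sup>2 * s\<^sup>2 / 2)) * ennreal (normal_density (t * s\<^sup>2) s x) \<partial>lborel)"
    by (subst nn_integral_density) (auto simp: eq simp flip: ennreal_mult)
  also have "\<dots> = ennreal (exp (t\<^sup>2 * s\<^sup>2 / 2)) * (\<integral>\<^sup>+ x. ennreal (normal_density (t * s\<^sup>2) s x) \<partial>lborel)"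
    by (rule nn_integral_cmult) simp
  also have "(\<integral>\<^sup>+ x. ennreal (normal_density (t * s\<^sup>2) s x) \<partial>lborel) = 1"
    using prob_space.emeasure_space_1[OF prob_space_normal_density[OF s, of "t * s\<^sup>2"]] by (simp add: emeasure_density)
  finally show ?thesis by simp
qed

lemma nn_integral_normal_exp_square:
  assumes s: "0 < s"
  shows "(\<integral>\<^sup>+ x. ennreal (exp (x\<^sup>2 / (4 * s\<^sup>2))) \<partial>density lborel (normal_density 0 s)) = ennreal (sqrt 2)"
proof -
  have eq: "normal_density 0 s x * exp (x\<^sup>2 / (4 * s\<^sup>2)) = sqrt 2 * normal_density 0 (sqrt 2 * s) x" for x
  proof -
    have "exp (- (x\<^sup>2) / (2 * s\<^sup>2)) * exp (x\<^sup>2 / (4 * s\<^sup>2)) = exp (- (x\<^sup>2) / (2 * (sqrt 2 * s)\<^sup>2))"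
      unfolding exp_add[symmetric] using s by (simp add: power_mult_distrib field_simps)
    moreover have "sqrt (2 * pi * (sqrt 2 * s)\<^sup>2) = sqrt 2 * sqrt (2 * pi * s\<^sup>2)"
      by (simp add: power_mult_distrib flip: real_sqrt_mult)
    ultimately show ?thesis using s by (simp add: normal_density_def field_simps)
  qed
  have "(\<integral>\<^sup>+ x. ennreal (exp (x\<^sup>2 / (4 * s\<^sup>2))) \<partial>density lborel (normal_density 0 s)) = (\<integral>\<^sup>+ x. ennreal (sqrt 2) * ennreal (normal_density 0 (sqrt 2 * s) x) \<partial>lborel)"
    by (subst nn_integral_density) (auto simp: eq simp flip: ennreal_mult)
  also have "\<dots> = ennreal (sqrt 2) * (\<integral>\<^sup>+ x. ennreal (normal_density 0 (sqrt 2 * s) x) \<partial>lborel)"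
    by (rule nn_integral_cmult) simp
  also have "(\<integral>\<^sup>+ x. ennreal (normal_density 0 (sqrt 2 * s) x) \<partial>lborel) = 1"
    using prob_space.emeasure_space_1[OF prob_space_normal_density[of "sqrt 2 * s" 0]] s by (simp add: emeasure_density)
  finally show ?thesis by simp
qed

lemma comp_measurable_normal_PiM: "i < n \<Longrightarrow> (\<lambda>g. g i) \<in> borel_measurable (normal_PiM n s)"
  using measurable_component_singleton[of i "{..<n}" "\<lambda>_. density lborel (normal_density 0 s)"] by simp

lemma prob_space_normal_PiM: "0 < s \<Longrightarrow> prob_space (normal_PiM n s)"
  by (intro prob_space_PiM prob_space_normal_density)

lemma subgaussian_normal_PiM:
  assumes s: "0 < s"
  shows "subgaussian (normal_PiM n s) n (\<lambda>z. z) (1 / (4 * s\<^sup>2))"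
proof -
  interpret N: product_sigma_finite "\<lambda>_::nat. density lborel (normal_density 0 s) :: real measure"
    by (intro product_sigma_finite.intro prob_space_imp_sigma_finite prob_space_normal_density s)
  have "subgaussian (normal_PiM n s) n (\<lambda>z. z) (1 / (2 * s\<^sup>2) / 2)"
  proof (rule subgaussian_from_tail[OF prob_space_normal_PiM[OF s]])
    show "(\<lambda>z. z i) \<in> borel_measurable (normal_PiM n s)" if "i < n" for i
      by (rule comp_measurable_normal_PiM[OF that])
    fix u :: "nat \<Rightarrow> real" and a :: real assume u: "L2_set u {..<n} \<le> 1" and a: "0 \<le> a"
    \<comment> \<open>The minimizer of the exponent t^2 s^2 / 2 - t a in Chernoff's bound.\<close>
    define t where "t = a / s\<^sup>2"
    have u2: "(\<Sum>i<n. (u i)\<^sup>2) \<le> 1" using u L2_set_le_iff[of 1 u "{..<n}"] by simp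
    have "(\<integral>\<^sup>+ z. ennreal (exp (\<Sum>i<n. t * u i * z i)) \<partial>normal_PiM n s) =
        (\<integral>\<^sup>+ z. (\<Prod>i<n. ennreal (exp (t * u i * z i))) \<partial>normal_PiM n s)"
      by (simp add: exp_sum prod_ennreal)
    also have "\<dots> = (\<Prod>i<n. \<integral>\<^sup>+ x. ennreal (exp (t * u i * x)) \<partial>density lborel (normal_density 0 s))"
      by (rule N.product_nn_integral_prod) auto
    also have "\<dots> = ennreal (exp (\<Sum>i<n. (t * u i)\<^sup>2 * s\<^sup>2 / 2))"
      by (simp add: nn_integral_normal_exp_linear[OF s] exp_sum prod_ennreal)
    also have "\<dots> \<le> ennreal (exp (t\<^sup>2 * s\<^sup>2 / 2))"
    proof -
      have "(\<Sum>i<n. (t * u i)\<^sup>2 * s\<^sup>2 / 2) = t\<^sup>2 * s\<^sup>2 / 2 * (\<Sum>i<n. (u i)\<^sup>2)"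
        by (simp add: sum_distrib_left power_mult_distrib mult_ac)
      also have "\<dots> \<le> t\<^sup>2 * s\<^sup>2 / 2 * 1" using u2 by (intro mult_left_mono) auto
      finally show ?thesis by (simp add: ennreal_leI)
    qed
    finally have C: "(\<integral>\<^sup>+ z. ennreal (exp (\<Sum>i<n. t * u i * z i)) \<partial>normal_PiM n s) \<le> ennreal (exp (t\<^sup>2 * s\<^sup>2 / 2))" .
    have meas: "(\<lambda>z. \<Sum>i<n. t * u i * z i) \<in> borel_measurable (normal_PiM n s)"
      by (intro borel_measurable_sum borel_measurable_times borel_measurable_const comp_measurable_normal_PiM) auto
    have "emeasure (normal_PiM n s) {z \<in> space (normal_PiM n s). a \<le> (\<Sum>i<n. u i * z i)}
       \<le> emeasure (normal_PiM n s) {z \<in> space (normal_PiM n s). t * a \<le> (\<Sum>i<n. t * u i * z i)}"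
    proof (rule emeasure_mono)
      show "{z \<in> space (normal_PiM n s). a \<le> (\<Sum>i<n. u i * z i)} \<subseteq> {z \<in> space (normal_PiM n s). t * a \<le> (\<Sum>i<n. t * u i * z i)}"
      proof -
        have "t * a \<le> (\<Sum>i<n. t * u i * z i)" if "a \<le> (\<Sum>i<n. u i * z i)" for z
        proof -
          have "t * a \<le> t * (\<Sum>i<n. u i * z i)" using that a by (intro mult_left_mono) (auto simp: t_def)
          then show ?thesis by (simp only: sum_distrib_left mult.assoc)
        qed
        then show ?thesis by blast
      qed
    qed (intro borel_measurable_le borel_measurable_const meas)
    also have "\<dots> \<le> ennreal (exp (t\<^sup>2 * s\<^sup>2 / 2) * exp (- (t * a)))" by (rule markov_exp[OF meas C])
    also have "exp (t\<^sup>2 * s\<^sup>2 / 2) * exp (- (t * a)) = exp (- (1 / (2 * s\<^sup>2)) * a\<^sup>2)"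
      using s by (simp add: mult_exp_exp t_def field_simps power2_eq_square)
    finally show "emeasure (normal_PiM n s) {z \<in> space (normal_PiM n s). a \<le> (\<Sum>i<n. u i * z i)} \<le> ennreal (exp (- (1 / (2 * s\<^sup>2)) * a\<^sup>2))" .
  qed (use s in auto)
  then show ?thesis by simp
qed

text \<open>The threshold is (3/2)^2 times the mean n s^2, which later becomes |z| < 3/2 sigma. Per
  coordinate the exponential moment sqrt 2 is at most exp (7/16) and the threshold contributes exp
  (-9/16); the difference 1/8 is the final gamma_1.\<close>

lemma normal_PiM_chi_square_tail:
  assumes s: "0 < s"
  shows "emeasure (normal_PiM n s) {z \<in> space (normal_PiM n s). 9 / 4 * (real n * s\<^sup>2) \<le> (\<Sum>i<n. (z i)\<^sup>2)} \<le> ennreal (exp (- (1 / 8) * real n))"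
proof -
  interpret N: product_sigma_finite "\<lambda>_::nat. density lborel (normal_density 0 s) :: real measure"
    by (intro product_sigma_finite.intro prob_space_imp_sigma_finite prob_space_normal_density s)
  have meas: "(\<lambda>z. \<Sum>i<n. (z i)\<^sup>2 / (4 * s\<^sup>2)) \<in> borel_measurable (normal_PiM n s)"
    by (intro borel_measurable_sum borel_measurable_divide borel_measurable_power borel_measurable_const comp_measurable_normal_PiM) auto
  have "(\<integral>\<^sup>+ z. ennreal (exp (\<Sum>i<n. (z i)\<^sup>2 / (4 * s\<^sup>2))) \<partial>normal_PiM n s) =
      (\<integral>\<^sup>+ z. (\<Prod>i<n. ennreal (exp ((z i)\<^sup>2 / (4 * s\<^sup>2)))) \<partial>normal_PiM n s)"
    by (simp add: exp_sum prod_ennreal)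
  also have "\<dots> = (\<Prod>i<n. \<integral>\<^sup>+ x. ennreal (exp (x\<^sup>2 / (4 * s\<^sup>2))) \<partial>density lborel (normal_density 0 s))"
    by (rule N.product_nn_integral_prod) auto
  also have "\<dots> = ennreal (sqrt 2 ^ n)"
    by (simp add: nn_integral_normal_exp_square[OF s] ennreal_power)
  finally have C: "(\<integral>\<^sup>+ z. ennreal (exp (\<Sum>i<n. (z i)\<^sup>2 / (4 * s\<^sup>2))) \<partial>normal_PiM n s) \<le> ennreal (sqrt 2 ^ n)" by simp
  have "{z \<in> space (normal_PiM n s). 9 / 4 * (real n * s\<^sup>2) \<le> (\<Sum>i<n. (z i)\<^sup>2)} = {z \<in> space (normal_PiM n s). 9 / 16 * real n \<le> (\<Sum>i<n. (z i)\<^sup>2 / (4 * s\<^sup>2))}"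
    using s by (auto simp: field_simps simp flip: sum_divide_distrib)
  also have "emeasure (normal_PiM n s) \<dots> \<le> ennreal (sqrt 2 ^ n * exp (- (9 / 16 * real n)))" by (rule markov_exp[OF meas C])
  also have "\<dots> \<le> ennreal (exp (- (1 / 8) * real n))"
  proof (rule ennreal_leI)
    have "(2::real) \<le> 1 + 7/8 + (7/8)\<^sup>2 / 2" by (simp add: power2_eq_square)
    also have "\<dots> \<le> exp (7/8)" by (rule exp_lower_Taylor_quadratic) simp
    also have "\<dots> = (exp (7/16))\<^sup>2" by (simp flip: exp_double)
    finally have "sqrt 2 \<le> exp (7/16)" by (intro real_le_lsqrt) auto
    then have "sqrt 2 ^ n \<le> exp (7/16) ^ n" by (intro power_mono) auto
    also have "\<dots> = exp (7/16 * real n)" by (simp add: mult.commute flip: exp_of_nat_mult)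
    finally have "sqrt 2 ^ n * exp (- (9 / 16 * real n)) \<le> exp (7/16 * real n) * exp (- (9 / 16 * real n))" by (intro mult_right_mono) auto
    also have "\<dots> = exp (- (1 / 8) * real n)" by (simp add: mult_exp_exp)
    finally show "sqrt 2 ^ n * exp (- (9 / 16 * real n)) \<le> exp (- (1 / 8) * real n)" .
  qed
  finally show ?thesis .
qed

text \<open>Jensen's inequality with weights proportional to the squared row lengths.\<close>
lemma subgaussian_matrix:
  fixes p :: nat
  assumes sg: "subgaussian M D \<xi> q" and M: "prob_space M"
    and u: "(\<Sum>r<p. \<Sum>i<D. (u r i)\<^sup>2) \<le> q"
  shows "(\<integral>\<^sup>+ x. ennreal (exp (\<Sum>r<p. (\<Sum>i<D. u r i * \<xi> x i)\<^sup>2)) \<partial>M) \<le> 9"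
proof -
  interpret prob_space M by fact
  define Q where "Q = (\<Sum>r<p. \<Sum>i<D. (u r i)\<^sup>2)"
  show ?thesis
  proof (cases "Q = 0")
    case True
    then have "\<forall>r<p. \<forall>i<D. u r i = 0" by (auto simp: Q_def sum_nonneg_eq_0_iff sum_nonneg)
    then show ?thesis by (simp add: emeasure_space_1)
  next
    case False
    moreover have "Q \<ge> 0" unfolding Q_def by (intro sum_nonneg zero_le_power2)
    ultimately have Q: "Q > 0" by linarith
    define w where "w = (\<lambda>r. (\<Sum>i<D. (u r i)\<^sup>2) / Q)"
    have w: "0 \<le> w r" for r using Q by (simp add: w_def sum_nonneg)
    have w1: "(\<Sum>r<p. w r) = 1" using Q by (simp add: w_def Q_def flip: sum_divide_distrib)
    have p: "{..<p} \<noteq> {}" using w1 by (cases "p = 0") auto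
    define X where "X = (\<lambda>r x. (\<Sum>i<D. (u r i / sqrt (w r)) * \<xi> x i)\<^sup>2)"
    have X: "w r * X r x = (\<Sum>i<D. u r i * \<xi> x i)\<^sup>2" if "r < p" for r x
    \<comment> \<open>A zero weight means a zero row, and division by \<open>sqrt 0\<close> also
      gives 0, so both sides vanish.\<close>
    proof (cases "w r = 0")
      case True
      then have "\<forall>i<D. u r i = 0" using Q by (simp add: w_def sum_nonneg_eq_0_iff)
      then show ?thesis by (simp add: True)
    next
      case False
      then have "w r > 0" using w[of r] by simp
      have "X r x = ((\<Sum>i<D. u r i * \<xi> x i) / sqrt (w r))\<^sup>2" unfolding X_def by (simp add: sum_divide_distrib)
      then show ?thesis using \<open>w r > 0\<close> by (simp add: power_divide)
    qed
    have "(\<integral>\<^sup>+ x. ennreal (exp (\<Sum>r<p. (\<Sum>i<D. u r i * \<xi> x i)\<^sup>2)) \<partial>M) \<le> (\<integral>\<^sup>+ x. (\<Sum>r<p. ennreal (w r) * ennreal (exp (X r x))) \<partial>M)"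
    proof (rule nn_integral_mono)
      fix x
      have "exp (\<Sum>r<p. w r *\<^sub>R X r x) \<le> (\<Sum>r<p. w r * exp (X r x))"
        by (rule convex_on_sum[OF _ p exp_convex w1]) (use w in auto)
      moreover have "(\<Sum>r<p. w r *\<^sub>R X r x) = (\<Sum>r<p. (\<Sum>i<D. u r i * \<xi> x i)\<^sup>2)"
        using X by (intro sum.cong) auto
      ultimately have "ennreal (exp (\<Sum>r<p. (\<Sum>i<D. u r i * \<xi> x i)\<^sup>2)) \<le> ennreal (\<Sum>r<p. w r * exp (X r x))"
        by (simp add: ennreal_leI)
      also have "\<dots> = (\<Sum>r<p. ennreal (w r) * ennreal (exp (X r x)))"
        using w by (simp add: ennreal_mult flip: sum_ennreal)
      finally show "ennreal (exp (\<Sum>r<p. (\<Sum>i<D. u r i * \<xi> x i)\<^sup>2)) \<le> (\<Sum>r<p. ennreal (w r) * ennreal (exp (X r x)))" .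
    qed
    also have "\<dots> = (\<Sum>r<p. ennreal (w r) * (\<integral>\<^sup>+ x. ennreal (exp (X r x)) \<partial>M))"
    proof -
      have [measurable]: "X r \<in> borel_measurable M" for r
        unfolding X_def by (intro borel_measurable_power subgaussian_inner_measurable[OF sg])
      show ?thesis by (subst nn_integral_sum) (auto simp: nn_integral_cmult)
    qed
    also have "\<dots> \<le> (\<Sum>r<p. ennreal (w r) * 9)"
    proof (intro sum_mono mult_left_mono)
      fix r assume "r \<in> {..<p}"
      have "(\<Sum>i<D. (u r i / sqrt (w r))\<^sup>2) = (\<Sum>i<D. (u r i)\<^sup>2) / w r"
        using w[of r] by (simp add: power_divide flip: sum_divide_distrib)
      also have "\<dots> \<le> Q" using Q by (cases "(\<Sum>i<D. (u r i)\<^sup>2) = 0") (auto simp: w_def)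
      also have "\<dots> \<le> q" using u by (simp add: Q_def)
      finally show "(\<integral>\<^sup>+ x. ennreal (exp (X r x)) \<partial>M) \<le> 9"
        using sg unfolding X_def subgaussian_def
        by (elim conjE allE[of _ "\<lambda>i. u r i / sqrt (w r)"]) simp
    qed auto
    also have "\<dots> = ennreal (\<Sum>r<p. w r) * 9" using w by (simp flip: sum_distrib_right sum_ennreal)
    finally show ?thesis by (simp add: w1)
  qed
qed

section \<open>Independent points: operator norms, counting rare events, conditioning\<close>

lemma product_sigma_finite_prob:
  assumes "\<And>j. prob_space (K j)"
  shows "product_sigma_finite K"
  by (intro product_sigma_finite.intro prob_space_imp_sigma_finite assms)

lemma nn_integral_PiM_prod_subset:
  fixes f :: "'i \<Rightarrow> 'a \<Rightarrow> ennreal"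
  assumes K: "\<And>j. prob_space (K j)" and I: "finite I" "J \<subseteq> I"
    and f: "\<And>j. j \<in> J \<Longrightarrow> f j \<in> borel_measurable (K j)"
  shows "(\<integral>\<^sup>+ \<omega>. (\<Prod>j\<in>J. f j (\<omega> j)) \<partial>PiM I K) = (\<Prod>j\<in>J. integral\<^sup>N (K j) (f j))"
proof -
  interpret product_sigma_finite K by (rule product_sigma_finite_prob[OF K])
  define g where "g = (\<lambda>j. if j \<in> J then f j else (\<lambda>_. 1))"
  have "(\<Prod>j\<in>J. f j (\<omega> j)) = (\<Prod>j\<in>I. g j (\<omega> j))" for \<omega>
    using I by (intro prod.mono_neutral_cong_left) (auto simp: g_def)
  then have "(\<integral>\<^sup>+ \<omega>. (\<Prod>j\<in>J. f j (\<omega> j)) \<partial>PiM I K) = (\<integral>\<^sup>+ \<omega>. (\<Prod>j\<in>I. g j (\<omega> j)) \<partial>PiM I K)" by simp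
  also have "\<dots> = (\<Prod>j\<in>I. integral\<^sup>N (K j) (g j))"
    by (rule product_nn_integral_prod[OF I(1)]) (use f in \<open>auto simp: g_def\<close>)
  also have "\<dots> = (\<Prod>j\<in>J. integral\<^sup>N (K j) (f j))"
    using I prob_space.emeasure_space_1[OF K] by (intro prod.mono_neutral_cong_right) (auto simp: g_def)
  finally show ?thesis .
qed

text \<open>The deviation at a fixed point of the net is exponentially small in \<open>card J + D\<close>, which beats the
  cardinality of the net.\<close>
lemma subgaussian_operator_norm:
  fixes \<xi> :: "'i \<Rightarrow> 'a \<Rightarrow> nat \<Rightarrow> real"
  assumes K: "\<And>j. prob_space (K j)" and I: "finite I" "J \<subseteq> I"
    and sg: "\<And>j. j \<in> J \<Longrightarrow> subgaussian (K j) D (\<xi> j) q" and q: "0 < q"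
  obtains B where "B \<in> sets (PiM I K)" "emeasure (PiM I K) B \<le> ennreal (exp (- (real (card J) + real D)))"
    "\<And>\<omega> u. \<omega> \<in> space (PiM I K) \<Longrightarrow> \<omega> \<notin> B \<Longrightarrow> L2_set u {..<D} \<le> 1 \<Longrightarrow>
      L2_set (\<lambda>j. \<Sum>i<D. u i * \<xi> j (\<omega> j) i) J \<le> 2 * sqrt (20 * (real (card J) + real D) / q)"
proof -
  obtain Q0 :: "(nat \<Rightarrow> real) set" where Q0: "finite Q0" "real (card Q0) \<le> (6 * 2 ^ 2) ^ D"
    "\<And>u. L2_set u {..<D} \<le> 1 \<Longrightarrow> \<exists>q\<in>Q0. L2_set (\<lambda>i. u i - q i) {..<D} \<le> 1 / real 2"
    using net_exists[of 2 D] by auto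
  \<comment> \<open>Longer net points are not within 1/2 of the unit ball; the bound 2 is needed
    because the moment estimate applies only to vectors of bounded length.\<close>
  define Q where "Q = {u \<in> Q0. L2_set u {..<D} \<le> 2}"
  have Q: "finite Q" "real (card Q) \<le> 24 ^ D"
  proof -
    show "finite Q" using Q0 by (simp add: Q_def)
    have "card Q \<le> card Q0" using Q0 by (intro card_mono) (auto simp: Q_def)
    then show "real (card Q) \<le> 24 ^ D" using Q0(2) by simp
  qed
  have net: "\<exists>y\<in>Q. L2_set (\<lambda>i. u i - y i) {..<D} \<le> 1 / 2" if u: "L2_set u {..<D} \<le> 1" for u
  proof -
    obtain y where y: "y \<in> Q0" "L2_set (\<lambda>i. u i - y i) {..<D} \<le> 1 / 2" using Q0(3)[OF u] by auto
    then have "L2_set y {..<D} \<le> 2"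
      using L2_set_triangle_diff[of y "{..<D}" u] u by (simp add: L2_set_minus_commute[of y])
    then show ?thesis using y by (auto simp: Q_def)
  qed
  define m where "m = card J"
  \<comment> \<open>As |u| <= 2, the variable q V / 4 has exponential moment at most 9^m. The level
    a corresponds to 5 (m + D), and the union over at most 24^D net points uses up exp (4 (m + D))
    of it.\<close>
  define a where "a = 20 * (real m + real D) / q"
  have a: "0 \<le> a" using q by (simp add: a_def)
  let ?P = "PiM I K"
  have fJ: "finite J" using I finite_subset by blast
  define V where "V = (\<lambda>u \<omega>. \<Sum>j\<in>J. (\<Sum>i<D. u i * \<xi> j (\<omega> j) i)\<^sup>2)"
  have inner: "(\<lambda>x. \<Sum>i<D. u i * \<xi> j x i) \<in> borel_measurable (K j)" if "j \<in> J" for u j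
    by (rule subgaussian_inner_measurable[OF sg[OF that]])
  have Vm: "V u \<in> borel_measurable ?P" for u
    unfolding V_def
  proof (rule borel_measurable_sum, rule borel_measurable_power)
    fix j assume "j \<in> J"
    then show "(\<lambda>\<omega>. \<Sum>i<D. u i * \<xi> j (\<omega> j) i) \<in> borel_measurable ?P"
      using I by (intro measurable_compose[OF measurable_component_singleton, where g="\<lambda>x. \<Sum>i<D. u i * \<xi> j x i"] inner) auto
  qed
  define B where "B = (\<Union>u\<in>Q. {\<omega> \<in> space ?P. a \<le> V u \<omega>})"
  have Bs: "{\<omega> \<in> space ?P. a \<le> V u \<omega>} \<in> sets ?P" for u
    by (intro borel_measurable_le borel_measurable_const Vm)
  show ?thesis
  proof (rule that[of B])
    show "B \<in> sets ?P" unfolding B_def using Q Bs by (intro sets.finite_UN) auto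
    have one: "emeasure ?P {\<omega> \<in> space ?P. a \<le> V u \<omega>} \<le> ennreal (9 ^ m * exp (- 5 * (real m + real D)))" if "u \<in> Q" for u
    proof -
      define c where "c = sqrt q / 2"
      have c: "c\<^sup>2 = q / 4" using q by (simp add: c_def power_divide)
      have u2: "(\<Sum>i<D. (c * u i)\<^sup>2) \<le> q"
      proof -
        have "(\<Sum>i<D. (u i)\<^sup>2) \<le> 2\<^sup>2" using that L2_set_le_iff[of 2 u "{..<D}"] by (simp add: Q_def)
        then have "q / 4 * (\<Sum>i<D. (u i)\<^sup>2) \<le> q / 4 * 4" using q by (intro mult_left_mono) auto
        then show ?thesis by (simp only: power_mult_distrib c sum_distrib_left)
      qed
      have cV: "(\<Sum>j\<in>J. (\<Sum>i<D. (c * u i) * \<xi> j (\<omega> j) i)\<^sup>2) = q / 4 * V u \<omega>" for \<omega>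
        unfolding V_def c[symmetric]
        by (simp only: mult.assoc power_mult_distrib flip: sum_distrib_left)
      have "(\<integral>\<^sup>+ \<omega>. ennreal (exp (q / 4 * V u \<omega>)) \<partial>?P) = (\<integral>\<^sup>+ \<omega>. (\<Prod>j\<in>J. ennreal (exp ((\<Sum>i<D. (c * u i) * \<xi> j (\<omega> j) i)\<^sup>2))) \<partial>?P)"
        unfolding cV[symmetric] by (simp add: exp_sum fJ prod_ennreal)
      also have "\<dots> = (\<Prod>j\<in>J. \<integral>\<^sup>+ x. ennreal (exp ((\<Sum>i<D. (c * u i) * \<xi> j x i)\<^sup>2)) \<partial>K j)"
        by (rule nn_integral_PiM_prod_subset[OF K I])
          (intro measurable_compose[OF _ measurable_ennreal] measurable_compose[OF _ borel_measurable_exp] borel_measurable_power inner)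
      also have "\<dots> \<le> (\<Prod>j\<in>J. 9)"
        by (rule prod_mono_ennreal) (use sg u2 in \<open>auto simp: subgaussian_def\<close>)
      also have "\<dots> = ennreal (9 ^ m)" by (simp add: m_def ennreal_power flip: ennreal_numeral)
      finally have C: "(\<integral>\<^sup>+ \<omega>. ennreal (exp (q / 4 * V u \<omega>)) \<partial>?P) \<le> ennreal (9 ^ m)" .
      have "{\<omega> \<in> space ?P. a \<le> V u \<omega>} = {\<omega> \<in> space ?P. 5 * (real m + real D) \<le> q / 4 * V u \<omega>}"
        using q by (auto simp: a_def field_simps)
      also have "emeasure ?P \<dots> \<le> ennreal (9 ^ m * exp (- (5 * (real m + real D))))"
        by (rule markov_exp[OF borel_measurable_times[OF borel_measurable_const Vm] C])
      finally show ?thesis by simp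
    qed
    have "emeasure ?P B \<le> (\<Sum>u\<in>Q. emeasure ?P {\<omega> \<in> space ?P. a \<le> V u \<omega>})"
      unfolding B_def using Q Bs by (intro emeasure_subadditive_finite) auto
    also have "\<dots> \<le> (\<Sum>u\<in>Q. ennreal (9 ^ m * exp (- 5 * (real m + real D))))" by (intro sum_mono one)
    also have "\<dots> = ennreal (real (card Q) * (9 ^ m * exp (- 5 * (real m + real D))))"
      by (simp add: ennreal_mult ennreal_of_nat_eq_real_of_nat)
    also have "\<dots> \<le> ennreal (exp (- (real (card J) + real D)))"
    proof (rule ennreal_leI)
      have e4: "24 \<le> exp (4::real)"
      proof -
        have "(24::real) \<le> (1 + 1 + 1\<^sup>2 / 2) ^ 4" by (simp add: power_numeral_reduce)
        also have "\<dots> \<le> exp 1 ^ 4" using exp_lower_Taylor_quadratic[of "1::real"] by (intro power_mono) auto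
        finally show ?thesis by (simp flip: exp_of_nat_mult)
      qed
      have "real (card Q) * 9 ^ m \<le> 24 ^ D * 24 ^ m"
        using Q by (intro mult_mono power_mono) auto
      also have "\<dots> \<le> exp 4 ^ D * exp 4 ^ m" using e4 by (intro mult_mono power_mono) auto
      also have "\<dots> = exp (4 * (real m + real D))" by (simp add: mult_exp_exp algebra_simps flip: exp_of_nat_mult)
      finally have "(real (card Q) * 9 ^ m) * exp (- 5 * (real m + real D)) \<le> exp (4 * (real m + real D)) * exp (- 5 * (real m + real D))"
        by (intro mult_right_mono) auto
      also have "\<dots> = exp (- (real m + real D))" by (simp add: mult_exp_exp)
      finally show "real (card Q) * (9 ^ m * exp (- 5 * (real m + real D))) \<le> exp (- (real (card J) + real D))"
        by (simp add: m_def mult.assoc)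
    qed
    finally show "emeasure ?P B \<le> ennreal (exp (- (real (card J) + real D)))" .
    fix \<omega> u assume \<omega>: "\<omega> \<in> space ?P" "\<omega> \<notin> B" and u: "L2_set u {..<D} \<le> 1"
    have "L2_set (\<lambda>j. \<Sum>i<D. y i * \<xi> j (\<omega> j) i) J \<le> sqrt a" if "y \<in> Q" for y
    proof -
      have "V y \<omega> \<le> a" using \<omega> that unfolding B_def by force
      then show ?thesis unfolding L2_set_def V_def by simp
    qed
    from sup_from_net[OF net this u]
    show "L2_set (\<lambda>j. \<Sum>i<D. u i * \<xi> j (\<omega> j) i) J \<le> 2 * sqrt (20 * (real (card J) + real D) / q)"
      by (simp add: a_def m_def)
  qed
qed

text \<open>Markov's inequality for 256 to the number of events: each coordinate contributes a
  factor 1 + 256 / 256 = 2, while half of the events amount to 256^(card J / 2) = 16^(card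
  J).\<close>

lemma PiM_many_rare_events:
  assumes K: "\<And>j. prob_space (K j)" and I: "finite I" "J \<subseteq> I"
    and A: "\<And>j. j \<in> J \<Longrightarrow> A j \<in> sets (K j)"
    and p: "\<And>j. j \<in> J \<Longrightarrow> emeasure (K j) (A j) \<le> ennreal (1 / 256)"
  shows "{\<omega> \<in> space (PiM I K). card J \<le> 2 * card {j \<in> J. \<omega> j \<in> A j}} \<in> sets (PiM I K)"
    "emeasure (PiM I K) {\<omega> \<in> space (PiM I K). card J \<le> 2 * card {j \<in> J. \<omega> j \<in> A j}} \<le> ennreal ((1 / 8) ^ card J)"
proof -
  let ?P = "PiM I K"
  have fJ: "finite J" using I finite_subset by blast
  define f where "f = (\<lambda>j x. ln 256 * indicat_real (A j) x)"
  have fm: "f j \<in> borel_measurable (K j)" if "j \<in> J" for j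
    unfolding f_def using A[OF that] by (intro borel_measurable_times borel_measurable_const borel_measurable_indicator)
  have Fm: "(\<lambda>\<omega>. \<Sum>j\<in>J. f j (\<omega> j)) \<in> borel_measurable ?P"
    using I fm by (intro borel_measurable_sum measurable_PiM_component_rev) auto
  have count: "(\<Sum>j\<in>J. f j (\<omega> j)) = ln 256 * real (card {j \<in> J. \<omega> j \<in> A j})" for \<omega>
  proof -
    have "(\<Sum>j\<in>J. indicat_real (A j) (\<omega> j)) = real (card {j \<in> J. \<omega> j \<in> A j})"
      using fJ by (simp add: indicator_def sum.If_cases Int_def)
    then show ?thesis by (simp add: f_def flip: sum_distrib_left)
  qed
  have "(\<integral>\<^sup>+ \<omega>. ennreal (exp (\<Sum>j\<in>J. f j (\<omega> j))) \<partial>?P) = (\<integral>\<^sup>+ \<omega>. (\<Prod>j\<in>J. ennreal (exp (f j (\<omega> j)))) \<partial>?P)"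
    by (simp add: exp_sum fJ prod_ennreal)
  also have "\<dots> = (\<Prod>j\<in>J. \<integral>\<^sup>+ x. ennreal (exp (f j x)) \<partial>K j)"
    by (rule nn_integral_PiM_prod_subset[OF K I]) (intro measurable_compose[OF _ measurable_ennreal] measurable_compose[OF _ borel_measurable_exp] fm)
  also have "\<dots> \<le> (\<Prod>j\<in>J. 2)"
  proof (rule prod_mono_ennreal)
    fix j assume j: "j \<in> J"
    have "(\<integral>\<^sup>+ x. ennreal (exp (f j x)) \<partial>K j) \<le> (\<integral>\<^sup>+ x. 1 + 256 * indicator (A j) x \<partial>K j)"
      by (intro nn_integral_mono) (auto simp: f_def indicator_def)
    also have "\<dots> = 1 + 256 * emeasure (K j) (A j)"
      using A[OF j] prob_space.emeasure_space_1[OF K] by (subst nn_integral_add) (auto simp: nn_integral_cmult)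
    also have "\<dots> \<le> 1 + 256 * ennreal (1 / 256)" by (intro add_left_mono mult_left_mono p j) auto
    also have "\<dots> = 2" by (simp flip: ennreal_numeral ennreal_mult)
    finally show "(\<integral>\<^sup>+ x. ennreal (exp (f j x)) \<partial>K j) \<le> 2" .
  qed
  also have "\<dots> = ennreal (2 ^ card J)" by (simp add: ennreal_power flip: ennreal_numeral)
  finally have C: "(\<integral>\<^sup>+ \<omega>. ennreal (exp (\<Sum>j\<in>J. f j (\<omega> j))) \<partial>?P) \<le> ennreal (2 ^ card J)" .
  have ln256: "ln (256::real) = 2 * ln 16" using ln_realpow[of "16::real" 2] by simp
  have eq: "{\<omega> \<in> space ?P. card J \<le> 2 * card {j \<in> J. \<omega> j \<in> A j}} = {\<omega> \<in> space ?P. ln 16 * real (card J) \<le> (\<Sum>j\<in>J. f j (\<omega> j))}"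
  proof -
    have "card J \<le> 2 * k \<longleftrightarrow> ln 16 * real (card J) \<le> ln 256 * real k" for k
    proof -
      have "ln 16 * real (card J) \<le> ln 256 * real k \<longleftrightarrow> ln 16 * real (card J) \<le> ln 16 * (2 * real k)" by (simp add: ln256)
      also have "\<dots> \<longleftrightarrow> real (card J) \<le> 2 * real k" by (subst mult_le_cancel_left_pos) auto
      finally show ?thesis by linarith
    qed
    then show ?thesis by (simp add: count)
  qed
  show "{\<omega> \<in> space ?P. card J \<le> 2 * card {j \<in> J. \<omega> j \<in> A j}} \<in> sets ?P"
    unfolding eq by (intro borel_measurable_le borel_measurable_const Fm)
  have "emeasure ?P {\<omega> \<in> space ?P. card J \<le> 2 * card {j \<in> J. \<omega> j \<in> A j}} \<le> ennreal (2 ^ card J * exp (- (ln 16 * real (card J))))"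
    unfolding eq by (rule markov_exp[OF Fm C])
  also have "2 ^ card J * exp (- (ln 16 * real (card J))) = (1 / 8 :: real) ^ card J"
  proof -
    have "exp (- (ln 16 * real (card J))) = (1 / 16 :: real) ^ card J"
      by (simp add: exp_minus mult.commute exp_of_nat_mult power_one_over inverse_eq_divide)
    then show ?thesis by (simp flip: power_mult_distrib)
  qed
  finally show "emeasure ?P {\<omega> \<in> space ?P. card J \<le> 2 * card {j \<in> J. \<omega> j \<in> A j}} \<le> ennreal ((1 / 8) ^ card J)" .
qed

text \<open>Fubini with coordinate i innermost, that is, conditioning on all other points.\<close>

lemma emeasure_PiM_le_fibre:
  assumes K: "\<And>j. prob_space (K j)" and I: "finite I" "i \<in> I"
    and B: "B \<in> sets (PiM I K)"
    and le: "\<And>\<omega>. \<omega> \<in> space (PiM (I - {i}) K) \<Longrightarrow> emeasure (K i) {y \<in> space (K i). (fun_upd \<omega> i y) \<in> B} \<le> p"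
  shows "emeasure (PiM I K) B \<le> p"
proof -
  interpret product_sigma_finite K by (rule product_sigma_finite_prob[OF K])
  let ?R = "PiM (I - {i}) K"
  interpret R: prob_space ?R by (rule prob_space_PiM[OF K])
  have ins: "insert i (I - {i}) = I" using I by auto
  have "emeasure (PiM I K) B = (\<integral>\<^sup>+ \<omega>. indicator B \<omega> \<partial>PiM I K)" using B by simp
  also have "\<dots> = (\<integral>\<^sup>+ \<omega>. (\<integral>\<^sup>+ y. indicator B ((fun_upd \<omega> i y)) \<partial>K i) \<partial>?R)"
    using product_nn_integral_insert[of "I - {i}" i "indicator B"] I(1) B by (simp add: ins insert_absorb[OF I(2)])
  also have "\<dots> \<le> (\<integral>\<^sup>+ \<omega>. p \<partial>?R)"
  proof (rule nn_integral_mono)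
    fix \<omega> assume \<omega>: "\<omega> \<in> space ?R"
    have meas: "(\<lambda>y. (fun_upd \<omega> i y)) \<in> measurable (K i) (PiM I K)"
      using measurable_fun_upd[of I "I - {i}" i "\<lambda>_. \<omega>" "K i" K "\<lambda>y. y"] \<omega> ins by auto
    have "(\<integral>\<^sup>+ y. indicator B ((fun_upd \<omega> i y)) \<partial>K i) = (\<integral>\<^sup>+ y. indicator {y \<in> space (K i). (fun_upd \<omega> i y) \<in> B} y \<partial>K i)"
      by (intro nn_integral_cong) (auto simp: indicator_def)
    also have "\<dots> = emeasure (K i) {y \<in> space (K i). (fun_upd \<omega> i y) \<in> B}"
      using measurable_sets[OF meas B] by (intro nn_integral_indicator) (auto simp: vimage_def Int_def conj_commute)
    also have "\<dots> \<le> p" by (rule le[OF \<omega>])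
    finally show "(\<integral>\<^sup>+ y. indicator B ((fun_upd \<omega> i y)) \<partial>K i) \<le> p" .
  qed
  also have "\<dots> = p" by (simp add: R.emeasure_space_1)
  finally show ?thesis .
qed

section \<open>Affinity and Frobenius norm\<close>

definition mat_trace :: "'a::comm_ring_1 mat \<Rightarrow> 'a" where
  "mat_trace A = (\<Sum>i<dim_row A. A $$ (i, i))"

lemma index_mult_mat_sum:
  assumes "A \<in> carrier_mat n m" "B \<in> carrier_mat m k" "i < n" "j < k"
  shows "(A * B) $$ (i, j) = (\<Sum>l<m. A $$ (i, l) * B $$ (l, j))"
proof -
  have "(A * B) $$ (i, j) = row A i \<bullet> col B j" using assms by simp
  also have "\<dots> = (\<Sum>l<m. A $$ (i, l) * B $$ (l, j))"
    unfolding scalar_prod_def using assms by (intro sum.cong) auto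
  finally show ?thesis .
qed

lemma mat_trace_mult_commute:
  assumes A: "A \<in> carrier_mat n m" and B: "B \<in> carrier_mat m n"
  shows "mat_trace (A * B) = mat_trace (B * A)"
proof -
  have "mat_trace (A * B) = (\<Sum>i<n. \<Sum>l<m. A $$ (i, l) * B $$ (l, i))"
    using A B by (auto simp: mat_trace_def index_mult_mat_sum[OF A B] simp del: index_mult_mat(1) intro!: sum.cong)
  also have "\<dots> = (\<Sum>l<m. \<Sum>i<n. B $$ (l, i) * A $$ (i, l))"
    by (subst sum.swap) (simp add: mult.commute)
  also have "\<dots> = mat_trace (B * A)"
    using A B by (auto simp: mat_trace_def index_mult_mat_sum[OF B A] simp del: index_mult_mat(1) intro!: sum.cong)
  finally show ?thesis .
qed

text \<open>The trace is invariant under similarity, and Schur's triangular form has the roots on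
  its diagonal.\<close>

lemma mat_trace_eq_sum_list_roots:
  fixes A :: "real mat"
  assumes A: "A \<in> carrier_mat n n" and cp: "char_poly A = (\<Prod>e\<leftarrow>es. [:- e, 1:])"
  shows "mat_trace A = sum_list es"
proof -
  obtain B P Q where "schur_decomposition A es = (B, P, Q)" by (cases "schur_decomposition A es") auto
  from schur_decomposition[OF A cp this]
  have wit: "similar_mat_wit A B P Q" and diag: "diag_mat B = es" by auto
  note w = similar_mat_witD2[OF A wit]
  have "mat_trace A = mat_trace (P * (B * Q))" using w by simp
  also have "\<dots> = mat_trace (B * Q * P)" using w by (intro mat_trace_mult_commute[of _ n n]) auto
  also have "B * Q * P = B * (Q * P)" using w by (intro assoc_mult_mat) auto
  also have "\<dots> = B" using w by simp
  also have "mat_trace B = sum_list (diag_mat B)"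
    by (simp add: mat_trace_def diag_mat_def sum_list_distinct_conv_sum_set lessThan_atLeast0)
  finally show ?thesis using diag by simp
qed

lemma map_poly_of_real_prod_linear:
  "map_poly complex_of_real (\<Prod>e\<leftarrow>es. [:- e, 1:]) = (\<Prod>e\<leftarrow>es. [:- complex_of_real e, 1:])"
proof (induction es)
  case (Cons e es)
  have "map_poly complex_of_real ([:- e, 1:] * p) = [:- complex_of_real e, 1:] * map_poly complex_of_real p" for p
    by (rule poly_eqI) (simp add: coeff_map_poly coeff_pCons split: nat.split)
  with Cons show ?case by simp
qed simp

text \<open>By symmetry the form v^* G v equals its own conjugate; it also equals a |v|^2.\<close>

lemma symmetric_eigenvalue_real:
  fixes G :: "real mat"
  assumes G: "G \<in> carrier_mat m m" and sym: "\<And>i j. i < m \<Longrightarrow> j < m \<Longrightarrow> G $$ (i, j) = G $$ (j, i)"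
    and ev: "eigenvalue (map_mat complex_of_real G) a"
  shows "a \<in> \<real>"
proof -
  obtain v where v: "v \<in> carrier_vec m" "v \<noteq> 0\<^sub>v m" "map_mat complex_of_real G *\<^sub>v v = a \<cdot>\<^sub>v v"
    using ev G unfolding eigenvalue_def eigenvector_def by auto
  have Gv: "(\<Sum>j<m. of_real (G $$ (i, j)) * v $ j) = a * v $ i" if "i < m" for i
  proof -
    have "(map_mat complex_of_real G *\<^sub>v v) $ i = (\<Sum>j<m. of_real (G $$ (i, j)) * v $ j)"
      using G v(1) that by (auto simp: scalar_prod_def lessThan_atLeast0 intro!: sum.cong)
    moreover have "(map_mat complex_of_real G *\<^sub>v v) $ i = a * v $ i" unfolding v(3) using v(1) that by simp
    ultimately show ?thesis by (simp only:)
  qed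
  define S where "S = (\<Sum>i<m. \<Sum>j<m. cnj (v $ i) * (of_real (G $$ (i, j)) * v $ j))"
  define r where "r = (\<Sum>i<m. (cmod (v $ i))\<^sup>2)"
  have "cnj S = (\<Sum>i<m. \<Sum>j<m. v $ i * (of_real (G $$ (i, j)) * cnj (v $ j)))" by (simp add: S_def)
  also have "\<dots> = (\<Sum>j<m. \<Sum>i<m. v $ i * (of_real (G $$ (i, j)) * cnj (v $ j)))" by (rule sum.swap)
  also have "\<dots> = S" unfolding S_def by (intro sum.cong) (auto simp: sym)
  finally have S: "S \<in> \<real>" by (simp add: Reals_cnj_iff)
  have "S = (\<Sum>i<m. cnj (v $ i) * (a * v $ i))" unfolding S_def by (intro sum.cong) (auto simp: Gv simp flip: sum_distrib_left)
  also have "\<dots> = a * of_real r"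
    by (simp add: r_def sum_distrib_left complex_norm_square mult_ac del: of_real_power)
  finally have aS: "S = a * of_real r" .
  have "r \<noteq> 0"
  proof
    assume "r = 0"
    then have "\<forall>i<m. v $ i = 0" by (auto simp: r_def sum_nonneg_eq_0_iff)
    then have "v = 0\<^sub>v m" using v by (intro eq_vecI) auto
    then show False using v by simp
  qed
  then have "a = S / of_real r" using aS by simp
  then show ?thesis using S by simp
qed

text \<open>The Schur decomposition over the reals presupposes a split characteristic polynomial. It
  splits over the complex numbers, and there all roots are real.\<close>

lemma symmetric_char_poly_splits:
  fixes G :: "real mat"
  assumes G: "G \<in> carrier_mat m m" and sym: "\<And>i j. i < m \<Longrightarrow> j < m \<Longrightarrow> G $$ (i, j) = G $$ (j, i)"
  obtains es where "char_poly G = (\<Prod>e\<leftarrow>es. [:- e, 1:])" "length es = m"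
proof -
  let ?C = "map_mat complex_of_real G"
  have C: "?C \<in> carrier_mat m m" using G by simp
  obtain as where as: "char_poly ?C = (\<Prod>a\<leftarrow>as. [:- a, 1:])" "length as = m"
    using char_poly_factorized[OF C] by blast
  have re: "a \<in> \<real>" if "a \<in> set as" for a
  proof -
    have "poly (char_poly ?C) a = 0" unfolding as(1) poly_prod_list using that
      by (auto simp: prod_list_zero_iff intro!: image_eqI[of _ _ a])
    then have "eigenvalue ?C a" using eigenvalue_root_char_poly[OF C] by simp
    then show ?thesis using symmetric_eigenvalue_real[OF G sym] by blast
  qed
  define es where "es = map Re as"
  have as': "as = map complex_of_real es"
    unfolding es_def using re by (auto intro!: map_idI[symmetric] simp: o_def)
  have "map_poly complex_of_real (char_poly G) = map_poly complex_of_real (\<Prod>e\<leftarrow>es. [:- e, 1:])"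
    unfolding of_real_hom.char_poly_hom[OF G, symmetric] as(1) map_poly_of_real_prod_linear
    by (simp add: as' o_def)
  then have "char_poly G = (\<Prod>e\<leftarrow>es. [:- e, 1:])"
    by (simp add: poly_eq_iff coeff_map_poly)
  then show ?thesis using that[of es] as(2) by (simp add: es_def)
qed

text \<open>The entry at position k - 1 separates the two halves: all kept entries are at least as
  large, all dropped ones at most as large.\<close>

lemma descending_take_sum:
  fixes ys :: "real list"
  assumes desc: "sorted_wrt (\<ge>) ys" and k: "k \<le> length ys"
  shows "real k * sum_list ys \<le> real (length ys) * sum_list (take k ys)"
proof (cases "k = 0")
  case False
  define a where "a = ys ! (k - 1)"
  have take: "real k * a \<le> sum_list (take k ys)"
  proof -
    have "(\<Sum>i<k. a) \<le> (\<Sum>i<k. ys ! i)"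
    proof (rule sum_mono)
      fix i assume "i \<in> {..<k}"
      then have "i = k - 1 \<or> i < k - 1" by auto
      then show "a \<le> ys ! i" using sorted_wrt_nth_less[OF desc, of i "k - 1"] k False by (auto simp: a_def)
    qed
    then show ?thesis using k by (simp add: sum_list_sum_nth lessThan_atLeast0 min_def)
  qed
  have drop: "sum_list (drop k ys) \<le> real (length ys - k) * a"
  proof -
    have "(\<Sum>i<length ys - k. drop k ys ! i) \<le> (\<Sum>i<length ys - k. a)"
    proof (rule sum_mono)
      fix i assume "i \<in> {..<length ys - k}"
      then show "drop k ys ! i \<le> a" using sorted_wrt_nth_less[OF desc, of "k - 1" "k + i"] k False by (auto simp: a_def)
    qed
    then show ?thesis by (simp add: sum_list_sum_nth lessThan_atLeast0)
  qed
  have "real k * sum_list (drop k ys) \<le> real k * (real (length ys - k) * a)" using drop by (intro mult_left_mono) auto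
  also have "\<dots> = real (length ys - k) * (real k * a)" by simp
  also have "\<dots> \<le> real (length ys - k) * sum_list (take k ys)" using take by (intro mult_left_mono) auto
  finally have "real k * sum_list (drop k ys) \<le> (real (length ys) - real k) * sum_list (take k ys)" using k by (simp add: of_nat_diff)
  moreover have "sum_list ys = sum_list (take k ys) + sum_list (drop k ys)" by (metis append_take_drop_id sum_list_append)
  ultimately show ?thesis by (simp add: algebra_simps)
qed simp

text \<open>If some of the eigenvalues are dropped, these are the smallest ones, so the average of the rest is at
  least the average of all, which is a Frobenius norm.\<close>
lemma frobenius_le_singular_values:
  fixes A :: "real mat"
  assumes A: "A \<in> carrier_mat d m"
  shows "real (min d m) * (\<Sum>r<d. \<Sum>k<m. (A $$ (r, k))\<^sup>2) \<le> real m * (\<Sum>c\<leftarrow>singular_values A. c\<^sup>2)"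
proof -
  let ?G = "A\<^sup>T * A"
  have G: "?G \<in> carrier_mat m m" using A by simp
  have Gij: "?G $$ (i, j) = (\<Sum>r<d. A $$ (r, i) * A $$ (r, j))" if "i < m" "j < m" for i j
    using A that by (subst index_mult_mat_sum[of _ m d _ m]) auto
  obtain es where es: "char_poly ?G = (\<Prod>e\<leftarrow>es. [:- e, 1:])" "length es = m"
    by (rule symmetric_char_poly_splits[OF G]) (auto simp: Gij mult.commute)
  have tr: "(\<Sum>r<d. \<Sum>k<m. (A $$ (r, k))\<^sup>2) = sum_list es"
  proof -
    have "mat_trace ?G = (\<Sum>k<m. \<Sum>r<d. (A $$ (r, k))\<^sup>2)"
      using G A by (auto simp: mat_trace_def Gij power2_eq_square simp del: index_mult_mat(1) intro!: sum.cong)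
    then show ?thesis using mat_trace_eq_sum_list_roots[OF G es(1)] by (simp add: sum.swap[of _ "{..<m}"])
  qed
  have pr: "proots (char_poly ?G) = mset es"
  proof -
    have "proots (\<Prod>e\<leftarrow>es'. [:- e, 1:]) = mset es'" for es' :: "real list"
    proof (induction es')
      case (Cons e es')
      have "(\<Prod>e\<leftarrow>es'. [:- e, 1:]) \<noteq> (0 :: real poly)" by (auto simp: prod_list_zero_iff)
      then have "proots ([:- e, 1:] * (\<Prod>e\<leftarrow>es'. [:- e, 1:])) = proots [:- e, 1:] + proots (\<Prod>e\<leftarrow>es'. [:- e, 1:])"
        by (intro proots_mult) auto
      then show ?case using Cons by (simp del: mult_pCons_left)
    qed simp
    then show ?thesis using es by simp
  qed
  define R where "R = rev (sort (map sqrt es))"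
  have sv: "singular_values A = take (min d m) R"
    using A unfolding singular_values_def pr R_def by (simp flip: mset_map)
  have desc: "sorted_wrt (\<ge>) R" unfolding R_def by (simp add: sorted_wrt_rev)
  \<comment> \<open>\<open>sqrt\<close> is extended to negative numbers as an odd function, and
    \<open>?g\<close> inverts this extension. So the sum over the roots is recovered without showing
    that the eigenvalues of the Gram matrix are nonnegative, and \<open>?g c\<close> is at most c^2
    in any case.\<close>
  let ?g = "\<lambda>c::real. c * \<bar>c\<bar>"
  have mono: "?g x \<le> ?g y" if "x \<le> y" for x y
  proof -
    have "x * \<bar>x\<bar> \<le> y * \<bar>y\<bar>"
    proof (cases "0 \<le> x \<or> y \<le> 0")
      case True
      then show ?thesis using that mult_mono[of x y x y] mult_mono[of "-y" "-x" "-y" "-x"] by auto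
    next
      case False
      then have "x * \<bar>x\<bar> \<le> 0" "0 \<le> y * \<bar>y\<bar>" by (auto simp: mult_nonpos_nonneg)
      then show ?thesis by linarith
    qed
    then show ?thesis .
  qed
  have desc': "sorted_wrt (\<ge>) (map ?g R)" unfolding sorted_wrt_map by (rule sorted_wrt_mono_rel[OF _ desc]) (auto intro: mono)
  have sumR: "sum_list (map ?g R) = sum_list es"
  proof -
    have "mset (map ?g R) = image_mset ?g (image_mset sqrt (mset es))" by (simp add: R_def)
    then have "mset (map ?g R) = mset (map (\<lambda>e. ?g (sqrt e)) es)" by (simp add: multiset.map_comp o_def)
    then have "sum_list (map ?g R) = sum_list (map (\<lambda>e. ?g (sqrt e)) es)" by (metis sum_mset_sum_list)
    also have "map (\<lambda>e. ?g (sqrt e)) es = es"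
    proof (rule map_idI)
      fix e :: real
      show "?g (sqrt e) = e"
      proof (cases "0 \<le> e")
        case False
        then have "sqrt (- e) * sqrt (- e) = - e" by simp
        then show ?thesis using False by (simp add: real_sqrt_minus)
      qed simp
    qed
    finally show ?thesis .
  qed
  have "real (min d m) * sum_list es \<le> real (length (map ?g R)) * sum_list (take (min d m) (map ?g R))"
    using descending_take_sum[OF desc', of "min d m"] es(2) sumR by (simp add: R_def)
  also have "\<dots> \<le> real m * (\<Sum>c\<leftarrow>singular_values A. c\<^sup>2)"
  proof -
    have "sum_list (map ?g (take (min d m) R)) \<le> sum_list (map (\<lambda>c. c\<^sup>2) (take (min d m) R))"
    proof (rule sum_list_mono)
      fix c :: real
      have "c * \<bar>c\<bar> \<le> \<bar>c\<bar> * \<bar>c\<bar>" by (intro mult_right_mono) auto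
      then show "c * \<bar>c\<bar> \<le> c\<^sup>2" by (simp add: power2_eq_square)
    qed
    then show ?thesis unfolding sv using es(2) by (simp add: R_def take_map mult_left_mono)
  qed
  finally show ?thesis unfolding tr .
qed

section \<open>Orthonormal bases of subspaces\<close>

lemma is_orthonormal_basis_cols:
  assumes "is_orthonormal_basis n S U" "s < dim_col U" "t < dim_col U"
  shows "(\<Sum>i<n. U $$ (i, s) * U $$ (i, t)) = (if s = t then 1 else 0)"
proof -
  define d where "d = dim_col U"
  have U: "U \<in> carrier_mat n d" and I: "U\<^sup>T * U = 1\<^sub>m d" and st: "s < d" "t < d"
    using assms by (auto simp: is_orthonormal_basis_def d_def)
  have "(U\<^sup>T * U) $$ (s, t) = (\<Sum>i<n. U\<^sup>T $$ (s, i) * U $$ (i, t))"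
    by (rule index_mult_mat_sum[of _ d n _ d]) (use U st in auto)
  also have "\<dots> = (\<Sum>i<n. U $$ (i, s) * U $$ (i, t))" using U st by (intro sum.cong) auto
  finally show ?thesis unfolding I using st by simp
qed

text \<open>Links two notions of dimension: \<open>subspace_dim\<close> belongs to the module
  restricted to \<open>S\<close>, while the sphere law and the projections count columns.
  Independence is proved in the ambient space and carried over to the submodule.\<close>

lemma dim_col_orthonormal_basis:
  assumes S: "linear_subspace n S" and U: "is_orthonormal_basis n S U"
  shows "dim_col U = subspace_dim n S"
proof -
  interpret vec_space "TYPE(real)" n .
  define d where "d = dim_col U"
  have Uc: "U \<in> carrier_mat n d" using U by (auto simp: is_orthonormal_basis_def d_def)
  have sub: "VectorSpace.subspace class_ring S V" using S by (simp add: linear_subspace_def)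
  then have sm: "submodule class_ring S V" by (simp add: VectorSpace.subspace_def)
  interpret W: vectorspace class_ring "vs S" by (rule subspace_is_vs[OF sub])
  have colsc: "set (cols U) \<subseteq> carrier_vec n" using Uc cols_dim[of U] by auto
  have sp: "col_space U = S" using U by (simp add: is_orthonormal_basis_def)
  have colsS: "set (cols U) \<subseteq> S" using sp colsc in_own_span unfolding col_space_def by auto
  have cc: "col U s \<bullet> col U t = (if s = t then 1 else 0)" if "s < d" "t < d" for s t
  proof -
    have "col U s \<bullet> col U t = (\<Sum>i<n. U $$ (i, s) * U $$ (i, t))"
      unfolding scalar_prod_def using Uc that by (simp add: lessThan_atLeast0)
    then show ?thesis using is_orthonormal_basis_cols[OF U] that by (simp add: d_def)
  qed
  have dist: "distinct (cols U)"
    unfolding distinct_conv_nth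
  proof (intro allI impI)
    fix s t assume "s < length (cols U)" "t < length (cols U)" "s \<noteq> t"
    then have st: "s < d" "t < d" "s \<noteq> t" using Uc by auto
    then have "col U s \<noteq> col U t" using cc[of s s] cc[of s t] by auto
    then show "cols U ! s \<noteq> cols U ! t" using st Uc by simp
  qed
  have li: "lin_indpt (set (cols U))"
  proof (rule finite_lin_indpt2)
    show "finite (set (cols U))" by simp
    show "set (cols U) \<subseteq> carrier_vec n" by (rule colsc)
    fix a assume lc: "lincomb a (set (cols U)) = 0\<^sub>v n"
    show "\<forall>v\<in>set (cols U). a v = 0"
    proof
      fix v assume v: "v \<in> set (cols U)"
      then obtain t where t: "t < d" "v = col U t" using Uc by (auto simp: cols_def)
      have vc: "v \<in> carrier_vec n" using v colsc by auto
      have "0 = lincomb a (set (cols U)) \<bullet> v" using lc vc by simp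
      also have "\<dots> = (\<Sum>u\<in>set (cols U). (a u \<cdot>\<^sub>v u) \<bullet> v)"
        unfolding lincomb_def by (rule finsum_scalar_prod_sum) (use colsc vc in auto)
      also have "\<dots> = (\<Sum>u\<in>set (cols U). if u = v then a u else 0)"
      proof (rule sum.cong[OF refl])
        fix u assume u: "u \<in> set (cols U)"
        then obtain s where s: "s < d" "u = col U s" using Uc by (auto simp: cols_def)
        have "u = v \<longleftrightarrow> s = t" using dist s t Uc by (auto simp: distinct_conv_nth) 
        then show "(a u \<cdot>\<^sub>v u) \<bullet> v = (if u = v then a u else 0)"
          using s t cc[of s t] Uc by (simp add: scalar_prod_smult_left)
      qed
      also have "\<dots> = a v" using v by simp
      finally show "a v = 0" by simp
    qed
  qed
  have "W.basis (set (cols U))"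
    unfolding W.basis_def
  proof (intro conjI)
    show "\<not> W.lin_dep (set (cols U))" using li span_li_not_depend(2)[OF colsS sm] by simp
    show "W.span (set (cols U)) = carrier (vs S)" using span_li_not_depend(1)[OF colsS sm] sp by (simp add: col_space_def)
    show "set (cols U) \<subseteq> carrier (vs S)" using colsS by simp
  qed
  then have "W.dim = card (set (cols U))" by (intro W.dim_basis) auto
  also have "\<dots> = d" using dist distinct_card[of "cols U"] Uc by simp
  finally show ?thesis by (simp add: subspace_dim_def d_def)
qed

text \<open>Gives content to the choice in \<open>orthonormal_basis\<close>. Independent subsets of
  \<open>S\<close> have at most n elements, so a maximal one exists; it spans \<open>S\<close> and
  is then orthonormalized.\<close>

lemma orthonormal_basis_exists:
  assumes S: "linear_subspace n S"
  shows "\<exists>U. is_orthonormal_basis n S U"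
proof -
  interpret vec_space "TYPE(real)" n .
  have sub: "VectorSpace.subspace class_ring S V" using S by (simp add: linear_subspace_def)
  then have sm: "submodule class_ring S V" by (simp add: VectorSpace.subspace_def)
  interpret W: vectorspace class_ring "vs S" by (rule subspace_is_vs[OF sub])
  have Sc: "S \<subseteq> carrier_vec n" using sm by (simp add: submodule_def)
  obtain A where A: "finite A" "maximal A (\<lambda>T. T \<subseteq> S \<and> lin_indpt T)"
  proof -
    have "\<exists>A. finite A \<and> maximal A (\<lambda>T. T \<subseteq> S \<and> lin_indpt T)"
    proof (rule maximal_exists[of _ n "{}"])
      show "finite T \<and> card T \<le> n" if "T \<subseteq> S \<and> lin_indpt T" for T
        using li_le_dim[of T] that Sc dim_is_n by auto
      show "{} \<subseteq> S \<and> lin_indpt {}" by (simp add: lin_dep_def)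
    qed
    then show ?thesis using that by blast
  qed
  have AS: "A \<subseteq> S" using A by (simp add: maximal_def)
  have Ac: "A \<subseteq> carrier_vec n" using AS Sc by auto
  have "maximal A (\<lambda>T. T \<subseteq> carrier (vs S) \<and> \<not> W.lin_dep T)"
    using A(2) span_li_not_depend(2)[OF _ sm] unfolding maximal_def by (auto; metis)
  then have "W.span A = S" using W.max_li_is_gen by simp
  then have spA: "span A = S" using span_li_not_depend(1)[OF AS sm] by simp
  obtain r :: nat and q where orth: "\<forall>s<r. \<forall>t<r. (\<Sum>i<n. q s i * q t i) = (if s = t then 1 else (0::real))"
    and wq: "\<forall>v\<in>A. \<exists>e. \<forall>i<n. v $ i = (\<Sum>t<r. e t * q t i)"
    and qw: "\<forall>t<r. \<exists>c. \<forall>i<n. q t i = (\<Sum>v\<in>A. c v * v $ i)"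
    using gram_schmidt_functions[OF A(1), of n "\<lambda>v i. v $ i"] by blast
  from wq obtain e where e: "\<And>v i. v \<in> A \<Longrightarrow> i < n \<Longrightarrow> v $ i = (\<Sum>t<r. e v t * q t i)" by metis
  from qw obtain c where c: "\<And>t i. t < r \<Longrightarrow> i < n \<Longrightarrow> q t i = (\<Sum>v\<in>A. c t v * v $ i)" by metis
  define U where "U = mat n r (\<lambda>(i, t). q t i)"
  have U: "U \<in> carrier_mat n r" by (simp add: U_def)
  have Ux: "(U *\<^sub>v x) $ i = (\<Sum>t<r. q t i * x $ t)" if "x \<in> carrier_vec r" "i < n" for x i
    using that by (auto simp: scalar_prod_def U_def lessThan_atLeast0 intro!: sum.cong)
  have lA: "lincomb a A $ i = (\<Sum>v\<in>A. a v * v $ i)" if "i < n" for a i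
    by (rule lincomb_index[OF that Ac])
  have lAc: "lincomb a A \<in> carrier_vec n" for a using lincomb_closed[OF Ac] by simp
  have "col_space U = S"
  proof
    show "col_space U \<subseteq> S"
    proof
      fix y assume "y \<in> col_space U"
      then obtain x where x: "x \<in> carrier_vec r" "y = U *\<^sub>v x" using col_space_eq[OF U] U by auto
      define a where "a = (\<lambda>v. \<Sum>t<r. c t v * x $ t)"
      have "y = lincomb a A"
      proof (rule eq_vecI)
        show "dim_vec y = dim_vec (lincomb a A)" using x U lAc[of a] by simp
        fix i assume "i < dim_vec (lincomb a A)"
        then have i: "i < n" using lAc[of a] by simp
        have "y $ i = (\<Sum>t<r. \<Sum>v\<in>A. c t v * v $ i * x $ t)"
          using x i by (simp add: Ux c sum_distrib_right)
        also have "\<dots> = (\<Sum>v\<in>A. a v * v $ i)"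
          unfolding a_def by (subst sum.swap) (simp add: sum_distrib_left sum_distrib_right mult_ac)
        finally show "y $ i = lincomb a A $ i" using lA[OF i] by simp
      qed
      then show "y \<in> S" using spA A(1) by auto
    qed
    show "S \<subseteq> col_space U"
    proof
      fix y assume "y \<in> S"
      then obtain a where y: "y = lincomb a A" using spA finite_span[OF A(1) Ac] by auto
      define x where "x = vec r (\<lambda>t. \<Sum>v\<in>A. a v * e v t)"
      have "U *\<^sub>v x = y"
      proof (rule eq_vecI)
        show "dim_vec (U *\<^sub>v x) = dim_vec y" using y U lAc[of a] by simp
        fix i assume "i < dim_vec y"
        then have i: "i < n" using y lAc[of a] by simp
        have "y $ i = (\<Sum>v\<in>A. \<Sum>t<r. a v * (e v t * q t i))"
          using y lA[OF i] e i by (auto simp: sum_distrib_left intro!: sum.cong)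
        also have "\<dots> = (\<Sum>t<r. q t i * x $ t)"
          by (subst sum.swap) (auto simp: x_def sum_distrib_left mult_ac intro!: sum.cong)
        finally show "(U *\<^sub>v x) $ i = y $ i" using Ux[of x i] i by (simp add: x_def)
      qed
      then show "y \<in> col_space U" using col_space_eq[OF U] U y lAc[of a] by (auto simp: x_def)
    qed
  qed
  moreover have "U\<^sup>T * U = 1\<^sub>m (dim_col U)"
  proof (rule eq_matI)
    fix s t assume "s < dim_row (1\<^sub>m (dim_col U) :: real mat)" "t < dim_col (1\<^sub>m (dim_col U) :: real mat)"
    then have st: "s < r" "t < r" using U by auto
    have "(U\<^sup>T * U) $$ (s, t) = (\<Sum>i<n. U\<^sup>T $$ (s, i) * U $$ (i, t))"
      by (rule index_mult_mat_sum[of _ r n _ r]) (use U st in auto)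
    also have "\<dots> = (\<Sum>i<n. q s i * q t i)" using st by (auto simp: U_def intro!: sum.cong)
    finally show "(U\<^sup>T * U) $$ (s, t) = 1\<^sub>m (dim_col U) $$ (s, t)" using orth st U by simp
  qed (use U in auto)
  ultimately show ?thesis using U by (auto simp: is_orthonormal_basis_def)
qed

lemma orthonormal_basis_is:
  assumes "linear_subspace n S"
  shows "is_orthonormal_basis n S (orthonormal_basis n S)"
  unfolding orthonormal_basis_def by (rule someI_ex[OF orthonormal_basis_exists[OF assms]])

text \<open>For x uniform on the unit sphere of S' the projection onto S has mean square F / d',
  where F is the left-hand side. Hence the factor d': in this form the affinity enters the
  concentration estimate.\<close>

lemma frobenius_le_affinity:
  assumes S: "linear_subspace n S" "subspace_dim n S = d" "1 \<le> d"
    and S': "linear_subspace n S'" "subspace_dim n S' = d'" "1 \<le> d'"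
  shows "(\<Sum>r<d. \<Sum>k<d'. (\<Sum>i<n. orthonormal_basis n S $$ (i, r) * orthonormal_basis n S' $$ (i, k))\<^sup>2) \<le> real d' * (affinity n S S')\<^sup>2"
proof -
  let ?U = "orthonormal_basis n S" and ?V = "orthonormal_basis n S'"
  note U = orthonormal_basis_is[OF S(1)] and V = orthonormal_basis_is[OF S'(1)]
  have Uc: "?U \<in> carrier_mat n d" using U dim_col_orthonormal_basis[OF S(1) U] S by (auto simp: is_orthonormal_basis_def)
  have Vc: "?V \<in> carrier_mat n d'" using V dim_col_orthonormal_basis[OF S'(1) V] S' by (auto simp: is_orthonormal_basis_def)
  have A: "?U\<^sup>T * ?V \<in> carrier_mat d d'" using Uc Vc by simp
  have idx: "(?U\<^sup>T * ?V) $$ (r, k) = (\<Sum>i<n. ?U $$ (i, r) * ?V $$ (i, k))" if "r < d" "k < d'" for r k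
    using that Uc Vc by (subst index_mult_mat_sum[of _ d n _ d']) auto
  define F where "F = (\<Sum>r<d. \<Sum>k<d'. ((?U\<^sup>T * ?V) $$ (r, k))\<^sup>2)"
  define T where "T = (\<Sum>c\<leftarrow>singular_values (?U\<^sup>T * ?V). c\<^sup>2)"
  have T0: "0 \<le> T" unfolding T_def by (rule sum_list_nonneg) auto
  have m: "0 < real (min d d')" using S S' by simp
  have "real (min d d') * F \<le> real d' * T" unfolding F_def T_def by (rule frobenius_le_singular_values[OF A])
  then have "F \<le> real d' * (T / real (min d d'))" using m by (simp add: pos_le_divide_eq mult.commute)
  also have "T / real (min d d') = (affinity n S S')\<^sup>2"
    unfolding affinity_def principal_cosines_def S(2) S'(2) T_def[symmetric] using T0 by (simp del: of_nat_min)
  finally show ?thesis unfolding F_def by (simp add: idx)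
qed

section \<open>The law of a single point\<close>

lemma borel_vec_space [simp]: "space (borel_vec n) = carrier_vec n"
  by (simp add: borel_vec_def)

lemma borel_vec_index_measurable:
  assumes "k < n"
  shows "(\<lambda>v. v $ k) \<in> borel_measurable (borel_vec n)"
proof -
  have "(\<lambda>v. \<lambda>k\<in>{..<n}. v $ k) \<in> measurable (borel_vec n) (\<Pi>\<^sub>M k\<in>{..<n}. borel)"
    unfolding borel_vec_def by (rule measurable_vimage_algebra1) (auto simp: space_PiM)
  from measurable_compose[OF this measurable_component_singleton, of k] assms
  show ?thesis by simp
qed

lemma borel_vec_measurableI:
  assumes "\<And>x. x \<in> space N \<Longrightarrow> f x \<in> carrier_vec n"
    and "\<And>k. k < n \<Longrightarrow> (\<lambda>x. f x $ k) \<in> borel_measurable N"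
  shows "f \<in> measurable N (borel_vec n)"
  unfolding borel_vec_def
proof (rule measurable_vimage_algebra2)
  show "(\<lambda>x. \<lambda>k\<in>{..<n}. f x $ k) \<in> measurable N (\<Pi>\<^sub>M k\<in>{..<n}. borel)"
    by (intro measurable_restrict) (use assms in auto)
qed (use assms in auto)

lemma l2norm_eq_L2_set: "l2norm v = L2_set (\<lambda>i. v $ i) {..<dim_vec v}"
  by (simp add: l2norm_def L2_set_def scalar_prod_def power2_eq_square lessThan_atLeast0)

text \<open>Moves the law to function space, where the volume estimates are stated. At the zero
  vector both normalizations give 0.\<close>

lemma uniform_sphere_eq:
  fixes n :: nat and S :: "real vec set"
  defines "U \<equiv> orthonormal_basis n S"
  assumes U: "U \<in> carrier_mat n d"
  shows "uniform_sphere n S = distr (ball_law d) (borel_vec n) (\<lambda>g. U *\<^sub>v vec d (unit_dir d g))"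
proof -
  let ?L = "lborel_PiM d" and ?B = "{v \<in> carrier_vec d. l2norm v \<le> 1}"
  let ?f = "\<lambda>v. U *\<^sub>v ((1 / l2norm v) \<cdot>\<^sub>v v)" and ?h = "\<lambda>g. U *\<^sub>v vec d (unit_dir d g)"
  have Uv: "(U *\<^sub>v v) $ i = (\<Sum>s<d. U $$ (i, s) * v $ s)" if "i < n" "v \<in> carrier_vec d" for i v
    using U that by (auto simp: scalar_prod_def lessThan_atLeast0 intro!: sum.cong)
  have vecm: "vec d \<in> measurable ?L (borel_vec d)"
    by (rule borel_vec_measurableI) (auto intro: comp_measurable_lborel_PiM)
  have nrm: "l2norm \<in> borel_measurable (borel_vec d)"
  proof -
    have "(\<lambda>v. L2_set (\<lambda>i. v $ i) {..<d}) \<in> borel_measurable (borel_vec d)"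
      by (intro borel_measurable_L2_set borel_vec_index_measurable) auto
    moreover have "L2_set (\<lambda>i. v $ i) {..<d} = l2norm v" if "v \<in> space (borel_vec d)" for v
      using that by (simp add: l2norm_eq_L2_set)
    ultimately show ?thesis using measurable_cong[of "borel_vec d" "\<lambda>v. L2_set (\<lambda>i. v $ i) {..<d}" l2norm] by simp
  qed
  have B: "?B \<in> sets (borel_vec d)"
    using borel_measurable_le[OF nrm borel_measurable_const, of 1] by simp
  have fm: "?f \<in> measurable (borel_vec d) (borel_vec n)"
  proof (rule borel_vec_measurableI)
    fix k assume k: "k < n"
    have "(\<lambda>v. \<Sum>s<d. U $$ (k, s) * (1 / l2norm v * v $ s)) \<in> borel_measurable (borel_vec d)"
      by (intro borel_measurable_sum borel_measurable_times borel_measurable_const borel_measurable_divide nrm borel_vec_index_measurable) auto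
    also have "?this \<longleftrightarrow> (\<lambda>v. ?f v $ k) \<in> borel_measurable (borel_vec d)"
      by (rule measurable_cong) (use k in \<open>auto simp: Uv intro!: sum.cong\<close>)
    finally show "(\<lambda>v. ?f v $ k) \<in> borel_measurable (borel_vec d)" .
  qed (use U in auto)
  have hm: "?h \<in> measurable (ball_law d) (borel_vec n)"
  proof (rule borel_vec_measurableI)
    fix k assume k: "k < n"
    have "(\<lambda>g. \<Sum>s<d. U $$ (k, s) * unit_dir d g s) \<in> borel_measurable (ball_law d)"
      unfolding measurable_cong_sets[OF ball_law_sets refl]
      by (intro borel_measurable_sum borel_measurable_times borel_measurable_const unit_dir_measurable) auto
    also have "?this \<longleftrightarrow> (\<lambda>g. ?h g $ k) \<in> borel_measurable (ball_law d)"
      by (rule measurable_cong) (use k in \<open>auto simp: Uv intro!: sum.cong\<close>)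
    finally show "(\<lambda>g. ?h g $ k) \<in> borel_measurable (ball_law d)" .
  qed (use U in auto)
  have fh: "?f (vec d g) = ?h g" for g
  proof -
    have "(1 / l2norm (vec d g)) \<cdot>\<^sub>v vec d g = vec d (unit_dir d g)"
      by (rule eq_vecI) (auto simp: l2norm_eq_L2_set unit_dir_def intro!: arg_cong2[where f="(/)"] L2_set_cong)
    then show ?thesis by simp
  qed
  have ball: "vec d -` ?B \<inter> space ?L = fun_ball d (\<lambda>_. 0) 1"
  proof -
    have "l2norm (vec d g) = L2_set g {..<d}" for g
      unfolding l2norm_eq_L2_set by (auto intro!: L2_set_cong)
    then show ?thesis by (auto simp: fun_ball_def)
  qed
  have "distr (uniform_measure (lborel_vec d) ?B) (borel_vec n) ?f = distr (ball_law d) (borel_vec n) ?h"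
  proof (rule measure_eqI)
    fix A assume "A \<in> sets (distr (uniform_measure (lborel_vec d) ?B) (borel_vec n) ?f)"
    then have A: "A \<in> sets (borel_vec n)" by simp
    have fA: "?f -` A \<inter> carrier_vec d \<in> sets (borel_vec d)" using measurable_sets[OF fm A] by simp
    have hA: "?h -` A \<inter> space ?L \<in> sets ?L" using measurable_sets[OF hm A] by simp
    have sp: "space (lborel_vec d) = carrier_vec d" "sets (lborel_vec d) = sets (borel_vec d)" by (simp_all add: lborel_vec_def)
    have fm': "?f \<in> measurable (uniform_measure (lborel_vec d) ?B) (borel_vec n)"
      using fm by (simp add: measurable_def sp)
    have pre: "vec d -` (?B \<inter> (?f -` A \<inter> carrier_vec d)) \<inter> space ?L = fun_ball d (\<lambda>_. 0) 1 \<inter> (?h -` A \<inter> space ?L)"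
      using fh by (auto simp: ball[symmetric])
    have "emeasure (distr (uniform_measure (lborel_vec d) ?B) (borel_vec n) ?f) A = emeasure (uniform_measure (lborel_vec d) ?B) (?f -` A \<inter> carrier_vec d)"
      by (subst emeasure_distr[OF fm' A]) (simp add: sp)
    also have "\<dots> = emeasure (lborel_vec d) (?B \<inter> (?f -` A \<inter> carrier_vec d)) / emeasure (lborel_vec d) ?B"
      using B fA by (subst emeasure_uniform_measure) (simp_all add: sp)
    also have "emeasure (lborel_vec d) ?B = emeasure ?L (fun_ball d (\<lambda>_. 0) 1)"
      unfolding lborel_vec_def using B by (subst emeasure_distr[OF vecm]) (simp_all only: ball)
    also have "emeasure (lborel_vec d) (?B \<inter> (?f -` A \<inter> carrier_vec d)) = emeasure ?L (fun_ball d (\<lambda>_. 0) 1 \<inter> (?h -` A \<inter> space ?L))"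
      unfolding lborel_vec_def using B fA by (subst emeasure_distr[OF vecm]) (simp_all only: pre sets.Int)
    also have "emeasure ?L (fun_ball d (\<lambda>_. 0) 1 \<inter> (?h -` A \<inter> space ?L)) / emeasure ?L (fun_ball d (\<lambda>_. 0) 1) = emeasure (ball_law d) (?h -` A \<inter> space ?L)"
      unfolding ball_law_def using hA by (subst emeasure_uniform_measure) simp_all
    also have "\<dots> = emeasure (distr (ball_law d) (borel_vec n) ?h) A"
      by (subst emeasure_distr[OF hm A]) simp
    finally show "emeasure (distr (uniform_measure (lborel_vec d) ?B) (borel_vec n) ?f) A = emeasure (distr (ball_law d) (borel_vec n) ?h) A" .
  qed simp
  moreover have "dim_col U = d" using U by simp
  ultimately show ?thesis unfolding uniform_sphere_def Let_def U_def[symmetric] by simp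
qed

lemma subgaussian_distr_iff:
  assumes f: "f \<in> measurable M N" and \<xi>: "\<And>i. i < D \<Longrightarrow> (\<lambda>x. \<xi> x i) \<in> borel_measurable N"
  shows "subgaussian (distr M N f) D \<xi> q \<longleftrightarrow> subgaussian M D (\<lambda>x. \<xi> (f x)) q"
proof -
  have "(\<lambda>x. ennreal (exp ((\<Sum>i<D. u i * \<xi> x i)\<^sup>2))) \<in> borel_measurable N" for u
    by (intro measurable_compose[OF _ measurable_ennreal] measurable_compose[OF _ borel_measurable_exp]
        borel_measurable_power borel_measurable_sum borel_measurable_times borel_measurable_const \<xi>) auto
  then have "(\<integral>\<^sup>+ x. ennreal (exp ((\<Sum>i<D. u i * \<xi> x i)\<^sup>2)) \<partial>distr M N f) = (\<integral>\<^sup>+ x. ennreal (exp ((\<Sum>i<D. u i * \<xi> (f x) i)\<^sup>2)) \<partial>M)" for u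
    by (intro nn_integral_distr f) (simp only: measurable_distr_eq1)
  moreover have "(\<lambda>x. \<xi> (f x) i) \<in> borel_measurable M" if "i < D" for i
    using measurable_compose[OF f \<xi>[OF that]] .
  ultimately show ?thesis using \<xi> by (auto simp: subgaussian_def)
qed

lemma subgaussian_cong:
  assumes "\<And>x i. i < D \<Longrightarrow> \<xi> x i = \<zeta> x i"
  shows "subgaussian M D \<xi> q \<longleftrightarrow> subgaussian M D \<zeta> q"
proof -
  have "(\<Sum>i<D. u i * \<xi> x i) = (\<Sum>i<D. u i * \<zeta> x i)" for u x by (intro sum.cong) (auto simp: assms)
  then show ?thesis using assms by (auto simp: subgaussian_def)
qed

lemma distr_pair_snd:
  assumes "prob_space A" "prob_space B"
  shows "distr (A \<Otimes>\<^sub>M B) B snd = B"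
proof -
  interpret B: prob_space B by fact
  interpret A: prob_space A by fact
  show ?thesis
  proof (rule measure_eqI)
    fix X assume "X \<in> sets (distr (A \<Otimes>\<^sub>M B) B snd)"
    then have X: "X \<in> sets B" by simp
    have "snd -` X \<inter> space (A \<Otimes>\<^sub>M B) = space A \<times> X"
      using sets.sets_into_space[OF X] by (auto simp: space_pair_measure)
    then show "emeasure (distr (A \<Otimes>\<^sub>M B) B snd) X = emeasure B X"
      using X by (simp add: emeasure_distr B.emeasure_pair_measure_Times A.emeasure_space_1)
  qed simp
qed

text \<open>The entries of U^T x. For orthonormal columns these are the coordinates of the
  projection onto the column space, and the projection P is always handled through them.\<close>

definition coords :: "nat \<Rightarrow> real mat \<Rightarrow> real vec \<Rightarrow> nat \<Rightarrow> real" where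
  "coords n U x r = (\<Sum>i<n. U $$ (i, r) * x $ i)"

lemma coords_measurable: "(\<lambda>x. coords n U x r) \<in> borel_measurable (borel_vec n)"
  unfolding coords_def
  by (intro borel_measurable_sum borel_measurable_times borel_measurable_const borel_vec_index_measurable) auto

lemma coords_mult_mat_vec:
  assumes U: "is_orthonormal_basis n S U" "U \<in> carrier_mat n d" and r: "r < d"
  shows "coords n U (U *\<^sub>v vec d a) r = a r"
proof -
  have "coords n U (U *\<^sub>v vec d a) r = (\<Sum>i<n. U $$ (i, r) * (\<Sum>s<d. U $$ (i, s) * a s))"
    unfolding coords_def using U(2) by (auto simp: scalar_prod_def lessThan_atLeast0 intro!: sum.cong)
  also have "\<dots> = (\<Sum>i<n. \<Sum>s<d. (U $$ (i, r) * U $$ (i, s)) * a s)"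
    by (simp add: sum_distrib_left mult.assoc)
  also have "\<dots> = (\<Sum>s<d. (\<Sum>i<n. U $$ (i, r) * U $$ (i, s)) * a s)"
    by (subst sum.swap) (simp add: sum_distrib_right)
  also have "\<dots> = (\<Sum>s<d. if r = s then a s else 0)"
    using is_orthonormal_basis_cols[OF U(1) r[folded carrier_matD(2)[OF U(2)]]] U(2) by (intro sum.cong) auto
  also have "\<dots> = a r" using r by simp
  finally show ?thesis .
qed

text \<open>The comparison of sets is required only inside the unit ball; there an inner product
  with \<open>g\<close> is no larger in modulus than one with its direction.\<close>

lemma ball_law_mono:
  assumes "A \<in> sets (lborel_PiM d)" "B \<in> sets (lborel_PiM d)"
    and sub: "\<And>g. g \<in> A \<Longrightarrow> L2_set g {..<d} \<le> 1 \<Longrightarrow> g \<in> B"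
  shows "emeasure (ball_law d) A \<le> emeasure (ball_law d) B"
proof -
  have "fun_ball d (\<lambda>_. 0) 1 \<inter> A \<subseteq> fun_ball d (\<lambda>_. 0) 1 \<inter> B" using sub by (auto simp: fun_ball_def)
  then have "emeasure (lborel_PiM d) (fun_ball d (\<lambda>_. 0) 1 \<inter> A) \<le> emeasure (lborel_PiM d) (fun_ball d (\<lambda>_. 0) 1 \<inter> B)"
    using assms by (intro emeasure_mono) auto
  then show ?thesis unfolding ball_law_def using assms by (simp add: divide_right_mono_ennreal)
qed

text \<open>The law of one point and its noise. It is interpreted for the subspace of y_i and,
  separately, for the subspace of any other given point.\<close>

locale point_law =
  fixes n d :: nat and S :: "real vec set" and \<sigma> :: real
  assumes lin: "linear_subspace n S" and dim: "subspace_dim n S = d" and d: "1 \<le> d" and \<sigma>: "0 < \<sigma>"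
begin

definition "U = orthonormal_basis n S"

lemma U_basis: "is_orthonormal_basis n S U"
  unfolding U_def by (rule orthonormal_basis_is[OF lin])

lemma U_carrier: "U \<in> carrier_mat n d"
  using U_basis dim_col_orthonormal_basis[OF lin U_basis] dim by (auto simp: is_orthonormal_basis_def)

lemma U_cols: "s < d \<Longrightarrow> t < d \<Longrightarrow> (\<Sum>i<n. U $$ (i, s) * U $$ (i, t)) = (if s = t then 1 else 0)"
  using is_orthonormal_basis_cols[OF U_basis] U_carrier by simp

lemma n_pos: "0 < n"
  using U_cols[of 0 0] d by (cases n) auto

definition "lift g = U *\<^sub>v vec d (unit_dir d g)"

lemma sphere_eq: "uniform_sphere n S = distr (ball_law d) (borel_vec n) lift"
  unfolding lift_def U_def by (rule uniform_sphere_eq[OF U_carrier[unfolded U_def]])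

lemma coords_lift: "r < d \<Longrightarrow> coords n U (lift g) r = unit_dir d g r"
  unfolding lift_def by (rule coords_mult_mat_vec[OF U_basis U_carrier])

lemma lift_index: "i < n \<Longrightarrow> lift g $ i = (\<Sum>s<d. U $$ (i, s) * unit_dir d g s)"
  using U_carrier unfolding lift_def by (auto simp: scalar_prod_def lessThan_atLeast0 intro!: sum.cong)

lemma lift_measurable: "lift \<in> measurable (ball_law d) (borel_vec n)"
proof (rule borel_vec_measurableI)
  fix k assume "k < n"
  then have "(\<lambda>g. lift g $ k) = (\<lambda>g. \<Sum>s<d. U $$ (k, s) * unit_dir d g s)" by (simp add: lift_index fun_eq_iff)
  then show "(\<lambda>g. lift g $ k) \<in> borel_measurable (ball_law d)"
    unfolding measurable_cong_sets[OF ball_law_sets refl]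
    by (simp only:, intro borel_measurable_sum borel_measurable_times borel_measurable_const unit_dir_measurable) auto
qed (use U_carrier in \<open>auto simp: lift_def\<close>)

definition "law = uniform_sphere n S \<Otimes>\<^sub>M gaussian_noise n \<sigma>"

lemma prob_sphere: "prob_space (uniform_sphere n S)"
  unfolding sphere_eq by (intro prob_space.prob_space_distr prob_space_ball_law lift_measurable)

lemma sd_pos: "0 < \<sigma> / sqrt (real n)" using \<sigma> n_pos by simp

lemma vec_measurable: "vec n \<in> measurable (normal_PiM n (\<sigma> / sqrt (real n))) (borel_vec n)"
  by (rule borel_vec_measurableI) (auto intro: comp_measurable_normal_PiM)

lemma prob_noise: "prob_space (gaussian_noise n \<sigma>)"
  unfolding gaussian_noise_def by (intro prob_space.prob_space_distr prob_space_normal_PiM sd_pos vec_measurable)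

lemma sets_law: "sets law = sets (borel_vec n \<Otimes>\<^sub>M borel_vec n)"
  unfolding law_def by (rule sets_pair_measure_cong) (simp_all add: uniform_sphere_def gaussian_noise_def Let_def)

lemma space_law: "space law = carrier_vec n \<times> carrier_vec n"
  using sets_eq_imp_space_eq[OF sets_law] by (simp add: space_pair_measure)

lemma prob_law: "prob_space law"
proof -
  interpret A: prob_space "uniform_sphere n S" by (rule prob_sphere)
  interpret B: prob_space "gaussian_noise n \<sigma>" by (rule prob_noise)
  interpret pair_prob_space "uniform_sphere n S" "gaussian_noise n \<sigma>" ..
  show ?thesis unfolding law_def by unfold_locales
qed

lemma sets_sphere: "sets (uniform_sphere n S) = sets (borel_vec n)"
  and sets_noise: "sets (gaussian_noise n \<sigma>) = sets (borel_vec n)"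
  by (simp_all add: uniform_sphere_def gaussian_noise_def Let_def)

lemma law_fst: "distr law (uniform_sphere n S) fst = uniform_sphere n S"
  unfolding law_def by (rule prob_space.distr_pair_fst[OF prob_noise])

lemma law_snd: "distr law (gaussian_noise n \<sigma>) snd = gaussian_noise n \<sigma>"
  unfolding law_def by (rule distr_pair_snd[OF prob_sphere prob_noise])

lemma fst_measurable: "fst \<in> measurable law (borel_vec n)"
  and snd_measurable: "snd \<in> measurable law (borel_vec n)"
  using measurable_cong_sets[OF sets_law refl, of "borel_vec n"] by auto

lemma emeasure_law_fst:
  assumes A: "A \<in> sets (borel_vec n)"
  shows "emeasure law {p \<in> space law. fst p \<in> A} = emeasure (ball_law d) {g \<in> space (lborel_PiM d). lift g \<in> A}"
proof -
  have "emeasure law {p \<in> space law. fst p \<in> A} = emeasure (distr law (uniform_sphere n S) fst) A"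
    using A fst_measurable by (subst emeasure_distr) (auto simp: sets_sphere measurable_cong_sets[OF refl sets_sphere] vimage_def Int_def conj_commute)
  also have "\<dots> = emeasure (distr (ball_law d) (borel_vec n) lift) A" by (simp only: law_fst sphere_eq[symmetric])
  also have "\<dots> = emeasure (ball_law d) {g \<in> space (lborel_PiM d). lift g \<in> A}"
    using A by (subst emeasure_distr[OF lift_measurable]) (auto simp: vimage_def Int_def conj_commute)
  finally show ?thesis .
qed

lemma emeasure_law_snd:
  assumes A: "A \<in> sets (borel_vec n)"
  shows "emeasure law {p \<in> space law. snd p \<in> A} = emeasure (normal_PiM n (\<sigma> / sqrt (real n))) {g \<in> space (normal_PiM n (\<sigma> / sqrt (real n))). vec n g \<in> A}"
proof -
  have "emeasure law {p \<in> space law. snd p \<in> A} = emeasure (distr law (gaussian_noise n \<sigma>) snd) A"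
    using A snd_measurable by (subst emeasure_distr) (auto simp: sets_noise measurable_cong_sets[OF refl sets_noise] vimage_def Int_def conj_commute)
  also have "\<dots> = emeasure (distr (normal_PiM n (\<sigma> / sqrt (real n))) (borel_vec n) (vec n)) A"
    by (simp only: law_snd gaussian_noise_def[symmetric])
  also have "\<dots> = emeasure (normal_PiM n (\<sigma> / sqrt (real n))) {g \<in> space (normal_PiM n (\<sigma> / sqrt (real n))). vec n g \<in> A}"
    using A by (subst emeasure_distr[OF vec_measurable]) (auto simp: vimage_def Int_def conj_commute)
  finally show ?thesis .
qed

lemma subgaussian_sphere: "subgaussian law d (\<lambda>p. coords n U (fst p)) (real d / 8)"
proof -
  have "subgaussian (ball_law d) d (\<lambda>g. coords n U (lift g)) (real d / 8)"
    using subgaussian_cong[of d "\<lambda>g. coords n U (lift g)" "unit_dir d" "ball_law d"] coords_lift subgaussian_ball_law[of d] d by auto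
  then have "subgaussian (uniform_sphere n S) d (coords n U) (real d / 8)"
    unfolding sphere_eq using subgaussian_distr_iff[OF lift_measurable, of d "coords n U"] coords_measurable by auto
  then have "subgaussian (distr law (uniform_sphere n S) fst) d (coords n U) (real d / 8)" by (simp add: law_fst)
  then show ?thesis
    using fst_measurable coords_measurable
    by (subst (asm) subgaussian_distr_iff) (auto simp: measurable_cong_sets[OF refl sets_sphere] measurable_cong_sets[OF sets_sphere refl])
qed

lemma subgaussian_noise: "subgaussian law n (\<lambda>p k. snd p $ k) (real n / (4 * \<sigma>\<^sup>2))"
proof -
  let ?s = "\<sigma> / sqrt (real n)"
  have q: "1 / (4 * ?s\<^sup>2) = real n / (4 * \<sigma>\<^sup>2)" by (simp add: power_divide)
  have "subgaussian (normal_PiM n ?s) n (\<lambda>g k. vec n g $ k) (real n / (4 * \<sigma>\<^sup>2))"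
    using subgaussian_cong[of n "\<lambda>g k. vec n g $ k" "\<lambda>g. g" "normal_PiM n ?s"] subgaussian_normal_PiM[OF sd_pos, of n] q by auto
  then have "subgaussian (gaussian_noise n \<sigma>) n (\<lambda>z k. z $ k) (real n / (4 * \<sigma>\<^sup>2))"
    unfolding gaussian_noise_def using subgaussian_distr_iff[OF vec_measurable, of n "\<lambda>z k. z $ k"] borel_vec_index_measurable by auto
  then have "subgaussian (distr law (gaussian_noise n \<sigma>) snd) n (\<lambda>z k. z $ k) (real n / (4 * \<sigma>\<^sup>2))" by (simp add: law_snd)
  then show ?thesis
    using snd_measurable borel_vec_index_measurable
    by (subst (asm) subgaussian_distr_iff) (auto simp: measurable_cong_sets[OF refl sets_noise] measurable_cong_sets[OF sets_noise refl])
qed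

text \<open>The points of S of norm at most 1, written as finitely many equations and one inequality
  in the entries so that measurability is evident.\<close>

definition "well_placed = {x \<in> carrier_vec n. (\<forall>i<n. x $ i = (\<Sum>r<d. U $$ (i, r) * coords n U x r)) \<and> L2_set (coords n U x) {..<d} \<le> 1}"

lemma well_placed_sets: "well_placed \<in> sets (borel_vec n)"
proof -
  have "well_placed = (\<Inter>i\<in>{..<n}. {x \<in> space (borel_vec n). x $ i = (\<Sum>r<d. U $$ (i, r) * coords n U x r)}) \<inter> {x \<in> space (borel_vec n). L2_set (coords n U x) {..<d} \<le> 1}"
    using n_pos by (auto simp: well_placed_def)
  also have "\<dots> \<in> sets (borel_vec n)"
    using n_pos
    by (intro sets.Int sets.finite_INT borel_measurable_eq borel_measurable_le borel_measurable_const borel_measurable_L2_set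
        borel_measurable_sum borel_measurable_times coords_measurable borel_vec_index_measurable) auto
  finally show ?thesis .
qed

lemma lift_well_placed: "lift g \<in> well_placed"
proof -
  have "L2_set (coords n U (lift g)) {..<d} = L2_set (unit_dir d g) {..<d}"
    by (rule L2_set_cong) (auto simp: coords_lift)
  then show ?thesis
    using L2_set_unit_dir_le[of d g] U_carrier by (auto simp: well_placed_def lift_index coords_lift) (simp add: lift_def)
qed

text \<open>The sample space of a point is all of R^n, so lying in S is an almost sure property and
  has to be carried along as an event of full measure.\<close>

lemma emeasure_not_well_placed: "emeasure law {p \<in> space law. fst p \<in> carrier_vec n - well_placed} = 0"
proof -
  have "carrier_vec n - well_placed \<in> sets (borel_vec n)"
    using sets.Diff[OF sets.top[of "borel_vec n"] well_placed_sets] by simp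
  from emeasure_law_fst[OF this] show ?thesis by (simp only:) (simp add: lift_well_placed)
qed

lemma noise_tail:
  "{p \<in> space law. 3 / 2 * \<sigma> \<le> L2_set (\<lambda>k. snd p $ k) {..<n}} \<in> sets law"
  "emeasure law {p \<in> space law. 3 / 2 * \<sigma> \<le> L2_set (\<lambda>k. snd p $ k) {..<n}} \<le> ennreal (exp (- (1 / 8) * real n))"
proof -
  let ?s = "\<sigma> / sqrt (real n)"
  let ?A = "{z \<in> space (borel_vec n). 3 / 2 * \<sigma> \<le> L2_set (\<lambda>k. z $ k) {..<n}}"
  have A: "?A \<in> sets (borel_vec n)"
    by (intro borel_measurable_le borel_measurable_const borel_measurable_L2_set borel_vec_index_measurable) auto
  have eq: "{p \<in> space law. 3 / 2 * \<sigma> \<le> L2_set (\<lambda>k. snd p $ k) {..<n}} = {p \<in> space law. snd p \<in> ?A}"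
    by (auto simp: space_law)
  show "{p \<in> space law. 3 / 2 * \<sigma> \<le> L2_set (\<lambda>k. snd p $ k) {..<n}} \<in> sets law"
    unfolding eq using measurable_sets[OF snd_measurable A] by (simp add: vimage_def Int_def conj_commute)
  have eq2: "{g \<in> space (normal_PiM n ?s). vec n g \<in> ?A} = {g \<in> space (normal_PiM n ?s). 9 / 4 * (real n * ?s\<^sup>2) \<le> (\<Sum>i<n. (g i)\<^sup>2)}"
  proof -
    have "3 / 2 * \<sigma> \<le> L2_set (\<lambda>k. vec n g $ k) {..<n} \<longleftrightarrow> 9 / 4 * (real n * ?s\<^sup>2) \<le> (\<Sum>i<n. (g i)\<^sup>2)" for g
    proof -
      have L: "L2_set (\<lambda>k. vec n g $ k) {..<n} = L2_set g {..<n}" by (rule L2_set_cong) auto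
      have "3 / 2 * \<sigma> \<le> L2_set g {..<n} \<longleftrightarrow> (3 / 2 * \<sigma>)\<^sup>2 \<le> (L2_set g {..<n})\<^sup>2"
        using \<sigma> by (simp add: abs_le_square_iff[symmetric])
      also have "\<dots> \<longleftrightarrow> 9 / 4 * (real n * ?s\<^sup>2) \<le> (\<Sum>i<n. (g i)\<^sup>2)"
        using n_pos unfolding L2_set_power2 by (simp add: power_divide power_mult_distrib)
      finally show ?thesis using L by simp
    qed
    then show ?thesis by auto
  qed
  show "emeasure law {p \<in> space law. 3 / 2 * \<sigma> \<le> L2_set (\<lambda>k. snd p $ k) {..<n}} \<le> ennreal (exp (- (1 / 8) * real n))"
    unfolding eq emeasure_law_snd[OF A] eq2 by (rule normal_PiM_chi_square_tail[OF sd_pos])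
qed

text \<open>A small ball estimate, the source of all lower bounds. The slab for directions is
  contained, within the unit ball, in the slab for \<open>g\<close> itself.\<close>

lemma law_slab:
  assumes u: "L2_set u {..<d} = 1" and J: "0 < J"
  defines "h \<equiv> 1 / (2 * real J * sqrt (real d))"
  shows "{p \<in> space law. \<bar>\<Sum>r<d. u r * coords n U (fst p) r\<bar> < h} \<in> sets law"
    "emeasure law {p \<in> space law. \<bar>\<Sum>r<d. u r * coords n U (fst p) r\<bar> < h} \<le> ennreal (exp 1 / (real J + 1))"
proof -
  let ?A = "{x \<in> space (borel_vec n). \<bar>\<Sum>r<d. u r * coords n U x r\<bar> < h}"
  have A: "?A \<in> sets (borel_vec n)"
    by (intro borel_measurable_less borel_measurable_const borel_measurable_abs borel_measurable_sum borel_measurable_times coords_measurable)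
  have eq: "{p \<in> space law. \<bar>\<Sum>r<d. u r * coords n U (fst p) r\<bar> < h} = {p \<in> space law. fst p \<in> ?A}"
    by (auto simp: space_law)
  show "{p \<in> space law. \<bar>\<Sum>r<d. u r * coords n U (fst p) r\<bar> < h} \<in> sets law"
    unfolding eq using measurable_sets[OF fst_measurable A] by (simp add: vimage_def Int_def conj_commute)
  have "emeasure (ball_law d) {g \<in> space (lborel_PiM d). lift g \<in> ?A} \<le> emeasure (ball_law d) {g \<in> space (lborel_PiM d). \<bar>\<Sum>i<d. u i * g i\<bar> < h}"
  proof (rule ball_law_mono)
    show "{g \<in> space (lborel_PiM d). lift g \<in> ?A} \<in> sets (lborel_PiM d)"
      using measurable_sets[OF lift_measurable A] by (simp add: vimage_def Int_def conj_commute)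
    show "{g \<in> space (lborel_PiM d). \<bar>\<Sum>i<d. u i * g i\<bar> < h} \<in> sets (lborel_PiM d)"
      by (intro borel_measurable_less borel_measurable_const borel_measurable_abs borel_measurable_sum borel_measurable_times comp_measurable_lborel_PiM) auto
    fix g assume g: "g \<in> {g \<in> space (lborel_PiM d). lift g \<in> ?A}" and le: "L2_set g {..<d} \<le> 1"
    have "(\<Sum>i<d. u i * g i) = L2_set g {..<d} * (\<Sum>i<d. u i * unit_dir d g i)"
      unfolding sum_distrib_left
    proof (rule sum.cong[OF refl])
      fix i assume "i \<in> {..<d}"
      then have "L2_set g {..<d} * unit_dir d g i = g i" using unit_dir_scale[of i d g] by simp
      then show "u i * g i = L2_set g {..<d} * (u i * unit_dir d g i)" by (metis mult.left_commute)
    qed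
    moreover have "(\<Sum>i<d. u i * unit_dir d g i) = (\<Sum>r<d. u r * coords n U (lift g) r)"
      by (intro sum.cong) (auto simp: coords_lift)
    ultimately have "\<bar>\<Sum>i<d. u i * g i\<bar> \<le> 1 * \<bar>\<Sum>r<d. u r * coords n U (lift g) r\<bar>"
      using mult_right_mono[OF le abs_ge_zero] by (simp add: abs_mult)
    then show "g \<in> {g \<in> space (lborel_PiM d). \<bar>\<Sum>i<d. u i * g i\<bar> < h}" using g by auto
  qed
  also have "\<dots> \<le> ennreal (exp 1 / (real J + 1))"
    unfolding h_def by (rule ball_law_slab[OF u _ J]) (use d in auto)
  finally show "emeasure law {p \<in> space law. \<bar>\<Sum>r<d. u r * coords n U (fst p) r\<bar> < h} \<le> ennreal (exp 1 / (real J + 1))"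
    unfolding eq emeasure_law_fst[OF A] .
qed

text \<open>Membership in the neighbourhood of the span is a union over coefficient vectors; taking
  them from a countable set makes it measurable.\<close>

lemma law_near_span:
  fixes w :: "'j \<Rightarrow> nat \<Rightarrow> real"
  assumes G: "finite G" and C: "countable C"
  defines "A \<equiv> {x \<in> carrier_vec n. \<exists>c\<in>C. L2_set (\<lambda>r. coords n U x r - (\<Sum>j\<in>G. c j * w j r)) {..<d} < 1 / 4}"
  shows "emeasure law {p \<in> space law. fst p \<in> A} \<le> ennreal (1536 ^ card G * (1 / 2) ^ d)"
proof -
  have "A = (\<Union>c\<in>C. {x \<in> space (borel_vec n). L2_set (\<lambda>r. coords n U x r - (\<Sum>j\<in>G. c j * w j r)) {..<d} < 1 / 4})"
    by (auto simp: A_def)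
  also have "\<dots> \<in> sets (borel_vec n)"
  proof (rule sets.countable_UN'[OF C], safe)
    show "{x \<in> space (borel_vec n). L2_set (\<lambda>r. coords n U x r - (\<Sum>j\<in>G. c j * w j r)) {..<d} < 1 / 4} \<in> sets (borel_vec n)" for c
      by (intro borel_measurable_less borel_measurable_const borel_measurable_L2_set borel_measurable_diff coords_measurable)
  qed
  finally have A: "A \<in> sets (borel_vec n)" .
  show ?thesis
    unfolding emeasure_law_fst[OF A]
  proof (rule ball_law_near_span[OF G])
    show "{g \<in> space (lborel_PiM d). lift g \<in> A} \<in> sets (lborel_PiM d)"
      using measurable_sets[OF lift_measurable A] by (simp add: vimage_def Int_def conj_commute)
    fix g assume "g \<in> {g \<in> space (lborel_PiM d). lift g \<in> A}"
    then obtain c where c: "L2_set (\<lambda>r. coords n U (lift g) r - (\<Sum>j\<in>G. c j * w j r)) {..<d} < 1 / 4" by (auto simp: A_def)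
    moreover have "L2_set (\<lambda>r. coords n U (lift g) r - (\<Sum>j\<in>G. c j * w j r)) {..<d} = L2_set (\<lambda>r. unit_dir d g r - (\<Sum>j\<in>G. c j * w j r)) {..<d}"
      by (rule L2_set_cong) (auto simp: coords_lift)
    ultimately show "\<exists>c. L2_set (\<lambda>i. unit_dir d g i - (\<Sum>j\<in>G. c j * w j i)) {..<d} \<le> 1 / 4"
      by (intro exI[of _ c]) simp
  qed
qed

end

section \<open>The two optimization problems\<close>

text \<open>Applied to the columns of an orthonormal basis: projecting a residual or a noise vector
  does not increase its norm.\<close>

lemma bessel:
  fixes q :: "nat \<Rightarrow> nat \<Rightarrow> real" and r d :: nat
  assumes orth: "\<And>s t. s < r \<Longrightarrow> t < r \<Longrightarrow> (\<Sum>i<d. q s i * q t i) = (if s = t then 1 else 0)"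
  shows "L2_set (\<lambda>t. \<Sum>i<d. q t i * f i) {..<r} \<le> L2_set f {..<d}"
proof -
  define c where "c = (\<lambda>t. \<Sum>i<d. q t i * f i)"
  have "(L2_set c {..<r})\<^sup>2 = (\<Sum>t<r. \<Sum>i<d. c t * (q t i * f i))"
    unfolding L2_set_power2 by (rule sum.cong[OF refl]) (simp add: power2_eq_square c_def sum_distrib_left)
  also have "\<dots> = (\<Sum>i<d. (\<Sum>t<r. c t * q t i) * f i)"
    by (subst sum.swap) (simp add: sum_distrib_right mult.assoc)
  also have "\<dots> \<le> L2_set (\<lambda>i. \<Sum>t<r. c t * q t i) {..<d} * L2_set f {..<d}"
    using abs_inner_le_L2_set[of "\<lambda>i. \<Sum>t<r. c t * q t i" f "{..<d}"] by linarith
  also have "L2_set (\<lambda>i. \<Sum>t<r. c t * q t i) {..<d} = L2_set c {..<r}"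
    using L2_set_orthonormal_sum[where q=q and r=r and d=d, OF orth] by simp
  finally have "L2_set c {..<r} * L2_set c {..<r} \<le> L2_set c {..<r} * L2_set f {..<d}" by (simp add: power2_eq_square)
  then show ?thesis
    using L2_set_nonneg[of c "{..<r}"] L2_set_nonneg[of f "{..<d}"] unfolding c_def[symmetric]
    by (cases "L2_set c {..<r} = 0") (auto simp: mult_le_cancel_left)
qed

text \<open>Duality: the bound on the transposed map is tested at the normalized value
  \<open>v\<close> itself.\<close>

lemma adjoint_operator_norm:
  fixes z :: "'j \<Rightarrow> nat \<Rightarrow> real"
  assumes op: "\<And>u. L2_set u {..<n} \<le> 1 \<Longrightarrow> L2_set (\<lambda>j. \<Sum>k<n. u k * z j k) T \<le> K"
  shows "L2_set (\<lambda>k. \<Sum>j\<in>T. \<gamma> j * z j k) {..<n} \<le> L2_set \<gamma> T * K"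
proof -
  define v where "v = (\<lambda>k. \<Sum>j\<in>T. \<gamma> j * z j k)"
  define m where "m = L2_set v {..<n}"
  have m0: "0 \<le> m" by (simp add: m_def)
  have K0: "0 \<le> K" using op[of "\<lambda>_. 0"] by (simp add: L2_set_def)
  show ?thesis
  proof (cases "m = 0")
    case True
    then show ?thesis unfolding v_def[symmetric] m_def[symmetric] using K0 by simp
  next
    case False
    define u where "u = (\<lambda>k. v k / m)"
    have "L2_set u {..<n} = L2_set (\<lambda>k. (1 / m) * v k) {..<n}" by (simp add: u_def)
    also have "\<dots> = \<bar>1 / m\<bar> * m" unfolding L2_set_scale m_def ..
    finally have u: "L2_set u {..<n} \<le> 1" using False m0 by simp
    have "m * m = (\<Sum>k<n. v k * v k)" using L2_set_power2[of v "{..<n}"] by (simp add: m_def power2_eq_square)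
    then have "m = (\<Sum>k<n. u k * v k)" using False by (simp add: u_def field_simps flip: sum_divide_distrib)
    also have "\<dots> = (\<Sum>k<n. \<Sum>j\<in>T. \<gamma> j * (u k * z j k))" by (simp add: v_def sum_distrib_left mult_ac)
    also have "\<dots> = (\<Sum>j\<in>T. \<gamma> j * (\<Sum>k<n. u k * z j k))" by (subst sum.swap) (simp add: sum_distrib_left)
    also have "\<dots> \<le> L2_set \<gamma> T * L2_set (\<lambda>j. \<Sum>k<n. u k * z j k) T"
      using abs_inner_le_L2_set[of \<gamma> "\<lambda>j. \<Sum>k<n. u k * z j k" T] by linarith
    also have "\<dots> \<le> L2_set \<gamma> T * K" by (intro mult_left_mono op u L2_set_nonneg)
    finally show ?thesis by (simp add: m_def v_def)
  qed
qed

text \<open>The coefficients are those of the minimum norm solution \<open>A\<^sup>T (A A\<^sup>T)\<^sup>-\<^sup>1 t\<close>, where the columns of \<open>A\<close> are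
  the vectors \<open>a j\<close>.\<close>
lemma min_norm_representation:
  fixes a :: "'j \<Rightarrow> nat \<Rightarrow> real"
  assumes T: "finite T" and b: "0 < b"
    and low: "\<And>v. L2_set v {..<d} \<le> b * L2_set (\<lambda>j. \<Sum>r<d. v r * a j r) T"
  obtains \<gamma> where "\<And>r. r < d \<Longrightarrow> (\<Sum>j\<in>T. \<gamma> j * a j r) = t r" "L2_set \<gamma> T \<le> b * L2_set t {..<d}"
proof -
  define G where "G = mat d d (\<lambda>(r, s). \<Sum>j\<in>T. a j r * a j s)"
  have G: "G \<in> carrier_mat d d" by (simp add: G_def)
  have Gw: "(G *\<^sub>v w) $ r = (\<Sum>j\<in>T. (\<Sum>s<d. w $ s * a j s) * a j r)" if "w \<in> carrier_vec d" "r < d" for w r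
  proof -
    have "(G *\<^sub>v w) $ r = (\<Sum>s<d. (\<Sum>j\<in>T. a j r * a j s) * w $ s)"
      using that G by (auto simp: G_def scalar_prod_def lessThan_atLeast0 intro!: sum.cong)
    also have "\<dots> = (\<Sum>s<d. \<Sum>j\<in>T. w $ s * a j s * a j r)"
      unfolding sum_distrib_right by (intro sum.cong refl) simp
    also have "\<dots> = (\<Sum>j\<in>T. (\<Sum>s<d. w $ s * a j s) * a j r)" by (subst sum.swap) (simp add: sum_distrib_right)
    finally show ?thesis .
  qed
  have quad: "(\<Sum>r<d. w $ r * (G *\<^sub>v w) $ r) = (L2_set (\<lambda>j. \<Sum>s<d. w $ s * a j s) T)\<^sup>2" if "w \<in> carrier_vec d" for w
  proof -
    have "(\<Sum>r<d. w $ r * (G *\<^sub>v w) $ r) = (\<Sum>r<d. \<Sum>j\<in>T. (\<Sum>s<d. w $ s * a j s) * (w $ r * a j r))"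
      using that by (simp add: Gw sum_distrib_left mult_ac)
    also have "\<dots> = (\<Sum>j\<in>T. (\<Sum>s<d. w $ s * a j s) * (\<Sum>r<d. w $ r * a j r))"
      by (subst sum.swap) (simp only: sum_distrib_left)
    finally show ?thesis unfolding L2_set_power2 by (simp add: power2_eq_square)
  qed
  \<comment> \<open>The lower bound \<open>low\<close> forces a vector in the kernel of the Gram
    matrix to be 0.\<close>
  have det: "Determinant.det G \<noteq> 0"
  proof
    assume "Determinant.det G = 0"
    then obtain v where v: "v \<in> carrier_vec d" "v \<noteq> 0\<^sub>v d" "G *\<^sub>v v = 0\<^sub>v d"
      using det_0_iff_vec_prod_zero_field[OF G] by auto
    have "(L2_set (\<lambda>j. \<Sum>s<d. v $ s * a j s) T)\<^sup>2 = 0" unfolding quad[OF v(1), symmetric] v(3) by simp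
    then have "L2_set (\<lambda>s. v $ s) {..<d} \<le> 0" using low[of "\<lambda>s. v $ s"] by simp
    then have "\<forall>s<d. v $ s = 0" using L2_set_nonneg[of "\<lambda>s. v $ s" "{..<d}"] by (auto simp: L2_set_eq_0_iff dest: antisym)
    then show False using v by (auto intro!: eq_vecI)
  qed
  \<comment> \<open>The inverse of \<open>G\<close> is its adjugate divided by the determinant, so w
    = G^(-1) t.\<close>
  define w where "w = (1 / Determinant.det G) \<cdot>\<^sub>v (adj_mat G *\<^sub>v vec d t)"
  have adj: "adj_mat G \<in> carrier_mat d d" by (rule adj_mat(1)[OF G])
  have w: "w \<in> carrier_vec d" using adj by (simp add: w_def)
  have "G *\<^sub>v w = (1 / Determinant.det G) \<cdot>\<^sub>v (G *\<^sub>v (adj_mat G *\<^sub>v vec d t))"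
    unfolding w_def using G adj by (intro mult_mat_vec[of _ d d]) auto
  also have "G *\<^sub>v (adj_mat G *\<^sub>v vec d t) = (G * adj_mat G) *\<^sub>v vec d t"
    using G adj by (intro assoc_mult_mat_vec[symmetric]) auto
  also have "\<dots> = (Determinant.det G \<cdot>\<^sub>m 1\<^sub>m d) *\<^sub>v vec d t" by (simp only: adj_mat(2)[OF G])
  also have "\<dots> = Determinant.det G \<cdot>\<^sub>v vec d t" by (rule eq_vecI) auto
  finally have Gwt: "G *\<^sub>v w = vec d t" using det by (simp add: smult_smult_assoc)
  define \<gamma> where "\<gamma> = (\<lambda>j. \<Sum>s<d. w $ s * a j s)"
  show ?thesis
  proof (rule that[of \<gamma>])
    show "(\<Sum>j\<in>T. \<gamma> j * a j r) = t r" if "r < d" for r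
      using Gw[OF w that] that by (simp add: \<gamma>_def Gwt)
    have "L2_set \<gamma> T * L2_set \<gamma> T = (\<Sum>r<d. w $ r * t r)"
      using quad[OF w] unfolding Gwt by (simp add: \<gamma>_def power2_eq_square)
    also have "\<dots> \<le> L2_set (\<lambda>r. w $ r) {..<d} * L2_set t {..<d}"
      using abs_inner_le_L2_set[of "\<lambda>r. w $ r" t "{..<d}"] by linarith
    also have "\<dots> \<le> (b * L2_set \<gamma> T) * L2_set t {..<d}"
      using low[of "\<lambda>r. w $ r"] by (intro mult_right_mono) (auto simp: \<gamma>_def)
    finally have "L2_set \<gamma> T * L2_set \<gamma> T \<le> L2_set \<gamma> T * (b * L2_set t {..<d})" by (simp add: mult_ac)
    then show "L2_set \<gamma> T \<le> b * L2_set t {..<d}"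
      using L2_set_nonneg[of \<gamma> T] b by (cases "L2_set \<gamma> T = 0") (auto simp: mult_le_cancel_left)
  qed
qed

text \<open>The noiseless parts cancel exactly, x_i being the sum of the gamma_j x_j, so the
  residual is z_i minus the collected noise, which has norm at most |gamma|_2 K. This is why a small
  l2 norm is sought; the l1 norm follows by Cauchy-Schwarz.\<close>

lemma feasible_coefficients:
  fixes x z a :: "nat \<Rightarrow> nat \<Rightarrow> real" and U :: "nat \<Rightarrow> nat \<Rightarrow> real"
  assumes T: "T \<subseteq> {..<N}" and b: "0 < b"
    and x: "\<And>j k. j \<in> insert i T \<Longrightarrow> k < n \<Longrightarrow> x j k = (\<Sum>r<d. U k r * a j r)"
    and low: "\<And>v. L2_set v {..<d} \<le> b * L2_set (\<lambda>j. \<Sum>r<d. v r * a j r) T"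
    and ai: "L2_set (a i) {..<d} \<le> 1"
    and op: "\<And>u. L2_set u {..<n} \<le> 1 \<Longrightarrow> L2_set (\<lambda>j. \<Sum>k<n. u k * z j k) T \<le> K"
    and zi: "L2_set (z i) {..<n} \<le> e" and \<tau>: "e + b * K \<le> \<tau>"
  obtains \<gamma> where "\<And>j. j \<notin> T \<Longrightarrow> \<gamma> j = 0" "(\<Sum>j<N. \<bar>\<gamma> j\<bar>) \<le> sqrt (real (card T)) * b"
    "L2_set (\<lambda>k. (x i k + z i k) - (\<Sum>j<N. \<gamma> j * (x j k + z j k))) {..<n} \<le> \<tau>"
proof -
  have fT: "finite T" using T finite_subset by blast
  obtain \<gamma>0 where \<gamma>0: "\<And>r. r < d \<Longrightarrow> (\<Sum>j\<in>T. \<gamma>0 j * a j r) = a i r" "L2_set \<gamma>0 T \<le> b * L2_set (a i) {..<d}"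
    using min_norm_representation[OF fT b low] by blast
  have nb: "L2_set \<gamma>0 T \<le> b" using \<gamma>0(2) mult_left_mono[OF ai less_imp_le[OF b]] by simp
  define \<gamma> where "\<gamma> = (\<lambda>j. if j \<in> T then \<gamma>0 j else 0)"
  have sumT: "(\<Sum>j<N. \<gamma> j * f j) = (\<Sum>j\<in>T. \<gamma>0 j * f j)" for f
    using T by (intro sum.mono_neutral_cong_right) (auto simp: \<gamma>_def)
  show ?thesis
  proof (rule that[of \<gamma>])
    show "\<gamma> j = 0" if "j \<notin> T" for j using that by (simp add: \<gamma>_def)
    have "(\<Sum>j<N. \<bar>\<gamma> j\<bar>) = (\<Sum>j\<in>T. \<bar>\<gamma>0 j\<bar>)"
      using T by (intro sum.mono_neutral_cong_right) (auto simp: \<gamma>_def)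
    also have "\<dots> \<le> sqrt (real (card T)) * L2_set \<gamma>0 T" by (rule sum_abs_le_sqrt_L2_set[OF fT])
    also have "\<dots> \<le> sqrt (real (card T)) * b" using nb by (intro mult_left_mono) auto
    finally show "(\<Sum>j<N. \<bar>\<gamma> j\<bar>) \<le> sqrt (real (card T)) * b" .
    have x0: "x i k = (\<Sum>j\<in>T. \<gamma>0 j * x j k)" if "k < n" for k
    proof -
      have "(\<Sum>j\<in>T. \<gamma>0 j * x j k) = (\<Sum>j\<in>T. \<Sum>r<d. U k r * (\<gamma>0 j * a j r))"
        using x that by (auto simp: sum_distrib_left mult_ac intro!: sum.cong)
      also have "\<dots> = (\<Sum>r<d. U k r * (\<Sum>j\<in>T. \<gamma>0 j * a j r))" by (subst sum.swap) (simp add: sum_distrib_left)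
      also have "\<dots> = x i k" using x that by (auto simp: \<gamma>0 intro!: sum.cong)
      finally show ?thesis ..
    qed
    have "L2_set (\<lambda>k. (x i k + z i k) - (\<Sum>j<N. \<gamma> j * (x j k + z j k))) {..<n} = L2_set (\<lambda>k. z i k + - (\<Sum>j\<in>T. \<gamma>0 j * z j k)) {..<n}"
      unfolding sumT by (rule L2_set_cong) (auto simp: distrib_left sum.distrib x0)
    also have "\<dots> \<le> L2_set (z i) {..<n} + L2_set (\<lambda>k. - (\<Sum>j\<in>T. \<gamma>0 j * z j k)) {..<n}" by (rule L2_set_triangle_ineq)
    also have "L2_set (\<lambda>k. - (\<Sum>j\<in>T. \<gamma>0 j * z j k)) {..<n} = L2_set (\<lambda>k. \<Sum>j\<in>T. \<gamma>0 j * z j k) {..<n}" by (simp add: L2_set_def)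
    also have "\<dots> \<le> L2_set \<gamma>0 T * K" by (rule adjoint_operator_norm[OF op])
    also have "\<dots> \<le> b * K"
      using nb op[of "\<lambda>_. 0"] by (intro mult_right_mono) (auto simp: L2_set_def)
    finally show "L2_set (\<lambda>k. (x i k + z i k) - (\<Sum>j<N. \<gamma> j * (x j k + z j k))) {..<n} \<le> \<tau>" using zi \<tau> by linarith
  qed
qed

text \<open>The strict inequality leaves room to perturb the coefficients. Rational ones on a finite
  index set are countable, as measurability of the near-span event demands.\<close>

lemma rational_coefficients:
  fixes p :: "'j \<Rightarrow> nat \<Rightarrow> real"
  assumes H: "finite H" and lt: "L2_set (\<lambda>r. a r - (\<Sum>j\<in>H. c j * p j r)) A < \<epsilon>"
  obtains c' where "c' \<in> PiE H (\<lambda>_. \<rat>)" "L2_set (\<lambda>r. a r - (\<Sum>j\<in>H. c' j * p j r)) A < \<epsilon>"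
proof -
  define M where "M = (\<Sum>j\<in>H. L2_set (p j) A)"
  have M: "0 \<le> M" unfolding M_def by (intro sum_nonneg) auto
  define \<eta> where "\<eta> = (\<epsilon> - L2_set (\<lambda>r. a r - (\<Sum>j\<in>H. c j * p j r)) A) / (M + 1)"
  have \<eta>: "0 < \<eta>" unfolding \<eta>_def using lt M by simp
  have "\<exists>q\<in>\<rat>. \<bar>c j - q\<bar> < \<eta>" for j
  proof -
    obtain q where "q \<in> \<rat>" "c j - \<eta> < q" "q < c j + \<eta>" using Rats_dense_in_real[of "c j - \<eta>" "c j + \<eta>"] \<eta> by auto
    then show ?thesis by (intro bexI[of _ q]) auto
  qed
  then obtain q where q: "\<And>j. q j \<in> \<rat>" "\<And>j. \<bar>c j - q j\<bar> < \<eta>" by metis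
  define c' where "c' = restrict q H"
  show ?thesis
  proof (rule that[of c'])
    show "c' \<in> PiE H (\<lambda>_. \<rat>)" using q by (auto simp: c'_def)
    have "L2_set (\<lambda>r. a r - (\<Sum>j\<in>H. c' j * p j r)) A = L2_set (\<lambda>r. (a r - (\<Sum>j\<in>H. c j * p j r)) + (\<Sum>j\<in>H. (c j - q j) * p j r)) A"
      by (rule L2_set_cong) (auto simp: c'_def left_diff_distrib sum_subtractf)
    also have "\<dots> \<le> L2_set (\<lambda>r. a r - (\<Sum>j\<in>H. c j * p j r)) A + L2_set (\<lambda>r. \<Sum>j\<in>H. (c j - q j) * p j r) A"
      by (rule L2_set_triangle_ineq)
    also have "L2_set (\<lambda>r. \<Sum>j\<in>H. (c j - q j) * p j r) A \<le> (\<Sum>j\<in>H. L2_set (\<lambda>r. (c j - q j) * p j r) A)" by (rule L2_set_sum_le)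
    also have "\<dots> \<le> (\<Sum>j\<in>H. \<eta> * L2_set (p j) A)"
      unfolding L2_set_scale by (intro sum_mono mult_right_mono) (use q less_imp_le in auto)
    also have "\<dots> = \<eta> * M" by (simp add: M_def sum_distrib_left)
    also have "\<dots> < \<eta> * (M + 1)" using \<eta> by simp
    also have "\<dots> = \<epsilon> - L2_set (\<lambda>r. a r - (\<Sum>j\<in>H. c j * p j r)) A" unfolding \<eta>_def using M by simp
    finally show "L2_set (\<lambda>r. a r - (\<Sum>j\<in>H. c' j * p j r)) A < \<epsilon>" by simp
  qed
qed

text \<open>Coefficients outside \<open>F\<close> are kept, and the combination over
  \<open>F\<close> is thinned out to \<open>s\<close> terms. The alternative of dropping it
  altogether serves dimensions so small that not even one term can be afforded; the three errors
  then add up to less than 1/4.\<close>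

lemma sparse_approximation:
  fixes p :: "nat \<Rightarrow> nat \<Rightarrow> real" and \<beta> a :: "nat \<Rightarrow> real"
  assumes res: "L2_set (\<lambda>r. p i r - (\<Sum>j<N. \<beta> j * p j r)) A \<le> e1"
    and pa: "L2_set (\<lambda>r. p i r - a r) A \<le> e2"
    and F: "F \<subseteq> {..<N}" and l1: "(\<Sum>j<N. \<bar>\<beta> j\<bar>) \<le> B"
    and W: "\<And>j. j \<in> F \<Longrightarrow> L2_set (p j) A \<le> W" "0 \<le> W"
    and s: "B * W \<le> \<delta> \<or> 0 < s \<and> B * W / sqrt (real s) \<le> \<delta>"
    and e: "e1 + e2 + \<delta> < 1 / 4"
  obtains G c where "G \<subseteq> F" "card G \<le> s" "c \<in> PiE ({j. j < N \<and> j \<notin> F \<and> \<beta> j \<noteq> 0} \<union> G) (\<lambda>_. \<rat>)"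
    "L2_set (\<lambda>r. a r - (\<Sum>j\<in>{j. j < N \<and> j \<notin> F \<and> \<beta> j \<noteq> 0} \<union> G. c j * p j r)) A < 1 / 4"
proof -
  have fF: "finite F" using F finite_subset by blast
  have l1F: "(\<Sum>j\<in>F. \<bar>\<beta> j\<bar>) \<le> B" using l1 sum_mono2[OF _ F, of "\<lambda>j. \<bar>\<beta> j\<bar>"] by force
  define T0 where "T0 = {j. j < N \<and> j \<notin> F \<and> \<beta> j \<noteq> 0}"
  have fT0: "finite T0" by (simp add: T0_def)
  obtain G c0 where G: "G \<subseteq> F" "card G \<le> s"
    "L2_set (\<lambda>r. (\<Sum>j\<in>F. \<beta> j * p j r) - (\<Sum>j\<in>G. c0 j * p j r)) A \<le> \<delta>"
    using s
  proof
    assume le: "B * W \<le> \<delta>"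
    have "L2_set (\<lambda>r. \<Sum>j\<in>F. \<beta> j * p j r) A \<le> (\<Sum>j\<in>F. L2_set (\<lambda>r. \<beta> j * p j r) A)" by (rule L2_set_sum_le)
    also have "\<dots> \<le> (\<Sum>j\<in>F. \<bar>\<beta> j\<bar> * W)" unfolding L2_set_scale by (intro sum_mono mult_left_mono W) auto
    also have "\<dots> \<le> B * W" using l1F W by (simp add: mult_right_mono flip: sum_distrib_right)
    finally show thesis using le by (intro that[of "{}" "\<lambda>_. 0"]) auto
  next
    assume s: "0 < s \<and> B * W / sqrt (real s) \<le> \<delta>"
    show thesis
    proof (rule maurey[where A=A, OF fF W l1F conjunct1[OF s]])
      fix G c assume "G \<subseteq> F" "card G \<le> s" "L2_set (\<lambda>i. (\<Sum>j\<in>F. \<beta> j * p j i) - (\<Sum>j\<in>G. c j * p j i)) A \<le> B * W / sqrt (real s)"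
      then show thesis using s by (intro that[of G c]) auto
    qed
  qed
  have disj: "T0 \<inter> G = {}" using G by (auto simp: T0_def)
  have fG: "finite G" using G fF finite_subset by blast
  define c1 where "c1 = (\<lambda>j. if j \<in> T0 then \<beta> j else c0 j)"
  have split: "(\<Sum>j<N. \<beta> j * p j r) = (\<Sum>j\<in>T0. \<beta> j * p j r) + (\<Sum>j\<in>F. \<beta> j * p j r)" for r
  proof -
    have "(\<Sum>j<N. \<beta> j * p j r) = (\<Sum>j\<in>T0 \<union> F. \<beta> j * p j r)"
      using F by (intro sum.mono_neutral_right) (auto simp: T0_def)
    then show ?thesis using fT0 fF by (simp add: sum.union_disjoint T0_def disjoint_iff)
  qed
  have c1: "(\<Sum>j\<in>T0 \<union> G. c1 j * p j r) = (\<Sum>j\<in>T0. \<beta> j * p j r) + (\<Sum>j\<in>G. c0 j * p j r)" for r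
  proof -
    have "(\<Sum>j\<in>G. c1 j * p j r) = (\<Sum>j\<in>G. c0 j * p j r)" using disj by (intro sum.cong) (auto simp: c1_def)
    moreover have "(\<Sum>j\<in>T0. c1 j * p j r) = (\<Sum>j\<in>T0. \<beta> j * p j r)" by (intro sum.cong) (auto simp: c1_def)
    ultimately show ?thesis using fT0 fG disj by (simp add: sum.union_disjoint)
  qed
  have "L2_set (\<lambda>r. a r - (\<Sum>j\<in>T0 \<union> G. c1 j * p j r)) A =
      L2_set (\<lambda>r. (a r - p i r) + ((p i r - (\<Sum>j<N. \<beta> j * p j r)) + ((\<Sum>j\<in>F. \<beta> j * p j r) - (\<Sum>j\<in>G. c0 j * p j r)))) A"
    by (rule L2_set_cong) (auto simp: c1 split)
  also have "\<dots> \<le> L2_set (\<lambda>r. a r - p i r) A + L2_set (\<lambda>r. (p i r - (\<Sum>j<N. \<beta> j * p j r)) + ((\<Sum>j\<in>F. \<beta> j * p j r) - (\<Sum>j\<in>G. c0 j * p j r))) A"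
    by (rule L2_set_triangle_ineq)
  also have "\<dots> \<le> L2_set (\<lambda>r. a r - p i r) A + (L2_set (\<lambda>r. p i r - (\<Sum>j<N. \<beta> j * p j r)) A + L2_set (\<lambda>r. (\<Sum>j\<in>F. \<beta> j * p j r) - (\<Sum>j\<in>G. c0 j * p j r)) A)"
    by (intro add_left_mono L2_set_triangle_ineq)
  also have "\<dots> < 1 / 4" using res pa G(3) e by (simp add: L2_set_minus_commute[of a])
  finally have lt: "L2_set (\<lambda>r. a r - (\<Sum>j\<in>T0 \<union> G. c1 j * p j r)) A < 1 / 4" .
  obtain c where "c \<in> PiE (T0 \<union> G) (\<lambda>_. \<rat>)" "L2_set (\<lambda>r. a r - (\<Sum>j\<in>T0 \<union> G. c j * p j r)) A < 1 / 4"
    using rational_coefficients[OF _ lt] fT0 fG by blast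
  then show ?thesis using G by (intro that[of G c]) (auto simp: T0_def)
qed

section \<open>The two minimization problems and the data matrix\<close>

lemma l1norm_eq: "v \<in> carrier_vec N \<Longrightarrow> l1norm v = (\<Sum>j<N. \<bar>v $ j\<bar>)"
  by (simp add: l1norm_def)

lemma l1norm_pos:
  assumes "v \<in> carrier_vec N" "v \<noteq> 0\<^sub>v N"
  shows "0 < l1norm v"
proof -
  have "0 \<le> l1norm v" by (simp add: l1norm_def sum_nonneg)
  moreover have "l1norm v \<noteq> 0"
  proof
    assume "l1norm v = 0"
    then have "\<forall>j<N. v $ j = 0" using assms by (simp add: l1norm_def sum_nonneg_eq_0_iff)
    then show False using assms by (auto intro!: eq_vecI)
  qed
  ultimately show ?thesis by simp
qed

text \<open>Both steps are compared through the first solution, which is admissible in the second problem.\<close>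
lemma two_step_comparison:
  assumes s1: "step1_solution Y i (2 * \<sigma>) \<beta>s" and nz: "\<beta>s \<noteq> 0\<^sub>v (dim_col Y)"
    and s3: "step3_solution Y i lam \<beta>"
    and b0: "step1_feasible Y i (2 * \<sigma>) b0"
    and \<sigma>: "0 < \<sigma>" "\<sigma> \<le> 1 / 100"
    and lam: "0 < lam" "0.707 * \<sigma> * inverse (l1norm \<beta>s) \<le> lam" "lam \<le> 1 / 800 * inverse (l1norm \<beta>s)"
  shows "l1norm \<beta> \<le> 2 * l1norm b0" "l2norm (col Y i - Y *\<^sub>v \<beta>) \<le> 6 / 100"
proof -
  define t where "t = l1norm \<beta>s"
  have f: "step1_feasible Y i (2 * \<sigma>) \<beta>s" and tb: "t \<le> l1norm b0"
    using s1 b0 by (auto simp: step1_solution_def is_arg_min_def t_def not_less)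
  have \<beta>sc: "\<beta>s \<in> carrier_vec (dim_col Y)" "\<beta>s $ i = 0" and r: "l2norm (col Y i - Y *\<^sub>v \<beta>s) \<le> 2 * \<sigma>"
    using f by (auto simp: step1_feasible_def)
  have t: "0 < t" unfolding t_def by (rule l1norm_pos[OF \<beta>sc(1) nz])
  define R where "R = l2norm (col Y i - Y *\<^sub>v \<beta>)"
  have obj: "R\<^sup>2 / 2 + lam * l1norm \<beta> \<le> (l2norm (col Y i - Y *\<^sub>v \<beta>s))\<^sup>2 / 2 + lam * t"
    using s3 \<beta>sc unfolding step3_solution_def is_arg_min_def R_def t_def by (auto simp: not_less)
  have l2: "0 \<le> l2norm v" for v by (simp add: l2norm_eq_L2_set)
  have "(l2norm (col Y i - Y *\<^sub>v \<beta>s))\<^sup>2 \<le> (2 * \<sigma>)\<^sup>2" using r l2 by (intro power_mono) auto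
  with obj have obj': "R\<^sup>2 / 2 + lam * l1norm \<beta> \<le> 2 * \<sigma>\<^sup>2 + lam * t" by (simp add: power_mult_distrib)
  have lt1: "0.707 * \<sigma> \<le> lam * t" using lam(2) t by (simp add: t_def[symmetric] field_simps)
  have lt2: "lam * t \<le> 1 / 800" using lam(3) t by (simp add: t_def[symmetric] field_simps)
  \<comment> \<open>The lower bound on f makes lam t at least of order sigma, so for sigma <= 1/100
    it dominates the residual term 2 sigma^2 and the l1 norm at most doubles.\<close>
  have "2 * \<sigma>\<^sup>2 \<le> 2 * (1 / 100) * \<sigma>" using \<sigma> by (simp add: power2_eq_square)
  then have "2 * \<sigma>\<^sup>2 \<le> lam * t" using lt1 \<sigma> by simp
  then have "lam * l1norm \<beta> \<le> lam * (2 * t)" using obj' zero_le_power2[of R] by linarith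
  then have "l1norm \<beta> \<le> 2 * t" using lam(1) by (simp only: mult_le_cancel_left_pos)
  then show "l1norm \<beta> \<le> 2 * l1norm b0" using tb by linarith
  have "0 \<le> lam * l1norm \<beta>" using lam(1) by (simp add: l1norm_def sum_nonneg)
  moreover have "\<sigma>\<^sup>2 \<le> (1 / 100)\<^sup>2" using \<sigma> by (intro power_mono) auto
  \<comment> \<open>R^2 <= 4 sigma^2 + 2 lam t <= 0.0004 + 0.0025.\<close>
  ultimately have "R\<^sup>2 \<le> (6 / 100)\<^sup>2" using obj' lt2 by (simp add: power2_eq_square)
  then have "R \<le> 6 / 100" by (rule power2_le_imp_le) simp
  then show "l2norm (col Y i - Y *\<^sub>v \<beta>) \<le> 6 / 100" by (simp add: R_def)
qed

lemma data_matrix_residual: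
  assumes \<beta>: "\<beta> \<in> carrier_vec N" and i: "i < N"
    and \<omega>: "\<And>j. j < N \<Longrightarrow> fst (\<omega> j) \<in> carrier_vec n \<and> snd (\<omega> j) \<in> carrier_vec n"
  shows "l2norm (col (data_matrix n N \<omega>) i - data_matrix n N \<omega> *\<^sub>v \<beta>) =
    L2_set (\<lambda>k. (fst (\<omega> i) $ k + snd (\<omega> i) $ k) - (\<Sum>j<N. \<beta> $ j * (fst (\<omega> j) $ k + snd (\<omega> j) $ k))) {..<n}"
proof -
  let ?Y = "data_matrix n N \<omega>"
  have Y: "?Y \<in> carrier_mat n N" by (simp add: data_matrix_def mat_of_cols_def)
  have idx: "?Y $$ (k, j) = fst (\<omega> j) $ k + snd (\<omega> j) $ k" if "k < n" "j < N" for k j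
    using that \<omega>[OF that(2)] by (auto simp: data_matrix_def mat_of_cols_index)
  have "l2norm (col ?Y i - ?Y *\<^sub>v \<beta>) = L2_set (\<lambda>k. (col ?Y i - ?Y *\<^sub>v \<beta>) $ k) {..<n}"
    using Y by (simp add: l2norm_eq_L2_set)
  also have "\<dots> = L2_set (\<lambda>k. (fst (\<omega> i) $ k + snd (\<omega> i) $ k) - (\<Sum>j<N. \<beta> $ j * (fst (\<omega> j) $ k + snd (\<omega> j) $ k))) {..<n}"
  proof (rule L2_set_cong[OF refl])
    fix k assume "k \<in> {..<n}"
    then have k: "k < n" by simp
    have "(?Y *\<^sub>v \<beta>) $ k = (\<Sum>j<N. ?Y $$ (k, j) * \<beta> $ j)"
      using Y k \<beta> by (auto simp: scalar_prod_def lessThan_atLeast0 intro!: sum.cong)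
    also have "\<dots> = (\<Sum>j<N. \<beta> $ j * (fst (\<omega> j) $ k + snd (\<omega> j) $ k))"
      using k by (intro sum.cong) (auto simp: idx)
    finally show "(col ?Y i - ?Y *\<^sub>v \<beta>) $ k = (fst (\<omega> i) $ k + snd (\<omega> i) $ k) - (\<Sum>j<N. \<beta> $ j * (fst (\<omega> j) $ k + snd (\<omega> j) $ k))"
      using Y k i idx[OF k i] by simp
  qed
  finally show ?thesis .
qed

lemma data_matrix_dim [simp]: "dim_col (data_matrix n N \<omega>) = N" "dim_row (data_matrix n N \<omega>) = n"
  by (simp_all add: data_matrix_def mat_of_cols_def)

section \<open>Events of small probability\<close>

text \<open>Only the exceptional set has to be measurable: \<open>P\<close> may quantify over all
  vectors u or over all outputs of the procedure.\<close>

definition rare :: "'a measure \<Rightarrow> real \<Rightarrow> ('a \<Rightarrow> bool) \<Rightarrow> bool" where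
  "rare M p P \<longleftrightarrow> (\<exists>B\<in>sets M. emeasure M B \<le> ennreal p \<and> (\<forall>\<omega>\<in>space M. \<omega> \<notin> B \<longrightarrow> P \<omega>))"

lemma rareI:
  assumes "B \<in> sets M" "emeasure M B \<le> ennreal p" "\<And>\<omega>. \<omega> \<in> space M \<Longrightarrow> \<omega> \<notin> B \<Longrightarrow> P \<omega>"
  shows "rare M p P"
  using assms unfolding rare_def by blast

lemma rare_mono:
  assumes "rare M p P" "p \<le> q" "\<And>\<omega>. \<omega> \<in> space M \<Longrightarrow> P \<omega> \<Longrightarrow> Q \<omega>"
  shows "rare M q Q"
  using assms unfolding rare_def by (meson ennreal_leI order_trans)

lemma rare_conj:
  assumes "rare M p P" "rare M q Q" "0 \<le> p" "0 \<le> q"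
  shows "rare M (p + q) (\<lambda>\<omega>. P \<omega> \<and> Q \<omega>)"
proof -
  obtain A where A: "A \<in> sets M" "emeasure M A \<le> ennreal p" "\<forall>\<omega>\<in>space M. \<omega> \<notin> A \<longrightarrow> P \<omega>"
    using assms unfolding rare_def by blast
  obtain B where B: "B \<in> sets M" "emeasure M B \<le> ennreal q" "\<forall>\<omega>\<in>space M. \<omega> \<notin> B \<longrightarrow> Q \<omega>"
    using assms unfolding rare_def by blast
  show ?thesis
  proof (rule rareI[of "A \<union> B"])
    have "emeasure M (A \<union> B) \<le> emeasure M A + emeasure M B" using A B by (intro emeasure_subadditive)
    also have "\<dots> \<le> ennreal p + ennreal q" using A B by (intro add_mono)
    finally show "emeasure M (A \<union> B) \<le> ennreal (p + q)" using assms by simp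
  qed (use A B in auto)
qed

lemma rare_ball:
  assumes J: "finite J" and p: "0 \<le> p" and P: "\<And>j. j \<in> J \<Longrightarrow> rare M p (P j)"
  shows "rare M (real (card J) * p) (\<lambda>\<omega>. \<forall>j\<in>J. P j \<omega>)"
  using J P
proof (induction J rule: finite_induct)
  case empty
  show ?case by (rule rareI[of "{}"]) auto
next
  case (insert j J)
  have "rare M (p + real (card J) * p) (\<lambda>\<omega>. P j \<omega> \<and> (\<forall>j\<in>J. P j \<omega>))"
    using insert p by (intro rare_conj) auto
  then show ?case by (rule rare_mono) (use insert in \<open>auto simp: algebra_simps\<close>)
qed

lemma rare_component:
  assumes K: "\<And>j. prob_space (K j)" and I: "finite I" "j \<in> I"
    and A: "A \<in> sets (K j)" "emeasure (K j) A \<le> ennreal p"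
  shows "rare (PiM I K) p (\<lambda>\<omega>. \<omega> j \<notin> A)"
proof (rule rareI)
  have "(\<lambda>\<omega>. \<omega> j) -` A \<inter> space (PiM I K) \<in> sets (PiM I K)"
    by (rule measurable_sets[OF measurable_component_singleton[OF I(2), of K] A(1)])
  then show B: "{\<omega> \<in> space (PiM I K). \<omega> j \<in> A} \<in> sets (PiM I K)" by (simp add: vimage_def Int_def conj_commute)
  show "emeasure (PiM I K) {\<omega> \<in> space (PiM I K). \<omega> j \<in> A} \<le> ennreal p"
  proof (rule emeasure_PiM_le_fibre[OF K I B])
    fix \<omega>
    have "emeasure (K j) {y \<in> space (K j). (fun_upd \<omega> j y) \<in> {\<omega> \<in> space (PiM I K). \<omega> j \<in> A}} \<le> emeasure (K j) A"
      by (rule emeasure_mono[OF _ A(1)]) auto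
    then show "emeasure (K j) {y \<in> space (K j). (fun_upd \<omega> j y) \<in> {\<omega> \<in> space (PiM I K). \<omega> j \<in> A}} \<le> ennreal p"
      using A(2) by (rule order_trans)
  qed
qed auto

text \<open>Scaling by sqrt (q / tau) brings the squared Frobenius norm of the rows down to the
  admissible value q; Markov's inequality does the rest.\<close>

lemma subgaussian_matrix_tail:
  fixes p :: nat
  assumes sg: "subgaussian M D \<xi> q" and M: "prob_space M" and q: "0 < q" and \<tau>: "0 < \<tau>"
    and u: "(\<Sum>r<p. \<Sum>i<D. (u r i)\<^sup>2) \<le> \<tau>"
  shows "{x \<in> space M. s * \<tau> / q \<le> (\<Sum>r<p. (\<Sum>i<D. u r i * \<xi> x i)\<^sup>2)} \<in> sets M"
    "emeasure M {x \<in> space M. s * \<tau> / q \<le> (\<Sum>r<p. (\<Sum>i<D. u r i * \<xi> x i)\<^sup>2)} \<le> ennreal (9 * exp (- s))"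
proof -
  define c where "c = sqrt (q / \<tau>)"
  have c: "c\<^sup>2 = q / \<tau>" using q \<tau> by (simp add: c_def)
  have inner: "(\<lambda>x. \<Sum>i<D. u r i * \<xi> x i) \<in> borel_measurable M" for u :: "nat \<Rightarrow> nat \<Rightarrow> real" and r
    by (rule subgaussian_inner_measurable[OF sg])
  show "{x \<in> space M. s * \<tau> / q \<le> (\<Sum>r<p. (\<Sum>i<D. u r i * \<xi> x i)\<^sup>2)} \<in> sets M"
    by (intro borel_measurable_le borel_measurable_const borel_measurable_sum borel_measurable_power inner)
  have cs: "(\<Sum>r<p. \<Sum>i<D. (c * u r i)\<^sup>2) \<le> q"
  proof -
    have "(\<Sum>r<p. \<Sum>i<D. (c * u r i)\<^sup>2) = q / \<tau> * (\<Sum>r<p. \<Sum>i<D. (u r i)\<^sup>2)"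
      by (simp add: power_mult_distrib c sum_distrib_left)
    also have "\<dots> \<le> q / \<tau> * \<tau>" using u q \<tau> by (intro mult_left_mono) auto
    finally show ?thesis using \<tau> by simp
  qed
  have eq: "(\<Sum>r<p. (\<Sum>i<D. (c * u r i) * \<xi> x i)\<^sup>2) = q / \<tau> * (\<Sum>r<p. (\<Sum>i<D. u r i * \<xi> x i)\<^sup>2)" for x
    unfolding c[symmetric] by (simp only: mult.assoc power_mult_distrib flip: sum_distrib_left)
  have C: "(\<integral>\<^sup>+ x. ennreal (exp (\<Sum>r<p. (\<Sum>i<D. (c * u r i) * \<xi> x i)\<^sup>2)) \<partial>M) \<le> ennreal 9"
    using subgaussian_matrix[OF sg M cs] by simp
  have "{x \<in> space M. s * \<tau> / q \<le> (\<Sum>r<p. (\<Sum>i<D. u r i * \<xi> x i)\<^sup>2)} = {x \<in> space M. s \<le> (\<Sum>r<p. (\<Sum>i<D. (c * u r i) * \<xi> x i)\<^sup>2)}"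
    unfolding eq using q \<tau> by (simp add: field_simps)
  also have "emeasure M \<dots> \<le> ennreal (9 * exp (- s))"
    by (rule markov_exp[OF _ C]) (intro borel_measurable_sum borel_measurable_power inner[of "\<lambda>r i. c * u r i"])
  finally show "emeasure M {x \<in> space M. s * \<tau> / q \<le> (\<Sum>r<p. (\<Sum>i<D. u r i * \<xi> x i)\<^sup>2)} \<le> ennreal (9 * exp (- s))" .
qed

text \<open>Weighting each subset \<open>A\<close> by \<open>x ^ card A\<close>, all weights add up to \<open>(1 + x) ^ card T\<close>.\<close>
lemma card_small_subsets:
  assumes T: "finite T" and x: "0 < x" "x \<le> 1"
  shows "real (card {A. A \<subseteq> T \<and> real (card A) \<le> k}) \<le> exp (x * real (card T) + k * ln (1 / x))"
proof -
  let ?F = "{A. A \<subseteq> T \<and> real (card A) \<le> k}"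
  have fin: "finite (Pow T)" using T by simp
  have "real (card ?F) * exp (- (k * ln (1 / x))) = (\<Sum>A\<in>?F. exp (- (k * ln (1 / x))))" by simp
  also have "\<dots> \<le> (\<Sum>A\<in>?F. x ^ card A)"
  proof (rule sum_mono)
    fix A assume "A \<in> ?F"
    then have "real (card A) * ln (1 / x) \<le> k * ln (1 / x)" using x by (intro mult_right_mono) auto
    then have "exp (- (k * ln (1 / x))) \<le> exp (- (real (card A) * ln (1 / x)))" by simp
    also have "\<dots> = x ^ card A" using x by (simp add: ln_div exp_of_nat_mult)
    finally show "exp (- (k * ln (1 / x))) \<le> x ^ card A" .
  qed
  also have "\<dots> \<le> (\<Sum>A\<in>Pow T. x ^ card A)" using fin x by (intro sum_mono2) auto
  also have "\<dots> = (x + 1) ^ card T"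
    using prod_add[OF T, of "\<lambda>_. x" "\<lambda>_. 1"] T by (simp add: prod_constant)
  also have "\<dots> \<le> exp x ^ card T" using x exp_ge_add_one_self[of x] by (intro power_mono) (auto simp: add.commute)
  also have "\<dots> = exp (x * real (card T))" by (simp add: mult.commute flip: exp_of_nat_mult)
  finally have "real (card ?F) * exp (- (k * ln (1 / x))) * exp (k * ln (1 / x)) \<le> exp (x * real (card T)) * exp (k * ln (1 / x))"
    by (intro mult_right_mono) auto
  then show ?thesis by (simp add: mult.assoc mult_exp_exp)
qed

section \<open>Random estimates for the points of one group\<close>

context point_law
begin

text \<open>For at most n points the bound is 2 sqrt (160 sigma^2) <= 26 sigma, because card J + n
  <= 2 n. It will be applied to 10^12 d points, where d is a tiny fraction of n.\<close>

lemma rare_noise_operator_norm: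
  assumes K: "\<And>j. prob_space (K j)" and I: "finite I" "J \<subseteq> I" and KJ: "\<And>j. j \<in> J \<Longrightarrow> K j = law"
    and J: "card J \<le> n"
  shows "rare (PiM I K) (exp (- (1 / 8) * real n))
    (\<lambda>\<omega>. \<forall>u. L2_set u {..<n} \<le> 1 \<longrightarrow> L2_set (\<lambda>j. \<Sum>k<n. u k * snd (\<omega> j) $ k) J \<le> 26 * \<sigma>)"
proof -
  have q: "0 < real n / (4 * \<sigma>\<^sup>2)" using n_pos \<sigma> by simp
  have sgJ: "subgaussian (K j) n (\<lambda>p k. snd p $ k) (real n / (4 * \<sigma>\<^sup>2))" if "j \<in> J" for j
    unfolding KJ[OF that] by (rule subgaussian_noise)
  obtain B where B: "B \<in> sets (PiM I K)" "emeasure (PiM I K) B \<le> ennreal (exp (- (real (card J) + real n)))"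
    "\<And>\<omega> u. \<omega> \<in> space (PiM I K) \<Longrightarrow> \<omega> \<notin> B \<Longrightarrow> L2_set u {..<n} \<le> 1 \<Longrightarrow>
      L2_set (\<lambda>j. \<Sum>k<n. u k * snd (\<omega> j) $ k) J \<le> 2 * sqrt (20 * (real (card J) + real n) / (real n / (4 * \<sigma>\<^sup>2)))"
    using subgaussian_operator_norm[where K=K and D=n and \<xi>="\<lambda>j p k. snd p $ k", OF K I sgJ q] by blast
  have "20 * (real (card J) + real n) / (real n / (4 * \<sigma>\<^sup>2)) \<le> 160 * \<sigma>\<^sup>2"
  proof -
    have "20 * (real (card J) + real n) / (real n / (4 * \<sigma>\<^sup>2)) = (80 * \<sigma>\<^sup>2) * ((real (card J) + real n) / real n)"
      using n_pos \<sigma> by (simp add: field_simps)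
    also have "\<dots> \<le> (80 * \<sigma>\<^sup>2) * 2" using J n_pos by (intro mult_left_mono) (auto simp: pos_divide_le_eq)
    finally show ?thesis by simp
  qed
  also have "\<dots> \<le> (13 * \<sigma>)\<^sup>2" by (simp add: power_mult_distrib)
  finally have "sqrt (20 * (real (card J) + real n) / (real n / (4 * \<sigma>\<^sup>2))) \<le> 13 * \<sigma>"
    using \<sigma> by (intro real_le_lsqrt) auto
  then have le: "2 * sqrt (20 * (real (card J) + real n) / (real n / (4 * \<sigma>\<^sup>2))) \<le> 26 * \<sigma>" by linarith
  show ?thesis
  proof (rule rareI[OF B(1)])
    have "exp (- (real (card J) + real n)) \<le> exp (- (1 / 8) * real n)" by simp
    then show "emeasure (PiM I K) B \<le> ennreal (exp (- (1 / 8) * real n))"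
      using B(2) by (meson ennreal_leI order_trans)
  qed (use B(3) le order_trans in blast)
qed

text \<open>At a fixed net point at least half of the points avoid a thin slab, except with
  probability 8^(-card J), which gives a value of order sqrt rho0. Passing from the net to the
  sphere loses 1 / E times the upper bound 36 sqrt rho0, and E = 36 * 9216 makes this half of sqrt
  rho0 / 4608. The net has at most (6 * 2^E)^d points, which 8^(-rho0 d) outweighs once rho0 >= E +
  2.\<close>

lemma rare_lower_singular_value:
  fixes \<rho>0 E :: nat
  assumes K: "\<And>j. prob_space (K j)" and I: "finite I" "J \<subseteq> I" and KJ: "\<And>j. j \<in> J \<Longrightarrow> K j = law"
    and J: "card J = \<rho>0 * d" and E: "E = 331776" and \<rho>0: "E + 2 \<le> \<rho>0"
  shows "rare (PiM I K) (2 * exp (- real d))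
    (\<lambda>\<omega>. \<forall>v. L2_set v {..<d} \<le> 9216 / sqrt (real \<rho>0) * L2_set (\<lambda>j. \<Sum>r<d. v r * coords n U (fst (\<omega> j)) r) J)"
proof -
  have dpos: "0 < real d" and \<rho>1: "1 \<le> real \<rho>0" and Epos: "0 < E" using d \<rho>0 E by linarith+
  define X where "X = (\<lambda>v (\<omega> :: 'a \<Rightarrow> real vec \<times> real vec). L2_set (\<lambda>j. \<Sum>r<d. v r * coords n U (fst (\<omega> j)) r) J)"
  have X_scale: "X (\<lambda>r. c * v r) \<omega> = \<bar>c\<bar> * X v \<omega>" for c v and \<omega> :: "'a \<Rightarrow> real vec \<times> real vec"
    unfolding X_def L2_set_scale[symmetric] by (simp add: sum_distrib_left mult.assoc)
  have X_tri: "X q \<omega> \<le> X v \<omega> + X (\<lambda>r. q r - v r) \<omega>" for q v and \<omega> :: "'a \<Rightarrow> real vec \<times> real vec"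
    unfolding X_def using L2_set_triangle_diff[of "\<lambda>j. \<Sum>r<d. q r * coords n U (fst (\<omega> j)) r" J "\<lambda>j. \<Sum>r<d. v r * coords n U (fst (\<omega> j)) r"]
    by (simp add: left_diff_distrib sum_subtractf)
  have upper: "rare (PiM I K) (exp (- real d)) (\<lambda>\<omega>. \<forall>v. L2_set v {..<d} \<le> 1 \<longrightarrow> X v \<omega> \<le> 36 * sqrt (real \<rho>0))"
  proof -
    have q: "0 < real d / 8" using dpos by simp
    have sgJ: "subgaussian (K j) d (\<lambda>p. coords n U (fst p)) (real d / 8)" if "j \<in> J" for j
      unfolding KJ[OF that] by (rule subgaussian_sphere)
    obtain B where B: "B \<in> sets (PiM I K)" "emeasure (PiM I K) B \<le> ennreal (exp (- (real (card J) + real d)))"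
      "\<And>\<omega> u. \<omega> \<in> space (PiM I K) \<Longrightarrow> \<omega> \<notin> B \<Longrightarrow> L2_set u {..<d} \<le> 1 \<Longrightarrow>
        X u \<omega> \<le> 2 * sqrt (20 * (real (card J) + real d) / (real d / 8))"
      unfolding X_def
      using subgaussian_operator_norm[where K=K and D=d and \<xi>="\<lambda>j p. coords n U (fst p)", OF K I sgJ q] by blast
    have "20 * (real (card J) + real d) / (real d / 8) = 160 * (real \<rho>0 + 1)" using dpos by (simp add: J field_simps)
    also have "\<dots> \<le> (18 * sqrt (real \<rho>0))\<^sup>2" using \<rho>1 by (simp add: power_mult_distrib)
    finally have "sqrt (20 * (real (card J) + real d) / (real d / 8)) \<le> 18 * sqrt (real \<rho>0)" by (intro real_le_lsqrt) auto
    then have le: "2 * sqrt (20 * (real (card J) + real d) / (real d / 8)) \<le> 36 * sqrt (real \<rho>0)" by linarith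
    show ?thesis
    proof (rule rareI[OF B(1)])
      have "exp (- (real (card J) + real d)) \<le> exp (- real d)" by simp
      then show "emeasure (PiM I K) B \<le> ennreal (exp (- real d))" using B(2) by (meson ennreal_leI order_trans)
    qed (use B(3) le order_trans in blast)
  qed
  obtain Q0 :: "(nat \<Rightarrow> real) set" where Q0: "finite Q0" "real (card Q0) \<le> (6 * 2 ^ E) ^ d"
    "\<And>u. L2_set u {..<d} \<le> 1 \<Longrightarrow> \<exists>q\<in>Q0. L2_set (\<lambda>i. u i - q i) {..<d} \<le> 1 / real E"
    using net_exists[OF Epos, where D=d] by blast
  \<comment> \<open>Points within 1 / E of a unit vector have norm at least 1/2; for shorter ones no
    useful lower bound could hold.\<close>
  define Q where "Q = {q \<in> Q0. 1 / 2 \<le> L2_set q {..<d}}"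
  have fQ: "finite Q" using Q0 by (simp add: Q_def)
  have cQ: "card Q \<le> card Q0" using Q0 by (intro card_mono) (auto simp: Q_def)
  have lowQ: "rare (PiM I K) ((1 / 8) ^ card J) (\<lambda>\<omega>. sqrt (real \<rho>0) / 4608 \<le> X q \<omega>)" if q: "q \<in> Q" for q
  proof -
    define m where "m = L2_set q {..<d}"
    have m: "1 / 2 \<le> m" using q by (simp add: Q_def m_def)
    define u where "u = (\<lambda>r. (1 / m) * q r)"
    have u1: "L2_set u {..<d} = 1" unfolding u_def L2_set_scale using m by (simp add: m_def[symmetric])
    \<comment> \<open>With 768 translates the slab has probability at most e / 769 <= 1/256, the
      threshold in \<open>PiM_many_rare_events\<close>.\<close>
    define h where "h = 1 / (2 * real 768 * sqrt (real d))"
    have h: "0 < h" using dpos by (simp add: h_def)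
    define A where "A = {p \<in> space law. \<bar>\<Sum>r<d. u r * coords n U (fst p) r\<bar> < h}"
    have As: "A \<in> sets law" unfolding A_def h_def by (rule law_slab(1)[OF u1]) simp
    have "emeasure law A \<le> ennreal (exp 1 / (real 768 + 1))" unfolding A_def h_def by (rule law_slab(2)[OF u1]) simp
    also have "\<dots> \<le> ennreal (1 / 256)" using exp_le by (intro ennreal_leI) simp
    finally have Ap: "emeasure law A \<le> ennreal (1 / 256)" .
    let ?B = "{\<omega> \<in> space (PiM I K). card J \<le> 2 * card {j \<in> J. \<omega> j \<in> A}}"
    have B: "?B \<in> sets (PiM I K)" "emeasure (PiM I K) ?B \<le> ennreal ((1 / 8) ^ card J)"
      by (rule PiM_many_rare_events[OF K I]; use As Ap KJ in simp)+
    show ?thesis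
    proof (rule rareI[OF B])
      fix \<omega> assume \<omega>: "\<omega> \<in> space (PiM I K)" "\<omega> \<notin> ?B"
      define J1 where "J1 = {j \<in> J. \<omega> j \<notin> A}"
      have fJ: "finite J" using I finite_subset by blast
      have "card J = card {j \<in> J. \<omega> j \<in> A} + card J1"
      proof -
        have "J = {j \<in> J. \<omega> j \<in> A} \<union> J1" "{j \<in> J. \<omega> j \<in> A} \<inter> J1 = {}" by (auto simp: J1_def)
        then show ?thesis using fJ card_Un_disjoint[of "{j \<in> J. \<omega> j \<in> A}" J1] by (simp add: J1_def)
      qed
      then have cJ1: "real \<rho>0 * real d \<le> 2 * real (card J1)" using \<omega> J by (simp flip: of_nat_mult)
      have big: "h / 2 \<le> \<bar>\<Sum>r<d. q r * coords n U (fst (\<omega> j)) r\<bar>" if "j \<in> J1" for j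
      proof -
        have j: "j \<in> J" "j \<in> I" using that I(2) by (auto simp: J1_def)
        have "\<omega> j \<in> space (K j)" using \<omega>(1) j(2) unfolding space_PiM by (rule PiE_mem)
        then have "\<omega> j \<in> space law" by (simp only: KJ[OF j(1)])
        then have "h \<le> \<bar>\<Sum>r<d. u r * coords n U (fst (\<omega> j)) r\<bar>" using that by (auto simp: J1_def A_def)
        moreover have "(\<Sum>r<d. q r * coords n U (fst (\<omega> j)) r) = m * (\<Sum>r<d. u r * coords n U (fst (\<omega> j)) r)"
          using m by (simp add: u_def sum_distrib_left)
        moreover have "1 / 2 * h \<le> m * \<bar>\<Sum>r<d. u r * coords n U (fst (\<omega> j)) r\<bar>"
          using m h calculation(1) by (intro mult_mono) auto
        ultimately show ?thesis using m by (simp add: abs_mult)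
      qed
      \<comment> \<open>At least rho0 d / 2 terms are at least (h / 2)^2. The denominator 8 * 1536^2
        is then enlarged to the square of 3 * 1536 = 4608.\<close>
      have "real \<rho>0 / (8 * 1536\<^sup>2) = (real \<rho>0 * real d / 2) * (h / 2)\<^sup>2"
        using dpos by (simp add: h_def power_divide power_mult_distrib)
      also have "\<dots> \<le> real (card J1) * (h / 2)\<^sup>2" using cJ1 by (intro mult_right_mono) auto
      also have "\<dots> = (\<Sum>j\<in>J1. (h / 2)\<^sup>2)" by simp
      also have "\<dots> \<le> (\<Sum>j\<in>J1. (\<Sum>r<d. q r * coords n U (fst (\<omega> j)) r)\<^sup>2)"
      proof (rule sum_mono)
        fix j assume "j \<in> J1"
        then have "(h / 2)\<^sup>2 \<le> \<bar>\<Sum>r<d. q r * coords n U (fst (\<omega> j)) r\<bar>\<^sup>2" using big h by (intro power_mono) auto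
        then show "(h / 2)\<^sup>2 \<le> (\<Sum>r<d. q r * coords n U (fst (\<omega> j)) r)\<^sup>2" by simp
      qed
      also have "\<dots> \<le> (X q \<omega>)\<^sup>2" unfolding X_def L2_set_power2 using fJ by (intro sum_mono2) (auto simp: J1_def)
      finally have "real \<rho>0 / (8 * 1536\<^sup>2) \<le> (X q \<omega>)\<^sup>2" .
      moreover have "(sqrt (real \<rho>0) / 4608)\<^sup>2 \<le> real \<rho>0 / (8 * 1536\<^sup>2)" by (simp add: power_divide)
      ultimately have "(sqrt (real \<rho>0) / 4608)\<^sup>2 \<le> (X q \<omega>)\<^sup>2" by linarith
      then show "sqrt (real \<rho>0) / 4608 \<le> X q \<omega>" by (rule power2_le_imp_le) (simp add: X_def)
    qed
  qed
  have "real (card Q) * (1 / 8) ^ card J \<le> exp (- real d)"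
  proof -
    have "real (card Q) * (1 / 8) ^ card J \<le> (6 * 2 ^ E) ^ d * ((1 / 8) ^ \<rho>0) ^ d"
      unfolding J power_mult using cQ Q0(2) by (intro mult_mono) auto
    also have "\<dots> = (6 * 2 ^ E * (1 / 8) ^ \<rho>0) ^ d" by (simp add: power_mult_distrib)
    also have "\<dots> \<le> exp (- 1) ^ d"
    proof (intro power_mono)
      have "(1 / 8 :: real) ^ \<rho>0 \<le> (1 / 8) ^ (E + 2)" using \<rho>0 by (intro power_decreasing) auto
      also have "\<dots> = (1 / 64) * (1 / 8) ^ E" by (simp add: power_add power2_eq_square)
      finally have "6 * 2 ^ E * (1 / 8 :: real) ^ \<rho>0 \<le> 6 * 2 ^ E * ((1 / 64) * (1 / 8) ^ E)" by (intro mult_left_mono) auto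
      also have "\<dots> = (6 / 64) * (2 * (1 / 8)) ^ E" unfolding power_mult_distrib by simp
      also have "\<dots> \<le> (6 / 64) * 1" by (intro mult_left_mono power_le_one) auto
      also have "\<dots> \<le> exp (- 1)" using exp_le by (simp add: exp_minus field_simps)
      finally show "6 * 2 ^ E * (1 / 8 :: real) ^ \<rho>0 \<le> exp (- 1)" .
    qed simp
    also have "\<dots> = exp (- real d)" by (simp flip: exp_of_nat_mult)
    finally show ?thesis .
  qed
  from rare_mono[OF rare_ball[OF fQ _ lowQ] this]
  have lower: "rare (PiM I K) (exp (- real d)) (\<lambda>\<omega>. \<forall>q\<in>Q. sqrt (real \<rho>0) / 4608 \<le> X q \<omega>)" by simp
  show ?thesis
  proof (rule rare_mono[OF rare_conj[OF upper lower]])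
    fix \<omega> assume "(\<forall>v. L2_set v {..<d} \<le> 1 \<longrightarrow> X v \<omega> \<le> 36 * sqrt (real \<rho>0)) \<and> (\<forall>q\<in>Q. sqrt (real \<rho>0) / 4608 \<le> X q \<omega>)"
    then have up: "\<And>v. L2_set v {..<d} \<le> 1 \<Longrightarrow> X v \<omega> \<le> 36 * sqrt (real \<rho>0)"
      and lo: "\<And>q. q \<in> Q \<Longrightarrow> sqrt (real \<rho>0) / 4608 \<le> X q \<omega>" by auto
    have unit: "sqrt (real \<rho>0) / 9216 \<le> X u \<omega>" if u: "L2_set u {..<d} = 1" for u
    proof -
      obtain q where q: "q \<in> Q0" "L2_set (\<lambda>i. u i - q i) {..<d} \<le> 1 / real E" using Q0(3)[of u] u by auto
      have "L2_set u {..<d} \<le> L2_set q {..<d} + L2_set (\<lambda>i. u i - q i) {..<d}" by (rule L2_set_triangle_diff)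
      then have "q \<in> Q" using q u by (simp add: Q_def E)
      \<comment> \<open>The difference, blown up by E, still lies in the unit ball, and 36 / E = 1 /
        9216.\<close>
      have "L2_set (\<lambda>r. real E * (q r - u r)) {..<d} \<le> 1"
        unfolding L2_set_scale using q(2) by (simp add: L2_set_minus_commute[of q] E)
      then have "X (\<lambda>r. real E * (q r - u r)) \<omega> \<le> 36 * sqrt (real \<rho>0)" by (rule up)
      then have "real E * X (\<lambda>r. q r - u r) \<omega> \<le> 36 * sqrt (real \<rho>0)" by (simp only: X_scale abs_of_nat)
      then have "X (\<lambda>r. q r - u r) \<omega> \<le> sqrt (real \<rho>0) / 9216" by (simp add: E)
      then show ?thesis using X_tri[of q \<omega> u] lo[OF \<open>q \<in> Q\<close>] by linarith
    qed
    have "L2_set v {..<d} \<le> 9216 / sqrt (real \<rho>0) * X v \<omega>" for v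
    proof (cases "L2_set v {..<d} = 0")
      case True
      then show ?thesis by (simp add: X_def)
    next
      case False
      define m where "m = L2_set v {..<d}"
      have m: "0 < m" using False L2_set_nonneg[of v "{..<d}"] unfolding m_def by linarith
      have "L2_set (\<lambda>r. (1 / m) * v r) {..<d} = 1" unfolding L2_set_scale using m by (simp add: m_def[symmetric])
      then have "sqrt (real \<rho>0) / 9216 \<le> X (\<lambda>r. (1 / m) * v r) \<omega>" by (rule unit)
      also have "\<dots> = X v \<omega> / m" unfolding X_scale using m by simp
      finally show ?thesis using m \<rho>1 by (simp add: m_def[symmetric] field_simps)
    qed
    then show "\<forall>v. L2_set v {..<d} \<le> 9216 / sqrt (real \<rho>0) * L2_set (\<lambda>j. \<Sum>r<d. v r * coords n U (fst (\<omega> j)) r) J"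
      by (simp add: X_def)
  qed auto
qed

text \<open>Given all the other points, the direction of \<open>x\<^sub>i\<close> is uniform, so it is unlikely to be close to the
  span of a few of them. Restricting to rational coefficients makes the event measurable.\<close>
lemma rare_near_span:
  assumes K: "\<And>j. prob_space (K j)" and I: "finite I" "i \<in> I" and Ki: "K i = law"
    and KI: "\<And>j. j \<in> I \<Longrightarrow> sets (K j) = sets (borel_vec n \<Otimes>\<^sub>M borel_vec n)"
    and H: "H \<subseteq> I - {i}"
  shows "rare (PiM I K) (1536 ^ card H * (1 / 2) ^ d)
    (\<lambda>\<omega>. \<not> (\<exists>c\<in>PiE H (\<lambda>_. \<rat>). L2_set (\<lambda>r. coords n U (fst (\<omega> i)) r -
      (\<Sum>j\<in>H. c j * (coords n U (fst (\<omega> j)) r + coords n U (snd (\<omega> j)) r))) {..<d} < 1 / 4))"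
proof -
  let ?P = "PiM I K"
  let ?D = "\<lambda>c \<omega>. L2_set (\<lambda>r. coords n U (fst (\<omega> i)) r -
      (\<Sum>j\<in>H. c j * (coords n U (fst (\<omega> j)) r + coords n U (snd (\<omega> j)) r))) {..<d}"
  let ?C = "PiE H (\<lambda>_. \<rat>) :: ('a \<Rightarrow> real) set"
  have fH: "finite H" using H I finite_subset by blast
  have C: "countable ?C" using fH by (intro countable_PiE countable_rat) auto
  have cf: "(\<lambda>\<omega>. coords n U (fst (\<omega> j)) r) \<in> borel_measurable ?P"
    and cs: "(\<lambda>\<omega>. coords n U (snd (\<omega> j)) r) \<in> borel_measurable ?P" if "j \<in> I" for j r
  proof -
    have m: "(\<lambda>\<omega>. \<omega> j) \<in> measurable ?P (borel_vec n \<Otimes>\<^sub>M borel_vec n)"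
      using measurable_component_singleton[OF that, of K] unfolding measurable_cong_sets[OF refl KI[OF that]] .
    show "(\<lambda>\<omega>. coords n U (fst (\<omega> j)) r) \<in> borel_measurable ?P"
      by (rule measurable_compose[OF measurable_compose[OF m measurable_fst] coords_measurable])
    show "(\<lambda>\<omega>. coords n U (snd (\<omega> j)) r) \<in> borel_measurable ?P"
      by (rule measurable_compose[OF measurable_compose[OF m measurable_snd] coords_measurable])
  qed
  have Dm: "?D c \<in> borel_measurable ?P" for c
    by (intro borel_measurable_L2_set borel_measurable_diff borel_measurable_sum borel_measurable_times
        borel_measurable_const borel_measurable_add cf cs) (use H I in auto)
  define B where "B = (\<Union>c\<in>?C. {\<omega> \<in> space ?P. ?D c \<omega> < 1 / 4})"
  have B: "B \<in> sets ?P"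
    unfolding B_def
  proof (rule sets.countable_UN'[OF C], safe)
    show "{\<omega> \<in> space ?P. ?D c \<omega> < 1 / 4} \<in> sets ?P" for c
      by (intro borel_measurable_less borel_measurable_const Dm)
  qed
  show ?thesis
  proof (rule rareI[OF B])
    show "emeasure ?P B \<le> ennreal (1536 ^ card H * (1 / 2) ^ d)"
    proof (rule emeasure_PiM_le_fibre[OF K I B])
      fix \<omega> assume "\<omega> \<in> space (PiM (I - {i}) K)"
      define w where "w = (\<lambda>j r. coords n U (fst (\<omega> j)) r + coords n U (snd (\<omega> j)) r)"
      define A where "A = {x \<in> carrier_vec n. \<exists>c\<in>?C. L2_set (\<lambda>r. coords n U x r - (\<Sum>j\<in>H. c j * w j r)) {..<d} < 1 / 4}"
      have Du: "?D c (fun_upd \<omega> i y) = L2_set (\<lambda>r. coords n U (fst y) r - (\<Sum>j\<in>H. c j * w j r)) {..<d}" for c y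
      proof (rule L2_set_cong[OF refl])
        fix r
        have "(\<Sum>j\<in>H. c j * (coords n U (fst ((fun_upd \<omega> i y) j)) r + coords n U (snd ((fun_upd \<omega> i y) j)) r)) = (\<Sum>j\<in>H. c j * w j r)"
          using H by (intro sum.cong) (auto simp: w_def)
        then show "coords n U (fst ((fun_upd \<omega> i y) i)) r - (\<Sum>j\<in>H. c j * (coords n U (fst ((fun_upd \<omega> i y) j)) r + coords n U (snd ((fun_upd \<omega> i y) j)) r))
          = coords n U (fst y) r - (\<Sum>j\<in>H. c j * w j r)" by simp
      qed
      have "{y \<in> space (K i). (fun_upd \<omega> i y) \<in> B} \<subseteq> {p \<in> space law. fst p \<in> A}"
      proof
        fix y assume y: "y \<in> {y \<in> space (K i). (fun_upd \<omega> i y) \<in> B}"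
        then obtain c where "c \<in> ?C" "?D c (fun_upd \<omega> i y) < 1 / 4" by (auto simp only: B_def UN_iff mem_Collect_eq)
        then have "\<exists>c\<in>?C. L2_set (\<lambda>r. coords n U (fst y) r - (\<Sum>j\<in>H. c j * w j r)) {..<d} < 1 / 4" unfolding Du by blast
        then show "y \<in> {p \<in> space law. fst p \<in> A}" using y by (auto simp: Ki space_law A_def)
      qed
      moreover have "{p \<in> space law. fst p \<in> A} \<in> sets law"
      proof -
        have "A = (\<Union>c\<in>?C. {x \<in> space (borel_vec n). L2_set (\<lambda>r. coords n U x r - (\<Sum>j\<in>H. c j * w j r)) {..<d} < 1 / 4})"
          by (auto simp: A_def)
        also have "\<dots> \<in> sets (borel_vec n)"
        proof (rule sets.countable_UN'[OF C], safe)
          show "{x \<in> space (borel_vec n). L2_set (\<lambda>r. coords n U x r - (\<Sum>j\<in>H. c j * w j r)) {..<d} < 1 / 4} \<in> sets (borel_vec n)" for c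
            by (intro borel_measurable_less borel_measurable_const borel_measurable_L2_set borel_measurable_diff coords_measurable)
        qed
        finally show ?thesis using measurable_sets[OF fst_measurable, of A] by (simp add: vimage_def Int_def conj_commute)
      qed
      ultimately have "emeasure (K i) {y \<in> space (K i). (fun_upd \<omega> i y) \<in> B} \<le> emeasure law {p \<in> space law. fst p \<in> A}"
        unfolding Ki by (intro emeasure_mono)
      also have "\<dots> \<le> ennreal (1536 ^ card H * (1 / 2) ^ d)"
        unfolding A_def by (rule law_near_span[OF fH C])
      finally show "emeasure (K i) {y \<in> space (K i). (fun_upd \<omega> i y) \<in> B} \<le> ennreal (1536 ^ card H * (1 / 2) ^ d)" .
    qed
  qed (auto simp: B_def)
qed

text \<open>The locale describes the group of the point j; \<open>V\<close> is a basis of the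
  subspace projected onto, later that of y_i. For the noiseless part the inverse variance d / 8
  cancels the d in the Frobenius bound and leaves 8 alpha^2 s. The noise sees e unit columns at
  inverse variance n / (4 sigma^2).\<close>

lemma rare_large_projection:
  fixes V :: "real mat" and e :: nat
  assumes K: "\<And>j. prob_space (K j)" and I: "finite I" "j \<in> I" and Kj: "K j = law"
    and V: "\<And>r. r < e \<Longrightarrow> (\<Sum>i<n. (V $$ (i, r))\<^sup>2) = 1" and e: "0 < e"
    and fro: "(\<Sum>r<e. \<Sum>k<d. (\<Sum>i<n. V $$ (i, r) * U $$ (i, k))\<^sup>2) \<le> real d * \<alpha>\<^sup>2" and \<alpha>: "0 < \<alpha>"
  shows "rare (PiM I K) (18 * exp (- s)) (\<lambda>\<omega>. fst (\<omega> j) \<in> well_placed \<longrightarrow>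
    L2_set (\<lambda>r. coords n V (fst (\<omega> j)) r + coords n V (snd (\<omega> j)) r) {..<e} \<le>
      sqrt (8 * \<alpha>\<^sup>2 * s) + sqrt (4 * \<sigma>\<^sup>2 * real e * s / real n))"
proof -
  have dpos: "0 < real d" using d by simp
  have npos: "0 < real n" using n_pos by simp
  define M where "M = (\<lambda>r k. \<Sum>i<n. V $$ (i, r) * U $$ (i, k))"
  let ?A = "{p \<in> space law. s * (real d * \<alpha>\<^sup>2) / (real d / 8) \<le> (\<Sum>r<e. (\<Sum>k<d. M r k * coords n U (fst p) k)\<^sup>2)}"
  let ?B = "{p \<in> space law. s * real e / (real n / (4 * \<sigma>\<^sup>2)) \<le> (\<Sum>r<e. (\<Sum>i<n. V $$ (i, r) * snd p $ i)\<^sup>2)}"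
  have A: "?A \<in> sets law" "emeasure law ?A \<le> ennreal (9 * exp (- s))"
    by (rule subgaussian_matrix_tail[OF subgaussian_sphere prob_law]; use dpos \<alpha> fro in \<open>simp add: M_def\<close>)+
  have fV: "(\<Sum>r<e. \<Sum>i<n. (V $$ (i, r))\<^sup>2) \<le> real e" using V by simp
  have B: "?B \<in> sets law" "emeasure law ?B \<le> ennreal (9 * exp (- s))"
    by (rule subgaussian_matrix_tail[OF subgaussian_noise prob_law]; use npos \<sigma> e fV in simp)+
  have "rare (PiM I K) (9 * exp (- s)) (\<lambda>\<omega>. \<omega> j \<notin> ?A)"
    by (rule rare_component[where K=K and j=j, OF K I, unfolded Kj, OF A])
  moreover have "rare (PiM I K) (9 * exp (- s)) (\<lambda>\<omega>. \<omega> j \<notin> ?B)"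
    by (rule rare_component[where K=K and j=j, OF K I, unfolded Kj, OF B])
  ultimately have "rare (PiM I K) (9 * exp (- s) + 9 * exp (- s)) (\<lambda>\<omega>. \<omega> j \<notin> ?A \<and> \<omega> j \<notin> ?B)"
    by (rule rare_conj) simp_all
  then show ?thesis
  proof (rule rare_mono)
    fix \<omega> assume \<omega>: "\<omega> \<in> space (PiM I K)" and AB: "\<omega> j \<notin> ?A \<and> \<omega> j \<notin> ?B"
    have sp: "\<omega> j \<in> space law" using \<omega> I Kj by (auto simp: space_PiM PiE_iff)
    show "fst (\<omega> j) \<in> well_placed \<longrightarrow>
      L2_set (\<lambda>r. coords n V (fst (\<omega> j)) r + coords n V (snd (\<omega> j)) r) {..<e} \<le>
      sqrt (8 * \<alpha>\<^sup>2 * s) + sqrt (4 * \<sigma>\<^sup>2 * real e * s / real n)"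
    proof
      assume wp: "fst (\<omega> j) \<in> well_placed"
      have "coords n V (fst (\<omega> j)) r = (\<Sum>k<d. M r k * coords n U (fst (\<omega> j)) k)" for r
      proof -
        have "coords n V (fst (\<omega> j)) r = (\<Sum>i<n. \<Sum>k<d. V $$ (i, r) * U $$ (i, k) * coords n U (fst (\<omega> j)) k)"
          unfolding coords_def[of n V] using wp by (auto simp: well_placed_def sum_distrib_left mult.assoc intro!: sum.cong)
        also have "\<dots> = (\<Sum>k<d. M r k * coords n U (fst (\<omega> j)) k)"
          unfolding M_def by (subst sum.swap) (simp add: sum_distrib_right)
        finally show ?thesis .
      qed
      then have "(\<Sum>r<e. (coords n V (fst (\<omega> j)) r)\<^sup>2) \<le> s * (real d * \<alpha>\<^sup>2) / (real d / 8)" using AB sp by simp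
      also have "\<dots> = 8 * \<alpha>\<^sup>2 * s" using dpos by simp
      finally have 1: "L2_set (coords n V (fst (\<omega> j))) {..<e} \<le> sqrt (8 * \<alpha>\<^sup>2 * s)"
        unfolding L2_set_def by (rule real_sqrt_le_mono)
      have "(\<Sum>r<e. (coords n V (snd (\<omega> j)) r)\<^sup>2) \<le> s * real e / (real n / (4 * \<sigma>\<^sup>2))" using AB sp by (simp add: coords_def)
      also have "\<dots> = 4 * \<sigma>\<^sup>2 * real e * s / real n" using npos \<sigma> by (simp add: field_simps)
      finally have 2: "L2_set (coords n V (snd (\<omega> j))) {..<e} \<le> sqrt (4 * \<sigma>\<^sup>2 * real e * s / real n)"
        unfolding L2_set_def by (rule real_sqrt_le_mono)
      show "L2_set (\<lambda>r. coords n V (fst (\<omega> j)) r + coords n V (snd (\<omega> j)) r) {..<e} \<le>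
        sqrt (8 * \<alpha>\<^sup>2 * s) + sqrt (4 * \<sigma>\<^sup>2 * real e * s / real n)"
        using L2_set_triangle_ineq[of "coords n V (fst (\<omega> j))" "coords n V (snd (\<omega> j))" "{..<e}"] 1 2 by linarith
    qed
  qed simp
qed

end

section \<open>The union bound and its consequence for a single outcome\<close>

lemma ln2_bounds: "1 / 2 \<le> ln (2::real)" "ln (2::real) \<le> 1"
  using ln_2_less_1 ln_le_minus_one[of "1/2::real"] by (auto simp: ln_div)

text \<open>The last factor bounds the probability that the span of a given pair of subsets comes close to a
  random direction, see \<open>rare_near_span\<close>.\<close>
lemma small_subsets_union_bound:
  assumes d: "1 \<le> d" and N: "2 \<le> N" and \<rho>: "3 \<le> \<rho>"
    and T: "finite T" "real (card T) \<le> \<rho> * real d" and F: "finite F" "card F \<le> N"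
    and s: "real s * ln (real N) \<le> real d / 368"
  defines "k \<equiv> 1 / 256 * (real d / ln \<rho>)"
  shows "real (card ({A. A \<subseteq> T \<and> real (card A) \<le> k} \<times> {G. G \<subseteq> F \<and> real (card G) \<le> real s})) *
    (exp (11 * (k + real s)) * (1 / 2) ^ d) \<le> 3 * exp (- (1 / 4) * real d)"
proof -
  have dp: "0 < real d" using d by simp
  have ln\<rho>: "1 \<le> ln \<rho>" using \<rho> exp_le by (subst ln_ge_iff) auto
  have k: "k * ln \<rho> = real d / 256" "0 \<le> k" using ln\<rho> dp by (auto simp: k_def)
  have kd: "k \<le> real d / 256" using k ln\<rho> mult_left_mono[OF ln\<rho> k(2)] by simp
  have lnN: "1 / 2 \<le> ln (real N)"
  proof -
    have "ln 2 \<le> ln (real N)" using N by simp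
    then show ?thesis using ln2_bounds by linarith
  qed
  have sd: "real s \<le> real d / 184" using s mult_left_mono[OF lnN, of "real s"] by simp
  \<comment> \<open>The weight 1 / (16 rho) makes the linear term at most d / 16. The other term is
    k (ln rho + ln 16) <= d / 256 + 4 k, where ln rho >= 1 bounds k by d / 256.\<close>
  have "real (card {A. A \<subseteq> T \<and> real (card A) \<le> k}) \<le> exp (1 / (16 * \<rho>) * real (card T) + k * ln (1 / (1 / (16 * \<rho>))))"
    by (rule card_small_subsets) (use T \<rho> in auto)
  also have "\<dots> \<le> exp (real d / 16 + 5 * (real d / 256))"
  proof -
    have "1 / (16 * \<rho>) * real (card T) \<le> real d / 16" using T(2) \<rho> by (simp add: field_simps)
    moreover have "ln (16::real) \<le> 4" using ln_realpow[of 2 4] ln2_bounds by simp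
    then have "k * ln 16 \<le> k * 4" using k by (intro mult_left_mono)
    then have "k * ln (1 / (1 / (16 * \<rho>))) \<le> 5 * (real d / 256)" using k kd \<rho> by (simp add: ln_mult distrib_left)
    ultimately show ?thesis by simp
  qed
  finally have cT: "real (card {A. A \<subseteq> T \<and> real (card A) \<le> k}) \<le> exp (real d / 16 + 5 * (real d / 256))" .
  have "real (card {G. G \<subseteq> F \<and> real (card G) \<le> real s}) \<le> exp (1 / real N * real (card F) + real s * ln (1 / (1 / real N)))"
    by (rule card_small_subsets) (use F N in auto)
  also have "\<dots> \<le> exp (1 + real d / 368)"
  proof -
    have "1 / real N * real (card F) \<le> 1" using F(2) N by (simp add: divide_le_eq)
    then show ?thesis using s by simp
  qed
  finally have cF: "real (card {G. G \<subseteq> F \<and> real (card G) \<le> real s}) \<le> exp (1 + real d / 368)" .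
  have half: "(1 / 2 :: real) ^ d \<le> exp (- (real d / 2))"
  proof -
    have "1 / 2 \<le> exp (- (1 / 2) :: real)" using exp_ge_add_one_self[of "- (1/2) :: real"] by simp
    then have "(1 / 2 :: real) ^ d \<le> exp (- (1 / 2)) ^ d" by (intro power_mono) auto
    also have "\<dots> = exp (- (real d / 2))" by (simp flip: exp_of_nat_mult)
    finally show ?thesis .
  qed
  have "real (card ({A. A \<subseteq> T \<and> real (card A) \<le> k} \<times> {G. G \<subseteq> F \<and> real (card G) \<le> real s})) *
    (exp (11 * (k + real s)) * (1 / 2) ^ d)
    \<le> (exp (real d / 16 + 5 * (real d / 256)) * exp (1 + real d / 368)) * (exp (11 * (k + real s)) * exp (- (real d / 2)))"
    unfolding card_cartesian_product of_nat_mult by (intro mult_mono cT cF half) auto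
  also have "\<dots> = exp (real d / 16 + 5 * (real d / 256) + (1 + real d / 368) + (11 * (k + real s) + - (real d / 2)))"
    by (simp only: mult_exp_exp)
  \<comment> \<open>In units of d the positive terms are 1/16 + 5/256 + 1/368 + 11 (1/256 + 1/184) <
    1/4, against -1/2 from the volume.\<close>
  also have "\<dots> \<le> exp (1 + - (1 / 4) * real d)" using kd sd dp by simp
  also have "\<dots> = exp 1 * exp (- (1 / 4) * real d)" by (rule exp_add)
  also have "\<dots> \<le> 3 * exp (- (1 / 4) * real d)" using exp_le by (intro mult_right_mono) auto
  finally show ?thesis .
qed

lemma power_1536_le: "real m \<le> x \<Longrightarrow> (1536::real) ^ m \<le> exp (11 * x)"
proof -
  assume m: "real m \<le> x"
  have "(1536::real) \<le> 2 ^ 11" by simp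
  also have "\<dots> \<le> exp 1 ^ 11" using exp_ge_add_one_self[of "1::real"] by (intro power_mono) auto
  also have "\<dots> = exp 11" by (simp flip: exp_of_nat_mult)
  finally have "(1536::real) ^ m \<le> exp 11 ^ m" by (intro power_mono) auto
  also have "\<dots> = exp (11 * real m)" by (simp add: mult.commute flip: exp_of_nat_mult)
  finally show ?thesis using m by (simp add: order_trans[of _ "exp (11 * real m)"])
qed

text \<open>The points in \<open>T'\<close> represent \<open>x\<^sub>i\<close> in the first step; \<open>s\<close> is the
  sparsity to which the contribution of the other groups is reduced.\<close>
lemma discoveries_of_good_point:
  fixes \<omega> :: "nat \<Rightarrow> real vec \<times> real vec" and U :: "real mat" and n N d s :: nat
  defines "p \<equiv> \<lambda>j r. coords n U (fst (\<omega> j)) r + coords n U (snd (\<omega> j)) r"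
  assumes \<omega>: "\<And>j. j < N \<Longrightarrow> fst (\<omega> j) \<in> carrier_vec n \<and> snd (\<omega> j) \<in> carrier_vec n"
    and i: "i < N" and \<sigma>: "0 < \<sigma>" "\<sigma> < 1 / 100"
    and U: "\<And>s t. s < d \<Longrightarrow> t < d \<Longrightarrow> (\<Sum>k<n. U $$ (k, s) * U $$ (k, t)) = (if s = t then 1 else 0)"
    and f: "\<And>t. 0 < t \<Longrightarrow> 0 < f t \<and> 0.707 * \<sigma> * inverse t \<le> f t \<and> f t \<le> 1 / 800 * inverse t"
    and placed: "\<And>j. j < N \<Longrightarrow> grp j = grp i \<Longrightarrow>
      (\<forall>k<n. fst (\<omega> j) $ k = (\<Sum>r<d. U $$ (k, r) * coords n U (fst (\<omega> j)) r)) \<and> L2_set (coords n U (fst (\<omega> j))) {..<d} \<le> 1"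
    and T': "T' \<subseteq> {j. j < N \<and> grp j = grp i \<and> j \<noteq> i}" "card T' = 10 ^ 12 * d"
    and zi: "L2_set (\<lambda>k. snd (\<omega> i) $ k) {..<n} \<le> 3 / 2 * \<sigma>"
    and op: "\<And>u. L2_set u {..<n} \<le> 1 \<Longrightarrow> L2_set (\<lambda>j. \<Sum>k<n. u k * snd (\<omega> j) $ k) T' \<le> 26 * \<sigma>"
    and low: "\<And>v. L2_set v {..<d} \<le> 9216 / 10 ^ 6 * L2_set (\<lambda>j. \<Sum>r<d. v r * coords n U (fst (\<omega> j)) r) T'"
    and W: "\<And>j. j < N \<Longrightarrow> grp j \<noteq> grp i \<Longrightarrow> L2_set (p j) {..<d} \<le> W" "0 \<le> W"
    and s: "18432 * sqrt (real d) * W \<le> 1 / 16 \<or> 0 < s \<and> 18432 * sqrt (real d) * W / sqrt (real s) \<le> 1 / 16"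
    and far: "\<And>T0 G c. T0 \<subseteq> {j. j < N \<and> grp j = grp i \<and> j \<noteq> i} \<Longrightarrow> real (card T0) \<le> k \<Longrightarrow>
      G \<subseteq> {j. j < N \<and> grp j \<noteq> grp i} \<Longrightarrow> card G \<le> s \<Longrightarrow> c \<in> PiE (T0 \<union> G) (\<lambda>_. \<rat>) \<Longrightarrow>
      \<not> L2_set (\<lambda>r. coords n U (fst (\<omega> i)) r - (\<Sum>j\<in>T0 \<union> G. c j * p j r)) {..<d} < 1 / 4"
    and k: "0 \<le> k"
    and out: "two_step_output conv (data_matrix n N \<omega>) i (2 * \<sigma>) f \<beta>"
  shows "k \<le> real (card (true_discoveries grp i \<beta>))"
proof -
  let ?Y = "data_matrix n N \<omega>"
  let ?res = "\<lambda>\<beta> k. (fst (\<omega> i) $ k + snd (\<omega> i) $ k) - (\<Sum>j<N. \<beta> $ j * (fst (\<omega> j) $ k + snd (\<omega> j) $ k))"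
  have residual: "l2norm (col ?Y i - ?Y *\<^sub>v \<beta>) = L2_set (?res \<beta>) {..<n}" if "\<beta> \<in> carrier_vec N" for \<beta>
    by (rule data_matrix_residual[OF that i \<omega>])
  have bes: "L2_set (\<lambda>r. \<Sum>k<n. U $$ (k, r) * g k) {..<d} \<le> L2_set g {..<n}" for g
    by (rule bessel[where q="\<lambda>r k. U $$ (k, r)"]) (rule U)
  have projected: "L2_set (\<lambda>r. p i r - (\<Sum>j<N. \<beta> $ j * p j r)) {..<d} \<le> L2_set (?res \<beta>) {..<n}" for \<beta>
  proof -
    have "p i r - (\<Sum>j<N. \<beta> $ j * p j r) = (\<Sum>k<n. U $$ (k, r) * ?res \<beta> k)" for r
    proof -
      have "(\<Sum>k<n. U $$ (k, r) * (\<Sum>j<N. \<beta> $ j * (fst (\<omega> j) $ k + snd (\<omega> j) $ k))) =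
          (\<Sum>k<n. \<Sum>j<N. \<beta> $ j * (U $$ (k, r) * fst (\<omega> j) $ k + U $$ (k, r) * snd (\<omega> j) $ k))"
        by (intro sum.cong refl) (simp add: sum_distrib_left algebra_simps)
      also have "\<dots> = (\<Sum>j<N. \<beta> $ j * p j r)"
        by (subst sum.swap) (simp add: p_def coords_def sum_distrib_left sum.distrib distrib_left)
      finally show ?thesis by (simp add: p_def coords_def right_diff_distrib distrib_left sum.distrib sum_subtractf)
    qed
    then show ?thesis using bes[of "?res \<beta>"] by simp
  qed
  have pa: "L2_set (\<lambda>r. p i r - coords n U (fst (\<omega> i)) r) {..<d} \<le> 3 / 2 * \<sigma>"
    using bes[of "\<lambda>k. snd (\<omega> i) $ k"] zi by (simp add: p_def coords_def)
  have iT: "i \<notin> T'" using T' by auto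
  obtain \<gamma> where \<gamma>: "\<And>j. j \<notin> T' \<Longrightarrow> \<gamma> j = 0" "(\<Sum>j<N. \<bar>\<gamma> j\<bar>) \<le> sqrt (real (card T')) * (9216 / 10 ^ 6)"
    "L2_set (\<lambda>k. (fst (\<omega> i) $ k + snd (\<omega> i) $ k) - (\<Sum>j<N. \<gamma> j * (fst (\<omega> j) $ k + snd (\<omega> j) $ k))) {..<n} \<le> 2 * \<sigma>"
  proof (rule feasible_coefficients[where T=T' and N=N and b="9216 / 10 ^ 6" and i=i and n=n and d=d and
        x="\<lambda>j k. fst (\<omega> j) $ k" and z="\<lambda>j k. snd (\<omega> j) $ k" and a="\<lambda>j. coords n U (fst (\<omega> j))" and
        U="\<lambda>k r. U $$ (k, r)" and K="26 * \<sigma>" and e="3 / 2 * \<sigma>" and \<tau>="2 * \<sigma>"])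
    show "T' \<subseteq> {..<N}" using T' by auto
    show "fst (\<omega> j) $ k = (\<Sum>r<d. U $$ (k, r) * coords n U (fst (\<omega> j)) r)" if "j \<in> insert i T'" "k < n" for j k
      using placed[of j] that T' i by auto
    show "L2_set (coords n U (fst (\<omega> i))) {..<d} \<le> 1" using placed[OF i] by simp
    show "L2_set (\<lambda>k. snd (\<omega> i) $ k) {..<n} \<le> 3 / 2 * \<sigma>" by (rule zi)
    \<comment> \<open>z_i uses 1.5 sigma of the tolerance and the representing points about 0.24
      sigma; the l2 bound of the coefficients is 9216 / sqrt (10^12).\<close>
    show "3 / 2 * \<sigma> + 9216 / 10 ^ 6 * (26 * \<sigma>) \<le> 2 * \<sigma>" using \<sigma> by simp
  qed (use low op in auto)
  define b0 where "b0 = vec N \<gamma>"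
  have b0c: "b0 \<in> carrier_vec N" by (simp add: b0_def)
  have feas: "step1_feasible ?Y i (2 * \<sigma>) b0"
  proof -
    have "?res b0 = (\<lambda>k. (fst (\<omega> i) $ k + snd (\<omega> i) $ k) - (\<Sum>j<N. \<gamma> j * (fst (\<omega> j) $ k + snd (\<omega> j) $ k)))"
      by (rule ext) (simp add: b0_def)
    then show ?thesis using \<gamma>(1)[OF iT] \<gamma>(3) i residual[OF b0c] by (simp add: step1_feasible_def b0_def)
  qed
  have b0l: "l1norm b0 \<le> 9216 * sqrt (real d)"
  proof -
    have "sqrt (real (card T')) = 10 ^ 6 * sqrt (real d)"
    proof -
      have "real (card T') = (10 ^ 6)\<^sup>2 * real d" by (simp add: T'(2))
      then show ?thesis by (simp only: real_sqrt_mult real_sqrt_abs) simp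
    qed
    then show ?thesis using \<gamma>(2) by (simp add: l1norm_eq[OF b0c]) (simp add: b0_def)
  qed
  \<comment> \<open>Since \<open>b0\<close> is feasible, the convention can apply only if 0 solves
    the first step, and then 0 is feasible.\<close>
  consider (run) \<beta>s where "step1_solution ?Y i (2 * \<sigma>) \<beta>s" "\<beta>s \<noteq> 0\<^sub>v N" "step3_solution ?Y i (f (l1norm \<beta>s)) \<beta>"
    | (degenerate) "step1_feasible ?Y i (2 * \<sigma>) (0\<^sub>v N)"
    using out feas unfolding two_step_output_def step1_solution_def is_arg_min_def by auto
  then show ?thesis
  proof cases
    case run
    have "\<beta>s \<in> carrier_vec N" using run(1) by (simp add: step1_solution_def is_arg_min_def step1_feasible_def)
    then have "0 < l1norm \<beta>s" using run(2) by (rule l1norm_pos)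
    note ft = f[OF this]
    have \<beta>: "\<beta> \<in> carrier_vec N" "\<beta> $ i = 0" using run(3) by (auto simp: step3_solution_def is_arg_min_def)
    have cmp: "l1norm \<beta> \<le> 2 * l1norm b0" "l2norm (col ?Y i - ?Y *\<^sub>v \<beta>) \<le> 6 / 100"
      using two_step_comparison[OF run(1) _ run(3) feas \<sigma>(1)] run(2) \<sigma>(2) ft by simp_all
    let ?F = "{j. j < N \<and> grp j \<noteq> grp i}"
    let ?T0 = "{j. j < N \<and> j \<notin> ?F \<and> \<beta> $ j \<noteq> 0}"
    obtain G c where G: "G \<subseteq> ?F" "card G \<le> s" "c \<in> PiE (?T0 \<union> G) (\<lambda>_. \<rat>)"
      "L2_set (\<lambda>r. coords n U (fst (\<omega> i)) r - (\<Sum>j\<in>?T0 \<union> G. c j * p j r)) {..<d} < 1 / 4"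
    proof (rule sparse_approximation[where p=p and i=i and N=N and \<beta>="\<lambda>j. \<beta> $ j" and A="{..<d}" and ?e1.0="6 / 100" and
          a="coords n U (fst (\<omega> i))" and ?e2.0="3 / 2 * \<sigma>" and F="?F" and B="18432 * sqrt (real d)" and W=W and \<delta>="1 / 16" and s=s])
      show "L2_set (\<lambda>r. p i r - (\<Sum>j<N. \<beta> $ j * p j r)) {..<d} \<le> 6 / 100"
        using projected[of \<beta>] cmp(2) residual[OF \<beta>(1)] by linarith
      show "(\<Sum>j<N. \<bar>\<beta> $ j\<bar>) \<le> 18432 * sqrt (real d)" using cmp(1) b0l l1norm_eq[OF \<beta>(1)] by linarith
      \<comment> \<open>Residual of the fit, projected noise of y_i, and Maurey error.\<close>
      show "6 / 100 + 3 / 2 * \<sigma> + 1 / 16 < 1 / 4" using \<sigma> by simp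
    qed (use pa W s in auto)
    have T0: "?T0 = true_discoveries grp i \<beta>" using \<beta>(1) by (auto simp: true_discoveries_def)
    show ?thesis
    proof (rule ccontr)
      assume "\<not> k \<le> real (card (true_discoveries grp i \<beta>))"
      then have "real (card ?T0) \<le> k" unfolding T0 by linarith
      moreover have "?T0 \<subseteq> {j. j < N \<and> grp j = grp i \<and> j \<noteq> i}" using \<beta>(2) by auto
      ultimately show False using far[of ?T0 G c] G by blast
    qed
  next
    case degenerate
    have "L2_set (?res (0\<^sub>v N)) {..<n} \<le> 2 * \<sigma>"
      using degenerate residual[of "0\<^sub>v N"] by (simp add: step1_feasible_def)
    then have "L2_set (\<lambda>r. p i r - (\<Sum>j<N. 0\<^sub>v N $ j * p j r)) {..<d} \<le> 2 * \<sigma>" using projected[of "0\<^sub>v N"] by linarith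
    then have "L2_set (p i) {..<d} \<le> 2 * \<sigma>" by simp
    moreover have "L2_set (coords n U (fst (\<omega> i))) {..<d} \<le> L2_set (p i) {..<d} + L2_set (\<lambda>r. coords n U (fst (\<omega> i)) r - p i r) {..<d}"
      by (rule L2_set_triangle_diff)
    moreover have "L2_set (\<lambda>r. coords n U (fst (\<omega> i)) r - p i r) {..<d} \<le> 3 / 2 * \<sigma>" using pa by (simp add: L2_set_minus_commute)
    ultimately have "L2_set (coords n U (fst (\<omega> i))) {..<d} < 1 / 4" using \<sigma> by linarith
    \<comment> \<open>Feasibility of 0 would place the direction of x_i near the empty span. The
      constantly \<open>undefined\<close> function is the one element of the product over the empty
      index set.\<close>
    then show ?thesis using far[of "{}" "{}" "\<lambda>_. undefined"] k by simp
  qed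
qed

section \<open>The main estimate\<close>

text \<open>Origin of the constants. The noise budget 26 * 9216 / sqrt rho0 <= 1/2 forces rho0 above
  2.2 * 10^11; 10^12 is a convenient square, and the extra 1 accounts for y_i itself. sigma < 1/100
  and alpha_0 = 1/800 keep the residual below 6/100. kappa_0 = 10^(-8) offsets the l1 bound 18432
  sqrt d in the choice of s, and c_0 = kappa_0^2 puts the projected noise on the same scale. The
  exponent 1/4 comes from the union bound.\<close>

lemma discoveries_with_high_probability:
  fixes n N L :: nat and S :: "nat \<Rightarrow> real vec set" and d grp Ns :: "nat \<Rightarrow> nat" and \<rho> :: "nat \<Rightarrow> real"
    and \<sigma> :: real and f :: "real \<Rightarrow> real" and conv :: "real mat \<Rightarrow> real vec"
  assumes N: "2 \<le> N"
    and S: "\<And>l. l < L \<Longrightarrow> linear_subspace n (S l) \<and> subspace_dim n (S l) = d l \<and> 1 \<le> d l"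
    and grp: "\<And>j. j < N \<Longrightarrow> grp j < L"
    and Ns: "\<And>l. l < L \<Longrightarrow> Ns l = card {j. j < N \<and> grp j = l}"
    and \<rho>: "\<And>l. l < L \<Longrightarrow> \<rho> l = real (Ns l) / real (d l)"
    and \<sigma>: "0 < \<sigma>" "\<sigma> < 1 / 100"
    and dn: "\<And>l. l < L \<Longrightarrow> real (d l) < 1 / 10 ^ 16 * (real n / (ln (real N))\<^sup>2)"
    and i: "i < N"
    and aff: "\<And>k. k < L \<Longrightarrow> k \<noteq> grp i \<Longrightarrow> affinity n (S (grp i)) (S k) \<le> 1 / 10 ^ 8 / ln (real N)"
    and \<rho>i: "10 ^ 12 + 1 \<le> \<rho> (grp i)"
    and f: "\<And>t. 0 < t \<Longrightarrow> 0 < f t \<and> 0.707 * \<sigma> * inverse t \<le> f t \<and> f t \<le> 1 / 800 * inverse t"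
  shows "\<exists>E \<in> sets (semirandom_model n N S grp \<sigma>).
    measure (semirandom_model n N S grp \<sigma>) E \<ge> 1 - 2 * exp (- (1 / 8) * real n) - 6 * exp (- (1 / 4) * real (d (grp i))) - 23 / (real N)\<^sup>2 \<and>
    (\<forall>\<omega>\<in>E. \<forall>\<beta>. two_step_output conv (data_matrix n N \<omega>) i (2 * \<sigma>) f \<beta> \<longrightarrow>
      1 / 256 * (real (d (grp i)) / ln (\<rho> (grp i))) \<le> real (card (true_discoveries grp i \<beta>)))"
proof -
  define l where "l = grp i"
  define e where "e = d l"
  have lL: "l < L" using grp[OF i] by (simp add: l_def)
  have PL: "point_law n (d k) (S k) \<sigma>" if "k < L" for k
    using S[OF that] \<sigma> by unfold_locales auto
  interpret P: point_law n e "S l" \<sigma> unfolding e_def by (rule PL[OF lL])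
  \<comment> \<open>Extends the group map beyond N so that every factor \<open>K j\<close>, not only
    those with j < N, is a probability measure.\<close>
  define g where "g = (\<lambda>j. grp (if j < N then j else i))"
  have gL: "g j < L" for j using grp i by (simp add: g_def)
  have gj: "g j = grp j" if "j < N" for j using that by (simp add: g_def)
  define K where "K = (\<lambda>j. point_law.law n (S (g j)) \<sigma>)"
  have K: "prob_space (K j)" for j unfolding K_def by (rule point_law.prob_law[OF PL[OF gL]])
  have Kl: "K j = P.law" if "j < N" "grp j = l" for j using that by (simp add: K_def gj)
  have KI: "sets (K j) = sets (borel_vec n \<Otimes>\<^sub>M borel_vec n)" for j
    unfolding K_def by (rule point_law.sets_law[OF PL[OF gL]])
  let ?I = "{..<N}"
  define M where "M = PiM ?I K"
  have M: "semirandom_model n N S grp \<sigma> = M"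
    unfolding semirandom_model_def M_def K_def
    by (intro PiM_cong refl) (simp add: gj point_law.law_def[OF PL] grp)
  interpret M: prob_space M unfolding M_def by (rule prob_space_PiM[OF K])
  have fin: "finite ?I" "i \<in> ?I" using i by auto

  have e1: "1 \<le> e" by (rule P.d)
  have npos: "0 < real n" using P.n_pos by simp
  have lnN: "1 / 2 \<le> ln (real N)"
  proof -
    have "ln 2 \<le> ln (real N)" using N by simp
    then show ?thesis using ln2_bounds by linarith
  qed
  have lnN2: "0 < (ln (real N))\<^sup>2" using lnN by simp
  have en: "10 ^ 16 * (real e * (ln (real N))\<^sup>2) \<le> real n"
    using dn[OF lL] lnN2 unfolding e_def[symmetric] by (simp add: field_simps)
  define T where "T = {j. j < N \<and> grp j = l \<and> j \<noteq> i}"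
  define F where "F = {j. j < N \<and> grp j \<noteq> l}"
  have fT: "finite T" and fF: "finite F" by (auto simp: T_def F_def)
  have cT: "card T + 1 = Ns l"
  proof -
    have "{j. j < N \<and> grp j = l} = insert i T" using i by (auto simp: T_def l_def)
    then show ?thesis using Ns[OF lL] fT by (simp add: T_def)
  qed
  have Nse: "real (Ns l) = \<rho> l * real e" using \<rho>[OF lL] e1 by (simp add: e_def)
  have \<rho>l: "10 ^ 12 + 1 \<le> \<rho> l" using \<rho>i by (simp add: l_def)
  have "(10 ^ 12 + 1) * real e \<le> \<rho> l * real e" using \<rho>l by (intro mult_right_mono) auto
  moreover have "real (Ns l) = real (card T) + 1" unfolding cT[symmetric] by simp
  moreover have "real (10 ^ 12 * e) = 10 ^ 12 * real e" "1 \<le> real e" using e1 by simp_all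
  ultimately have "real (10 ^ 12 * e) \<le> real (card T)" using Nse by (simp only: distrib_right)
  then have "10 ^ 12 * e \<le> card T" by (simp only: of_nat_le_iff)
  \<comment> \<open>Chosen without looking at the data, and of a fixed size even if the group is
    much larger, so that it has at most n elements.\<close>
  then obtain T' where T': "T' \<subseteq> T" "card T' = 10 ^ 12 * e" by (rule obtain_subset_with_card_n)
  have T'I: "T' \<subseteq> ?I" using T'(1) by (auto simp: T_def)
  have KT': "K j = P.law" if "j \<in> T'" for j using that T'(1) by (intro Kl) (auto simp: T_def)
  have T'n: "card T' \<le> n"
  proof -
    have "(1 / 2)\<^sup>2 \<le> (ln (real N))\<^sup>2" using lnN by (intro power_mono) auto
    then have "real e * (1 / 4) \<le> real e * (ln (real N))\<^sup>2" by (intro mult_left_mono) (auto simp: power_divide)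
    then have "real (10 ^ 12 * e) \<le> real n" using en by simp
    then show ?thesis unfolding T'(2) by (simp only: of_nat_le_iff)
  qed

  define placed where "placed = (\<lambda>\<omega> :: nat \<Rightarrow> real vec \<times> real vec. \<forall>j\<in>?I. fst (\<omega> j) \<in> point_law.well_placed n (d (grp j)) (S (grp j)))"
  have R0: "rare M 0 placed"
  proof -
    have "rare M (real (card ?I) * 0) (\<lambda>\<omega>. \<forall>j\<in>?I. fst (\<omega> j) \<in> point_law.well_placed n (d (grp j)) (S (grp j)))"
    proof (rule rare_ball)
      fix j assume j: "j \<in> ?I"
      interpret Q: point_law n "d (grp j)" "S (grp j)" \<sigma> by (rule PL) (use grp j in auto)
      have Kj: "K j = Q.law" using j by (simp add: K_def gj)
      let ?A = "{p \<in> space Q.law. fst p \<in> carrier_vec n - Q.well_placed}"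
      have A: "?A \<in> sets (K j)"
      proof -
        have "carrier_vec n - Q.well_placed \<in> sets (borel_vec n)"
          using sets.Diff[OF sets.top[of "borel_vec n"] Q.well_placed_sets] by simp
        from measurable_sets[OF Q.fst_measurable this] show ?thesis
          by (simp add: Kj vimage_def Int_def conj_commute)
      qed
      have "rare M 0 (\<lambda>\<omega>. \<omega> j \<notin> ?A)"
        unfolding M_def by (rule rare_component[where K=K, OF K fin(1) j A]) (simp only: Kj Q.emeasure_not_well_placed ennreal_0)
      then show "rare M 0 (\<lambda>\<omega>. fst (\<omega> j) \<in> Q.well_placed)"
      proof (rule rare_mono)
        fix \<omega> assume \<omega>: "\<omega> \<in> space M" "\<omega> j \<notin> ?A"
        have "\<omega> j \<in> space (K j)" using \<omega>(1) j unfolding M_def space_PiM by (rule PiE_mem)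
        then show "fst (\<omega> j) \<in> Q.well_placed" using \<omega>(2) by (auto simp: Kj Q.space_law)
      qed simp
    qed auto
    then show ?thesis by (simp add: placed_def)
  qed

  have R1: "rare M (exp (- (1 / 8) * real n)) (\<lambda>\<omega>. L2_set (\<lambda>k. snd (\<omega> i) $ k) {..<n} \<le> 3 / 2 * \<sigma>)"
  proof -
    let ?A = "{p \<in> space P.law. 3 / 2 * \<sigma> \<le> L2_set (\<lambda>k. snd p $ k) {..<n}}"
    have Ki: "K i = P.law" using i by (intro Kl) (auto simp: l_def)
    have "rare M (exp (- (1 / 8) * real n)) (\<lambda>\<omega>. \<omega> i \<notin> ?A)"
      unfolding M_def by (rule rare_component[where K=K, OF K fin]; unfold Ki) (rule P.noise_tail)+
    then show ?thesis
    proof (rule rare_mono)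
      fix \<omega> assume \<omega>: "\<omega> \<in> space M" "\<omega> i \<notin> ?A"
      have "\<omega> i \<in> space (K i)" using \<omega>(1) fin(2) unfolding M_def space_PiM by (rule PiE_mem)
      then have "\<not> 3 / 2 * \<sigma> \<le> L2_set (\<lambda>k. snd (\<omega> i) $ k) {..<n}" using \<omega>(2) by (simp add: Ki)
      then show "L2_set (\<lambda>k. snd (\<omega> i) $ k) {..<n} \<le> 3 / 2 * \<sigma>" by linarith
    qed simp
  qed

  have R2: "rare M (exp (- (1 / 8) * real n))
    (\<lambda>\<omega>. \<forall>u. L2_set u {..<n} \<le> 1 \<longrightarrow> L2_set (\<lambda>j. \<Sum>k<n. u k * snd (\<omega> j) $ k) T' \<le> 26 * \<sigma>)"
    unfolding M_def by (rule P.rare_noise_operator_norm[where K=K, OF K fin(1) T'I KT' T'n])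

  have R3: "rare M (2 * exp (- real e))
    (\<lambda>\<omega>. \<forall>v. L2_set v {..<e} \<le> 9216 / 10 ^ 6 * L2_set (\<lambda>j. \<Sum>r<e. v r * coords n P.U (fst (\<omega> j)) r) T')"
  proof -
    have "sqrt (real (10 ^ 12)) = sqrt ((10 ^ 6)\<^sup>2)" by simp
    also have "\<dots> = 10 ^ 6" by (subst real_sqrt_abs) simp
    finally have "sqrt (real (10 ^ 12)) = 10 ^ 6" .
    then show ?thesis
      using P.rare_lower_singular_value[where K=K and ?\<rho>0.0="10 ^ 12" and E=331776, OF K fin(1) T'I KT' T'(2) refl]
      unfolding M_def by simp
  qed

  define \<eta> where "\<eta> = 1 / 10 ^ 8 / ln (real N)"
  have \<eta>: "0 < \<eta>" using lnN by (simp add: \<eta>_def)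
  \<comment> \<open>With b = 10^(-8) / sqrt (ln N), the projected x_j contributes at most 5 b and
    the projected noise at most 4 b.\<close>
  define W where "W = 9 / 10 ^ 8 / sqrt (ln (real N))"
  have W0: "0 \<le> W" using lnN by (simp add: W_def)
  \<comment> \<open>The level 3 ln N makes each point fail with probability at most 18 / N^3, so all
    of them together cost 18 / N^2.\<close>
  have R4: "rare M (real (card F) * (18 * exp (- (3 * ln (real N)))))
    (\<lambda>\<omega>. \<forall>j\<in>F. fst (\<omega> j) \<in> point_law.well_placed n (d (grp j)) (S (grp j)) \<longrightarrow>
      L2_set (\<lambda>r. coords n P.U (fst (\<omega> j)) r + coords n P.U (snd (\<omega> j)) r) {..<e} \<le> W)"
  proof (rule rare_ball[OF fF])
    fix j assume j: "j \<in> F"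
    then have jN: "j < N" and jl: "grp j \<noteq> l" by (auto simp: F_def)
    interpret Q: point_law n "d (grp j)" "S (grp j)" \<sigma> by (rule PL) (use grp jN in auto)
    have Kj: "K j = Q.law" using jN by (simp add: K_def gj)
    have fro: "(\<Sum>r<e. \<Sum>k<d (grp j). (\<Sum>m<n. P.U $$ (m, r) * Q.U $$ (m, k))\<^sup>2) \<le> real (d (grp j)) * \<eta>\<^sup>2"
    proof -
      have "(\<Sum>r<e. \<Sum>k<d (grp j). (\<Sum>m<n. P.U $$ (m, r) * Q.U $$ (m, k))\<^sup>2) \<le> real (d (grp j)) * (affinity n (S l) (S (grp j)))\<^sup>2"
        unfolding P.U_def Q.U_def by (rule frobenius_le_affinity[OF P.lin P.dim P.d Q.lin Q.dim Q.d])
      also have "\<dots> \<le> real (d (grp j)) * \<eta>\<^sup>2"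
      proof (intro mult_left_mono power_mono)
        show "affinity n (S l) (S (grp j)) \<le> \<eta>" using aff[of "grp j"] jl grp jN by (simp add: l_def \<eta>_def)
        show "0 \<le> affinity n (S l) (S (grp j))"
          unfolding affinity_def by (intro real_sqrt_ge_zero divide_nonneg_nonneg sum_list_nonneg) auto
      qed simp
      finally show ?thesis .
    qed
    have unit: "(\<Sum>m<n. (P.U $$ (m, r))\<^sup>2) = 1" if "r < e" for r
      using P.U_cols[OF that that] by (simp add: power2_eq_square)
    have jI: "j \<in> ?I" using jN by simp
    have epos: "0 < e" using e1 by simp
    have large: "rare M (18 * exp (- (3 * ln (real N)))) (\<lambda>\<omega>. fst (\<omega> j) \<in> Q.well_placed \<longrightarrow>
      L2_set (\<lambda>r. coords n P.U (fst (\<omega> j)) r + coords n P.U (snd (\<omega> j)) r) {..<e} \<le>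
        sqrt (8 * \<eta>\<^sup>2 * (3 * ln (real N))) + sqrt (4 * \<sigma>\<^sup>2 * real e * (3 * ln (real N)) / real n))"
      unfolding M_def by (rule Q.rare_large_projection[where K=K, OF K fin(1) jI Kj unit epos fro \<eta>])
    have le: "sqrt (8 * \<eta>\<^sup>2 * (3 * ln (real N))) + sqrt (4 * \<sigma>\<^sup>2 * real e * (3 * ln (real N)) / real n) \<le> W"
    proof -
      define b where "b = 1 / 10 ^ 8 / sqrt (ln (real N))"
      have b: "0 \<le> b" "b\<^sup>2 = 1 / 10 ^ 16 / ln (real N)" using lnN by (auto simp: b_def power_divide)
      have "8 * \<eta>\<^sup>2 * (3 * ln (real N)) = 24 * b\<^sup>2" using lnN unfolding b \<eta>_def by (simp add: power_divide power2_eq_square)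
      also have "\<dots> \<le> (5 * b)\<^sup>2" by (simp add: power_mult_distrib)
      finally have 1: "sqrt (8 * \<eta>\<^sup>2 * (3 * ln (real N))) \<le> 5 * b" using b by (intro real_le_lsqrt) auto
      have "4 * \<sigma>\<^sup>2 * real e * (3 * ln (real N)) / real n \<le> 4 * 1 * real e * (3 * ln (real N)) / real n"
        using \<sigma> lnN by (intro divide_right_mono mult_right_mono mult_left_mono power_le_one) auto
      also have "\<dots> \<le> 12 * b\<^sup>2" using en npos lnN unfolding b by (simp add: field_simps power2_eq_square)
      also have "\<dots> \<le> (4 * b)\<^sup>2" by (simp add: power_mult_distrib)
      finally have 2: "sqrt (4 * \<sigma>\<^sup>2 * real e * (3 * ln (real N)) / real n) \<le> 4 * b" using b by (intro real_le_lsqrt) auto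
      show ?thesis using 1 2 by (simp add: W_def b_def)
    qed
    show "rare M (18 * exp (- (3 * ln (real N)))) (\<lambda>\<omega>. fst (\<omega> j) \<in> Q.well_placed \<longrightarrow>
      L2_set (\<lambda>r. coords n P.U (fst (\<omega> j)) r + coords n P.U (snd (\<omega> j)) r) {..<e} \<le> W)"
      by (rule rare_mono[OF large order_refl]) (use le in \<open>auto intro: order_trans\<close>)
  qed simp

  \<comment> \<open>The sparsity at which Maurey's error equals 1/16. If x <= 1 the contribution is
    dropped and s = 0: rounding up to 1 would cost ln N in the union bound, which may exceed d. For
    x > 1 rounding at most doubles x.\<close>
  define x where "x = (16 * (18432 * sqrt (real e) * W))\<^sup>2"
  define s where "s = (if x \<le> 1 then 0 else nat \<lceil>x\<rceil>)"
  have BW: "0 \<le> 16 * (18432 * sqrt (real e) * W)" using W0 by simp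
  have sx: "18432 * sqrt (real e) * W \<le> 1 / 16 \<or> 0 < s \<and> 18432 * sqrt (real e) * W / sqrt (real s) \<le> 1 / 16"
  proof (cases "x \<le> 1")
    case True
    then have "(16 * (18432 * sqrt (real e) * W))\<^sup>2 \<le> 1\<^sup>2" by (simp only: x_def one_power2)
    then have "16 * (18432 * sqrt (real e) * W) \<le> 1" by (rule power2_le_imp_le) simp
    then show ?thesis by simp
  next
    case False
    then have s: "0 < s" "x \<le> real s" by (auto simp: s_def)
    have "16 * (18432 * sqrt (real e) * W) = sqrt x"
      by (simp only: x_def real_sqrt_abs abs_of_nonneg[OF BW])
    also have "\<dots> \<le> sqrt (real s)" using s by simp
    finally show ?thesis using s by (simp add: pos_divide_le_eq)
  qed
  have sN: "real s * ln (real N) \<le> real e / 368"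
  proof (cases "x \<le> 1")
    case False
    have "real s \<le> 2 * x" using False by (simp add: s_def) linarith
    then have "real s * ln (real N) \<le> 2 * x * ln (real N)" using lnN by (intro mult_right_mono) auto
    also have "W\<^sup>2 = 81 / 10 ^ 16 / ln (real N)" using lnN by (simp add: W_def power_divide)
    \<comment> \<open>The factor 1 / ln N in W^2 cancels ln N; the remaining coefficient is about
      0.0014, below 1/368.\<close>
    then have "2 * x * ln (real N) = 2 * (16 * 18432)\<^sup>2 * 81 / 10 ^ 16 * real e"
      using lnN by (simp add: x_def power_mult_distrib)
    also have "\<dots> \<le> real e / 368" by simp
    finally show ?thesis .
  qed (simp add: s_def)

  define k where "k = 1 / 256 * (real e / ln (\<rho> l))"
  have \<rho>3: "3 \<le> \<rho> l" using \<rho>l by simp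
  have k0: "0 \<le> k" using \<rho>3 by (simp add: k_def)
  \<comment> \<open>Index sets fixed in advance: any output with too few true discoveries would put
    x_i near the span belonging to one of these pairs.\<close>
  define \<T> where "\<T> = {A. A \<subseteq> T \<and> real (card A) \<le> k} \<times> {G. G \<subseteq> F \<and> real (card G) \<le> real s}"
  have f\<T>: "finite \<T>" unfolding \<T>_def using fT fF by (intro finite_cartesian_product) auto
  define far where "far = (\<lambda>H \<omega>. \<not> (\<exists>c\<in>PiE H (\<lambda>_. \<rat>). L2_set (\<lambda>r. coords n P.U (fst (\<omega> i)) r -
      (\<Sum>j\<in>H. c j * (coords n P.U (fst (\<omega> j)) r + coords n P.U (snd (\<omega> j)) r))) {..<e} < 1 / 4))"
  have R5: "rare M (3 * exp (- (1 / 4) * real e)) (\<lambda>\<omega>. \<forall>q\<in>\<T>. far (fst q \<union> snd q) \<omega>)"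
  proof -
    have "rare M (real (card \<T>) * (exp (11 * (k + real s)) * (1 / 2) ^ e)) (\<lambda>\<omega>. \<forall>q\<in>\<T>. far (fst q \<union> snd q) \<omega>)"
    proof (rule rare_ball[OF f\<T>])
      fix q assume q: "q \<in> \<T>"
      have H: "fst q \<union> snd q \<subseteq> ?I - {i}" using q by (auto simp: \<T>_def T_def F_def l_def)
      have Ki: "K i = P.law" using i by (intro Kl) (auto simp: l_def)
      have "rare M (1536 ^ card (fst q \<union> snd q) * (1 / 2) ^ e) (far (fst q \<union> snd q))"
        unfolding M_def far_def by (rule P.rare_near_span[where K=K, OF K fin Ki KI H])
      then show "rare M (exp (11 * (k + real s)) * (1 / 2) ^ e) (far (fst q \<union> snd q))"
      proof (rule rare_mono)
        have "card (fst q \<union> snd q) \<le> card (fst q) + card (snd q)" by (rule card_Un_le)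
        then have "real (card (fst q \<union> snd q)) \<le> k + real s" using q by (auto simp: \<T>_def)
        then show "1536 ^ card (fst q \<union> snd q) * (1 / 2) ^ e \<le> exp (11 * (k + real s)) * (1 / 2) ^ e"
          by (intro mult_right_mono power_1536_le) auto
      qed
    qed simp
    moreover have "real (card \<T>) * (exp (11 * (k + real s)) * (1 / 2) ^ e) \<le> 3 * exp (- (1 / 4) * real e)"
      unfolding \<T>_def k_def
    proof (rule small_subsets_union_bound[OF e1 N \<rho>3 fT _ fF _ sN])
      show "real (card T) \<le> \<rho> l * real e" using cT Nse by linarith
      have "F \<subseteq> ?I" by (auto simp: F_def)
      then show "card F \<le> N" using card_mono[of ?I F] by simp
    qed
    ultimately show ?thesis by (rule rare_mono) auto
  qed

  let ?p = "0 + (exp (- (1 / 8) * real n) + (exp (- (1 / 8) * real n) + (2 * exp (- real e) +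
    (real (card F) * (18 * exp (- (3 * ln (real N)))) + 3 * exp (- (1 / 4) * real e)))))"
  note R = rare_conj[OF R0 rare_conj[OF R1 rare_conj[OF R2 rare_conj[OF R3 rare_conj[OF R4 R5]]]]]
  have "rare M ?p (\<lambda>\<omega>. \<forall>\<beta>. two_step_output conv (data_matrix n N \<omega>) i (2 * \<sigma>) f \<beta> \<longrightarrow> k \<le> real (card (true_discoveries grp i \<beta>)))"
  proof (rule rare_mono[OF R])
    fix \<omega>
    assume \<omega>: "\<omega> \<in> space M"
    assume "placed \<omega> \<and> L2_set (\<lambda>k. snd (\<omega> i) $ k) {..<n} \<le> 3 / 2 * \<sigma> \<and>
      (\<forall>u. L2_set u {..<n} \<le> 1 \<longrightarrow> L2_set (\<lambda>j. \<Sum>k<n. u k * snd (\<omega> j) $ k) T' \<le> 26 * \<sigma>) \<and>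
      (\<forall>v. L2_set v {..<e} \<le> 9216 / 10 ^ 6 * L2_set (\<lambda>j. \<Sum>r<e. v r * coords n P.U (fst (\<omega> j)) r) T') \<and>
      (\<forall>j\<in>F. fst (\<omega> j) \<in> point_law.well_placed n (d (grp j)) (S (grp j)) \<longrightarrow>
        L2_set (\<lambda>r. coords n P.U (fst (\<omega> j)) r + coords n P.U (snd (\<omega> j)) r) {..<e} \<le> W) \<and>
      (\<forall>q\<in>\<T>. far (fst q \<union> snd q) \<omega>)"
    then have pl: "placed \<omega>" and z: "L2_set (\<lambda>k. snd (\<omega> i) $ k) {..<n} \<le> 3 / 2 * \<sigma>"
      and op: "\<And>u. L2_set u {..<n} \<le> 1 \<Longrightarrow> L2_set (\<lambda>j. \<Sum>k<n. u k * snd (\<omega> j) $ k) T' \<le> 26 * \<sigma>"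
      and low: "\<And>v. L2_set v {..<e} \<le> 9216 / 10 ^ 6 * L2_set (\<lambda>j. \<Sum>r<e. v r * coords n P.U (fst (\<omega> j)) r) T'"
      and Wj: "\<And>j. j \<in> F \<Longrightarrow> fst (\<omega> j) \<in> point_law.well_placed n (d (grp j)) (S (grp j)) \<Longrightarrow>
        L2_set (\<lambda>r. coords n P.U (fst (\<omega> j)) r + coords n P.U (snd (\<omega> j)) r) {..<e} \<le> W"
      and fr: "\<And>q. q \<in> \<T> \<Longrightarrow> far (fst q \<union> snd q) \<omega>" by blast+
    have pl': "fst (\<omega> j) \<in> point_law.well_placed n (d (grp j)) (S (grp j))" if "j < N" for j
      using pl that by (simp add: placed_def)
    have carrier: "fst (\<omega> j) \<in> carrier_vec n \<and> snd (\<omega> j) \<in> carrier_vec n" if "j < N" for j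
    proof -
      have "\<omega> j \<in> space (K j)" using \<omega> that unfolding M_def space_PiM by (auto simp: PiE_iff)
      also have "space (K j) = carrier_vec n \<times> carrier_vec n"
        unfolding K_def by (rule point_law.space_law[OF PL[OF gL]])
      finally show ?thesis by auto
    qed
    show "\<forall>\<beta>. two_step_output conv (data_matrix n N \<omega>) i (2 * \<sigma>) f \<beta> \<longrightarrow> k \<le> real (card (true_discoveries grp i \<beta>))"
    proof (intro allI impI)
      fix \<beta> assume out: "two_step_output conv (data_matrix n N \<omega>) i (2 * \<sigma>) f \<beta>"
      show "k \<le> real (card (true_discoveries grp i \<beta>))"
      proof (rule discoveries_of_good_point[OF carrier i \<sigma> P.U_cols f _ _ T'(2) z op low _ W0 sx _ k0 out])
        show "(\<forall>k<n. fst (\<omega> j) $ k = (\<Sum>r<e. P.U $$ (k, r) * coords n P.U (fst (\<omega> j)) r)) \<and> L2_set (coords n P.U (fst (\<omega> j))) {..<e} \<le> 1"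
          if "j < N" "grp j = grp i" for j
          using pl'[OF that(1)] that(2) by (simp add: l_def[symmetric] e_def[symmetric] P.well_placed_def)
        show "T' \<subseteq> {j. j < N \<and> grp j = grp i \<and> j \<noteq> i}" using T'(1) by (simp add: T_def l_def)
        show "L2_set (\<lambda>r. coords n P.U (fst (\<omega> j)) r + coords n P.U (snd (\<omega> j)) r) {..<e} \<le> W"
          if "j < N" "grp j \<noteq> grp i" for j
          using Wj[OF _ pl'[OF that(1)]] that by (simp add: F_def l_def)
        fix T0 G and c :: "nat \<Rightarrow> real"
        assume A: "T0 \<subseteq> {j. j < N \<and> grp j = grp i \<and> j \<noteq> i}" "real (card T0) \<le> k"
          "G \<subseteq> {j. j < N \<and> grp j \<noteq> grp i}" "card G \<le> s" and c: "c \<in> PiE (T0 \<union> G) (\<lambda>_. \<rat>)"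
        have "(T0, G) \<in> \<T>" using A by (simp add: \<T>_def T_def F_def l_def)
        from fr[OF this] c
        show "\<not> L2_set (\<lambda>r. coords n P.U (fst (\<omega> i)) r - (\<Sum>j\<in>T0 \<union> G. c j * (coords n P.U (fst (\<omega> j)) r + coords n P.U (snd (\<omega> j)) r))) {..<e} < 1 / 4"
          unfolding far_def by auto
      qed
    qed
  qed auto
  then obtain B where B: "B \<in> sets M" "emeasure M B \<le> ennreal ?p"
    "\<And>\<omega> \<beta>. \<omega> \<in> space M \<Longrightarrow> \<omega> \<notin> B \<Longrightarrow> two_step_output conv (data_matrix n N \<omega>) i (2 * \<sigma>) f \<beta> \<Longrightarrow> k \<le> real (card (true_discoveries grp i \<beta>))"
    unfolding rare_def by blast
  \<comment> \<open>The two noise events give 2 exp (-n / 8); 2 exp (-d) and 3 exp (-d / 4) together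
    stay below 6 exp (-d / 4).\<close>
  have p: "?p \<le> 2 * exp (- (1 / 8) * real n) + 6 * exp (- (1 / 4) * real e) + 23 / (real N)\<^sup>2"
  proof -
    have Np: "0 < real N" using N by simp
    have "exp (- (3 * ln (real N))) = 1 / (real N) ^ 3"
    proof -
      have "exp (3 * ln (real N)) = exp (ln (real N)) ^ 3" by (simp flip: exp_of_nat_mult)
      then show ?thesis using Np by (simp add: exp_minus inverse_eq_divide)
    qed
    moreover have "card F \<le> N" using card_mono[of ?I F] by (force simp: F_def)
    ultimately have "real (card F) * (18 * exp (- (3 * ln (real N)))) \<le> real N * (18 * (1 / (real N) ^ 3))"
      by (simp only:) (intro mult_right_mono, auto)
    also have "\<dots> = 18 / (real N)\<^sup>2" using Np by (simp add: power2_eq_square power3_eq_cube)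
    also have "\<dots> \<le> 23 / (real N)\<^sup>2" by (intro divide_right_mono) auto
    finally have 1: "real (card F) * (18 * exp (- (3 * ln (real N)))) \<le> 23 / (real N)\<^sup>2" .
    have 2: "exp (- real e) \<le> exp (- (1 / 4) * real e)" by simp
    have 3: "0 \<le> exp (- (1 / 4) * real e)" by simp
    show ?thesis using 1 2 3 by linarith
  qed
  have "measure M B \<le> ?p"
  proof -
    have "0 \<le> ?p" by (intro add_nonneg_nonneg) auto
    then show ?thesis using B(2) by (simp only: M.emeasure_eq_measure ennreal_le_iff)
  qed
  then have "1 - ?p \<le> measure M (space M - B)" using M.prob_compl[OF B(1)] by linarith
  then have "measure M (space M - B) \<ge> 1 - 2 * exp (- (1 / 8) * real n) - 6 * exp (- (1 / 4) * real e) - 23 / (real N)\<^sup>2"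
    using p by linarith
  then show ?thesis
    unfolding M using B by (intro bexI[of _ "space M - B"] conjI) (auto simp: e_def l_def k_def)
qed

theorem theorem3p2:
  shows "\<exists>\<sigma>s c0 \<kappa>0 \<rho>s \<alpha>0 c1 \<gamma>1 \<gamma>2 :: real.
    0 < \<sigma>s \<and> \<sigma>s < 1 \<and> 0 < c0 \<and> 0 < \<kappa>0 \<and> 1 < \<rho>s \<and> 0 < \<alpha>0 \<and> 0 < c1 \<and> 0 < \<gamma>1 \<and> 0 < \<gamma>2 \<and>
    (\<forall>(n::nat) (N::nat) (L::nat) (S :: nat \<Rightarrow> real vec set) (d :: nat \<Rightarrow> nat)
       (grp :: nat \<Rightarrow> nat) (Ns :: nat \<Rightarrow> nat) (\<rho> :: nat \<Rightarrow> real) (\<sigma>::real)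
       (i::nat) (f :: real \<Rightarrow> real) (conv :: real mat \<Rightarrow> real vec).
      2 \<le> N \<longrightarrow>
      (\<forall>l<L. linear_subspace n (S l) \<and> subspace_dim n (S l) = d l \<and> 1 \<le> d l) \<longrightarrow>
      (\<forall>j<N. grp j < L) \<longrightarrow>
      (\<forall>l<L. Ns l = card {j. j < N \<and> grp j = l}) \<longrightarrow>
      (\<forall>l<L. \<rho> l = real (Ns l) / real (d l)) \<longrightarrow>
      (\<forall>l<L. \<rho> l \<le> exp (real (d l) / 2)) \<longrightarrow>
      0 < \<sigma> \<longrightarrow> \<sigma> < \<sigma>s \<longrightarrow>
      (\<forall>l<L. real (d l) < c0 * (real n / (ln (real N))\<^sup>2)) \<longrightarrow>
      i < N \<longrightarrow>
      (\<forall>k<L. k \<noteq> grp i \<longrightarrow> affinity n (S (grp i)) (S k) \<le> \<kappa>0 / ln (real N)) \<longrightarrow>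
      \<rho>s \<le> \<rho> (grp i) \<longrightarrow>
      (\<forall>t>0. 0 < f t \<and> 0.707 * \<sigma> * inverse t \<le> f t \<and> f t \<le> \<alpha>0 * inverse t) \<longrightarrow>
      (\<forall>A. conv A \<in> carrier_vec (dim_col A)) \<longrightarrow>
      (\<exists>E \<in> sets (semirandom_model n N S grp \<sigma>).
         measure (semirandom_model n N S grp \<sigma>) E
           \<ge> 1 - 2 * exp (- \<gamma>1 * real n) - 6 * exp (- \<gamma>2 * real (d (grp i)))
               - exp (- sqrt (real (Ns (grp i)) * real (d (grp i)))) - 23 / (real N)\<^sup>2 \<and>
         (\<forall>\<omega>\<in>E. \<forall>\<beta>. two_step_output conv (data_matrix n N \<omega>) i (2 * \<sigma>) f \<beta> \<longrightarrow>
            real (card (true_discoveries grp i \<beta>))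
              \<ge> c1 * (real (d (grp i)) / ln (\<rho> (grp i))))))"
proof (rule exI[of _ "1 / 100"], rule exI[of _ "1 / 10 ^ 16"], rule exI[of _ "1 / 10 ^ 8"], rule exI[of _ "10 ^ 12 + 1"],
    rule exI[of _ "1 / 800"], rule exI[of _ "1 / 256"], rule exI[of _ "1 / 8"], rule exI[of _ "1 / 4"],
    intro conjI allI impI)
  fix n N L :: nat and S :: "nat \<Rightarrow> real vec set" and d grp Ns :: "nat \<Rightarrow> nat" and \<rho> :: "nat \<Rightarrow> real"
    and \<sigma> :: real and i :: nat and f :: "real \<Rightarrow> real" and conv :: "real mat \<Rightarrow> real vec"
  assume A: "2 \<le> N" "\<forall>l<L. linear_subspace n (S l) \<and> subspace_dim n (S l) = d l \<and> 1 \<le> d l" "\<forall>j<N. grp j < L"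
    "\<forall>l<L. Ns l = card {j. j < N \<and> grp j = l}" "\<forall>l<L. \<rho> l = real (Ns l) / real (d l)"
    "0 < \<sigma>" "\<sigma> < 1 / 100" "\<forall>l<L. real (d l) < 1 / 10 ^ 16 * (real n / (ln (real N))\<^sup>2)" "i < N"
    "\<forall>k<L. k \<noteq> grp i \<longrightarrow> affinity n (S (grp i)) (S k) \<le> 1 / 10 ^ 8 / ln (real N)" "10 ^ 12 + 1 \<le> \<rho> (grp i)"
    "\<forall>t>0. 0 < f t \<and> 0.707 * \<sigma> * inverse t \<le> f t \<and> f t \<le> 1 / 800 * inverse t"
  let ?M = "semirandom_model n N S grp \<sigma>"
  obtain E where E: "E \<in> sets ?M"
    "1 - 2 * exp (- (1 / 8) * real n) - 6 * exp (- (1 / 4) * real (d (grp i))) - 23 / (real N)\<^sup>2 \<le> measure ?M E"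
    "\<forall>\<omega>\<in>E. \<forall>\<beta>. two_step_output conv (data_matrix n N \<omega>) i (2 * \<sigma>) f \<beta> \<longrightarrow>
      1 / 256 * (real (d (grp i)) / ln (\<rho> (grp i))) \<le> real (card (true_discoveries grp i \<beta>))"
    using discoveries_with_high_probability[where n=n and N=N and L=L and S=S and d=d and grp=grp and Ns=Ns and \<rho>=\<rho> and \<sigma>=\<sigma> and i=i and f=f and conv=conv] A
    by blast
  have "0 < exp (- sqrt (real (Ns (grp i)) * real (d (grp i))))" by simp
  then have "measure ?M E \<ge> 1 - 2 * exp (- (1 / 8) * real n) - 6 * exp (- (1 / 4) * real (d (grp i)))
      - exp (- sqrt (real (Ns (grp i)) * real (d (grp i)))) - 23 / (real N)\<^sup>2" using E(2) by linarith
  then show "\<exists>E \<in> sets ?M. measure ?M E \<ge> 1 - 2 * exp (- (1 / 8) * real n) - 6 * exp (- (1 / 4) * real (d (grp i)))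
      - exp (- sqrt (real (Ns (grp i)) * real (d (grp i)))) - 23 / (real N)\<^sup>2 \<and>
    (\<forall>\<omega>\<in>E. \<forall>\<beta>. two_step_output conv (data_matrix n N \<omega>) i (2 * \<sigma>) f \<beta> \<longrightarrow>
      real (card (true_discoveries grp i \<beta>)) \<ge> 1 / 256 * (real (d (grp i)) / ln (\<rho> (grp i))))"
    using E(1,3) by blast
qed simp_all

end
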